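(* Let $n,l\in\mathbb N$, $0<p_1,\dots,p_l<\infty$, $\frac1p=\frac1{p_1}+\cdots+\frac1{p_l}$, $1<u<\infty$ with $\frac1u+\frac1{u'}=1$, and $0<s<\infty$. Suppose that for all $m$ with $\mathcal A^u_s[m]<\infty$, $$\|T_m(f_1,\dots,f_l)\|_{L^p(\mathbb R^n)}\lesssim\mathcal A^u_s[m]\prod_{i=1}^l\|f_i\|_{L^{p_i}(\mathbb R^n)}$$ holds for all Schwartz $f_i$ on $\mathbb R^n$. Then necessarily $\frac sn>\max\{\frac lu,\frac1p-\frac1{u'}\}$.
   Context: For bounded $m$ on $\mathbb R^{ln}$ and Schwartz $f_i$ on $\mathbb R^n$: $T_m(f_1,\dots,f_l)(x)=\int_{(\mathbb R^n)^l}\widehat{f_1}(\xi_1)\cdots\widehat{f_l}(\xi_l)m(\xi_1,\dots,\xi_l)e^{2\pi i\langle x,\xi_1+\cdots+\xi_l\rangle}d\xi$, $\widehat f(\xi)=\int f(x)e^{-2\pi i\langle x,\xi\rangle}dx$. $\Theta$ is a fixed Schwartz function on $\mathbb R^{ln}$ with $\widehat\Theta$ supported in $\{1/2\le|\vec\xi|\le2\}$; $\|F\|_{L^u_s(\mathbb R^{ln})}=\|[(1+4\pi^2|\cdot|^2)^{s/2}\widehat F]^\vee\|_{L^u}$; $\mathcal A^u_s[m]=\sup_{k\in\mathbb Z}\|m(2^k\cdot)\widehat\Theta\|_{L^u_s(\mathbb R^{ln})}$. *)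

theory Defs
  imports "HOL-Analysis.Analysis"
begin

definition fourier :: "('a::euclidean_space \<Rightarrow> complex) \<Rightarrow> 'a \<Rightarrow> complex" where
  "fourier f \<xi> = (LINT x|lborel. f x * cis (- 2 * pi * (x \<bullet> \<xi>)))"

definition pderiv_dir :: "'a::euclidean_space \<Rightarrow> ('a \<Rightarrow> complex) \<Rightarrow> 'a \<Rightarrow> complex" where
  "pderiv_dir b g x = vector_derivative (\<lambda>t::real. g (x + t *\<^sub>R b)) (at 0)"

fun iter_pderiv :: "'a::euclidean_space list \<Rightarrow> ('a \<Rightarrow> complex) \<Rightarrow> 'a \<Rightarrow> complex" where
  "iter_pderiv [] f = f"
| "iter_pderiv (b # bs) f = pderiv_dir b (iter_pderiv bs f)"

definition schwartz :: "('a::euclidean_space \<Rightarrow> complex) \<Rightarrow> bool" where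
  "schwartz f \<longleftrightarrow>
     (\<forall>bs. set bs \<subseteq> Basis \<longrightarrow>
        continuous_on UNIV (iter_pderiv bs f) \<and>
        (\<forall>b\<in>Basis. \<forall>x. (\<lambda>t::real. iter_pderiv bs f (x + t *\<^sub>R b)) differentiable (at 0)) \<and>
        (\<forall>N::nat. \<exists>C. \<forall>x. (1 + norm x) ^ N * norm (iter_pderiv bs f x) \<le> C))"

definition lp_norm :: "real \<Rightarrow> ('a::euclidean_space \<Rightarrow> complex) \<Rightarrow> ennreal" where
  "lp_norm p f =
     (let I = (\<integral>\<^sup>+ x. ennreal (norm (f x) powr p) \<partial>lborel)
      in if I = \<infinity> then \<infinity> else ennreal (enn2real I powr (1 / p)))"

definition bessel_weight :: "real \<Rightarrow> 'a::euclidean_space \<Rightarrow> complex" where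
  "bessel_weight s \<xi> = complex_of_real ((1 + 4 * pi\<^sup>2 * (norm \<xi>)\<^sup>2) powr (s / 2))"

text \<open>Sobolev (Bessel potential) norm
  ||F||_{L^u_s} = || ((1+4 pi^2|.|^2)^{s/2} hat F)^vee ||_{L^u},
  where the inverse Fourier transform is taken in the sense of tempered distributions:
  G represents it iff hat G = w hat F as distributions, i.e.
  int G hat phi = int F hat(w phi) for all Schwartz phi.  If no such G in L^u exists,
  the norm is infinity (Inf of the empty set).\<close>
definition sobolev_norm :: "real \<Rightarrow> real \<Rightarrow> ('a::euclidean_space \<Rightarrow> complex) \<Rightarrow> ennreal" where
  "sobolev_norm u s F =
     Inf { lp_norm u G | G. G \<in> borel_measurable lborel \<and> lp_norm u G < \<infinity> \<and>
            (\<forall>\<phi>. schwartz \<phi> \<longrightarrow>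
               (LINT x|lborel. G x * fourier \<phi> x) =
               (LINT x|lborel. F x * fourier (\<lambda>\<xi>. bessel_weight s \<xi> * \<phi> \<xi>) x)) }"

definition A_norm :: "('a::euclidean_space \<Rightarrow> complex) \<Rightarrow> real \<Rightarrow> real \<Rightarrow> ('a \<Rightarrow> complex) \<Rightarrow> ennreal" where
  "A_norm \<Theta> u s m = (SUP k::int. sobolev_norm u s (\<lambda>\<xi>. m ((2 powr real_of_int k) *\<^sub>R \<xi>) * fourier \<Theta> \<xi>))"

definition T_mult :: "(real^'n^'l \<Rightarrow> complex) \<Rightarrow> ('l \<Rightarrow> real^'n \<Rightarrow> complex) \<Rightarrow> real^'n \<Rightarrow> complex" where
  "T_mult m f x = (LINT \<xi>|lborel. (\<Prod>i\<in>UNIV. fourier (f i) (\<xi> $ i)) * m \<xi> *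
                        cis (2 * pi * (x \<bullet> (\<Sum>i\<in>UNIV. \<xi> $ i))))"

end

theory Submission
  imports Defs "HOL-Probability.Probability"
begin

text \<open>
  Let \<open>w\<close> be the Bessel weight and let \<open>d = l n\<close>. A multiplier of the form \<open>m = \<chi> F(H / w)\<close>, with \<open>F\<close> the Fourier transform and
  \<open>\<chi>\<close> a cutoff near a unit vector \<open>a\<close>, meets only finitely many dyadic annuli, and on each of them its Sobolev norm is
  at most a constant times the \<open>L^u\<close> norm of \<open>F H\<close>. Indeed, multiplying by a rapidly decaying superposition of characters
  replaces \<open>H\<close> by an average of the functions \<open>w(\<lambda> y + v) / w(y) H(y)\<close>, and these ratios are \<open>L^u\<close> Fourier multipliers
  with bounds polynomial in \<open>v\<close>: after passing from \<open>1 + 4 \<pi>\<^sup>2 |y|\<^sup>2\<close> to \<open>A + 4 \<pi>\<^sup>2 |y|\<^sup>2\<close> with \<open>A\<close> of size \<open>(1 + |v|)\<^sup>2\<close>, they are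
  binomial series in a symbol of multiplier norm at most 1/2.

  Choosing \<open>H\<close> such that \<open>F H\<close> is a sum of \<open>J\<close> Gaussians of widths \<open>2^-j\<close>, each normalised in \<open>L^u\<close>, gives \<open>A[m] \<lesssim> J^(1/u)\<close>.
  All functions involved are nonnegative up to a common modulation, so on Gaussians modulated by \<open>a\<close> the operator \<open>T_m\<close>
  is bounded from below pointwise. If \<open>s \<le> d/u\<close>, Gaussians on \<open>R^d\<close> tested with inputs of width \<open>2^J\<close> give
  \<open>J \<lesssim> J^(1/u)\<close>. If \<open>s \<le> n/p - n/u'\<close> and \<open>p < u\<close>, Gaussians that depend on \<open>\<xi>_1 + ... + \<xi>_l\<close> only, up to a fixed factor,
  give \<open>J^(1/p) \<lesssim> J^(1/u)\<close>. The case \<open>p \<ge> u\<close> follows from the first condition.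
\<close>

section \<open>Integration and the Fourier transform\<close>

text \<open>The obstacle is strictness. At the critical value of \<open>s\<close> a single bump
  yields no contradiction, so the test superposes \<open>J\<close> scales that contribute equally.
  The operator adds them linearly in \<open>J\<close> where all scales meet at the same points, and
  like \<open>J^(1/p)\<close> where they occupy disjoint annuli, whereas the Sobolev norm combines
  them like an l^u sum. Letting \<open>J\<close> grow contradicts the assumed bound. Gaussians are
  chosen because inverse powers of quadratic expressions are Laplace superpositions of them. All
  multiplier bounds thereby reduce to invariance under translations and dilations and to Jensen's
  inequality, without singular integrals, Plancherel or interpolation. The function \<Theta> has
  neither a known sign nor a known shape. It enters through the support of its transform and through
  the integrability of \<open>(1 + |v|)^N \<Theta> v\<close>, which absorbs the polynomial growth of
  the multiplier bounds in \<open>v\<close>. The cutoff needs the same decay and compact support in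
  frequency, but also a nonnegative space side, since otherwise the pointwise lower bounds would be
  destroyed by cancellation.\<close>

lemma nn_integral_lborel_affine:
  fixes f :: "'a::euclidean_space \<Rightarrow> ennreal"
  assumes [measurable]: "f \<in> borel_measurable borel" and c: "c \<noteq> 0"
  shows "(\<integral>\<^sup>+x. f x \<partial>lborel) = ennreal (\<bar>c\<bar> ^ DIM('a)) * (\<integral>\<^sup>+x. f (t + c *\<^sub>R x) \<partial>lborel)"
proof -
  have "(\<integral>\<^sup>+x. f x \<partial>lborel) = (\<integral>\<^sup>+x. f x \<partial>density (distr lborel borel (\<lambda>x. t + c *\<^sub>R x)) (\<lambda>_. \<bar>c\<bar>^DIM('a)))"
    using lborel_affine[OF c, of t] by simp
  also have "\<dots> = ennreal (\<bar>c\<bar> ^ DIM('a)) * (\<integral>\<^sup>+x. f (t + c *\<^sub>R x) \<partial>lborel)"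
    by (simp add: nn_integral_density nn_integral_distr nn_integral_cmult)
  finally show ?thesis .
qed

lemma integrable_lborel_affine_iff:
  fixes f :: "'a::euclidean_space \<Rightarrow> 'b::{banach, second_countable_topology}"
  assumes c: "c \<noteq> 0"
  shows "integrable lborel (\<lambda>x. f (t + c *\<^sub>R x)) \<longleftrightarrow> integrable lborel f"
proof -
  have imp: "integrable lborel (\<lambda>x. f (t + c *\<^sub>R x))" if f: "integrable lborel f" and c: "c \<noteq> 0"
    for f :: "'a \<Rightarrow> 'b" and c t
  proof -
    have [measurable]: "f \<in> borel_measurable borel" using f by auto
    have "(\<integral>\<^sup>+x. norm (f x) \<partial>lborel) = ennreal (\<bar>c\<bar> ^ DIM('a)) * (\<integral>\<^sup>+x. norm (f (t + c *\<^sub>R x)) \<partial>lborel)"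
      by (rule nn_integral_lborel_affine) (use c in auto)
    moreover have "(\<integral>\<^sup>+x. norm (f x) \<partial>lborel) < \<infinity>"
      using f by (simp add: integrable_iff_bounded)
    ultimately have "(\<integral>\<^sup>+x. norm (f (t + c *\<^sub>R x)) \<partial>lborel) < \<infinity>"
      using c by (auto simp: ennreal_mult_less_top)
    then show ?thesis by (simp add: integrable_iff_bounded)
  qed
  show ?thesis
  proof
    assume "integrable lborel (\<lambda>x. f (t + c *\<^sub>R x))"
    from imp[OF this, of "1/c" "- (t /\<^sub>R c)"] c show "integrable lborel f"
      by (simp add: algebra_simps)
  qed (use imp c in blast)
qed

lemma integral_lborel_affine:
  fixes f :: "'a::euclidean_space \<Rightarrow> 'b::{banach, second_countable_topology}"
  assumes c: "c \<noteq> 0"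
  shows "(LINT x|lborel. f x) = (\<bar>c\<bar> ^ DIM('a)) *\<^sub>R (LINT x|lborel. f (t + c *\<^sub>R x))"
proof (cases "integrable lborel f")
  case True
  then have [measurable]: "f \<in> borel_measurable borel" by auto
  have "(LINT x|lborel. f x) = (LINT x|density (distr lborel borel (\<lambda>x. t + c *\<^sub>R x)) (\<lambda>_. \<bar>c\<bar>^DIM('a)). f x)"
    using lborel_affine[OF c, of t] by simp
  also have "\<dots> = (\<bar>c\<bar> ^ DIM('a)) *\<^sub>R (LINT x|lborel. f (t + c *\<^sub>R x))"
    by (simp add: integral_density integral_distr)
  finally show ?thesis .
next
  \<comment> \<open>Non-integrable functions have Bochner integral 0 and integrability is invariant
    under the substitution, so both sides are 0.\<close>
  case False
  then show ?thesis using integrable_lborel_affine_iff[OF c, of f t]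
    by (simp add: not_integrable_integral_eq)
qed

text \<open>Lebesgue measure is the image of a product of one-dimensional ones under the basis
  expansion. This reduces Gaussians, tents and inverse square weights to the real line.\<close>

lemma lborel_prod_integral:
  fixes f :: "'a::euclidean_space \<Rightarrow> real \<Rightarrow> complex"
  assumes f: "\<And>b. b \<in> Basis \<Longrightarrow> integrable lborel (f b)"
  shows integrable_lborel_prod: "integrable lborel (\<lambda>x::'a. \<Prod>b\<in>Basis. f b (x \<bullet> b))"
    and integral_lborel_prod:
      "(LINT x|lborel. (\<Prod>b\<in>Basis. f b (x \<bullet> b))) = (\<Prod>b\<in>Basis. (LINT x|lborel. f b x))"
proof -
  interpret product_sigma_finite "\<lambda>_::'a. lborel :: real measure" ..
  have [measurable]: "b \<in> Basis \<Longrightarrow> f b \<in> borel_measurable borel" for b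
    using f[of b] by auto
  have eq: "(\<Prod>b\<in>Basis. f b ((\<Sum>b\<in>Basis. y b *\<^sub>R b) \<bullet> b)) = (\<Prod>b\<in>Basis. f b (y b))" for y :: "'a \<Rightarrow> real"
    by (rule prod.cong) auto
  show "integrable lborel (\<lambda>x::'a. \<Prod>b\<in>Basis. f b (x \<bullet> b))"
    apply (subst lborel_eq, subst integrable_distr_eq)
      apply simp
     apply simp
    using product_integrable_prod[of Basis f] f
    by (simp add: eq)
  show "(LINT x|lborel. (\<Prod>b\<in>Basis. f b (x \<bullet> b))) = (\<Prod>b\<in>Basis. (LINT x|lborel. f b x))"
    apply (subst lborel_eq, subst integral_distr)
      apply simp
     apply simp
    using product_integral_prod[of Basis f] f
    by (simp add: eq)
qed

section \<open>Gaussians and their transforms\<close>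

lemma cis_measurable [measurable]: "cis \<in> borel_measurable borel"
  by (intro borel_measurable_continuous_onI continuous_intros)

text \<open>With \<open>pi\<close> in the exponent \<open>gauss 1\<close> has mass one and is its
  own Fourier transform. The parameter is an inverse squared width: width \<open>2^j\<close>
  corresponds to \<open>1 / 4 ^ j\<close>.\<close>

definition gauss :: "real \<Rightarrow> 'a::euclidean_space \<Rightarrow> real" where
  "gauss c x = exp (- (pi * c * (norm x)\<^sup>2))"

lemma gauss_measurable [measurable]: "gauss c \<in> borel_measurable borel"
  unfolding gauss_def by measurable

lemma gauss_nonneg [simp]: "0 \<le> gauss c x" and gauss_pos: "0 < gauss c x"
  by (simp_all add: gauss_def)

lemma gauss_le_1: "0 \<le> c \<Longrightarrow> gauss c x \<le> 1"
  by (simp add: gauss_def)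

lemma continuous_on_gauss [continuous_intros]:
  "continuous_on A f \<Longrightarrow> continuous_on A (\<lambda>x. gauss c (f x))"
  unfolding gauss_def by (intro continuous_intros)

lemma gauss_scale: "gauss c (t *\<^sub>R x) = gauss (c * t\<^sup>2) x"
  by (simp add: gauss_def power_mult_distrib algebra_simps)

lemma gauss_eq_prod: "gauss c x = (\<Prod>b\<in>Basis. gauss c (x \<bullet> b))"
  unfolding gauss_def
  by (simp add: exp_sum[symmetric] sum_negf sum_distrib_left[symmetric] norm_eq_sqrt_inner
      euclidean_inner[of x x] power2_eq_square sum_nonneg)

lemma cis_inner_eq_prod: "cis (c * (x \<bullet> y)) = (\<Prod>b\<in>Basis. cis (c * ((x \<bullet> b) * (y \<bullet> b))))"
proof -
  have "(\<Prod>b\<in>B. cis (f b)) = cis (\<Sum>b\<in>B. f b)" for f :: "'a \<Rightarrow> real" and B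
    by (induction B rule: infinite_finite_induct) (auto simp: cis_mult)
  then show ?thesis by (simp add: euclidean_inner[of x y] sum_distrib_left)
qed

text \<open>The characteristic function of the standard normal law, rescaled by
  \<open>k = sqrt (2 * pi)\<close> to turn \<open>exp (- x^2 / 2)\<close> into
  \<open>gauss 1\<close>.\<close>

lemma gauss_fourier_real:
  fixes t :: real
  shows "integrable lborel (\<lambda>x::real. complex_of_real (gauss 1 x) * cis (- 2 * pi * (x * t)))"
    and "(LINT x|lborel. complex_of_real (gauss 1 x) * cis (- 2 * pi * (x * t))) = of_real (gauss 1 t)"
proof -
  define k where "k = sqrt (2 * pi)"
  have k: "k > 0" "k\<^sup>2 = 2 * pi" by (simp_all add: k_def)
  have dens: "k * std_normal_density (k * x) = gauss 1 x" for x :: real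
    using k(1) by (simp add: std_normal_density_def gauss_def power_mult_distrib k(2)) (simp add: k_def)
  have int: "integrable lborel (\<lambda>x. std_normal_density x *\<^sub>R cis (- (k * t) * x))"
    by (rule Bochner_Integration.integrable_bound[OF integrable_std_normal_moment[of 0]]) auto
  have eq: "std_normal_density (0 + k * x) *\<^sub>R cis (- (k * t) * (0 + k * x))
     = (1 / k) *\<^sub>R (complex_of_real (gauss 1 x) * cis (- 2 * pi * (x * t)))" for x
  proof -
    have "- (k * t) * (0 + k * x) = - 2 * pi * (x * t)"
      using k(2) by (simp add: power2_eq_square) 
    then show ?thesis unfolding dens[of x, symmetric] using k(1) by (simp only:) (simp add: scaleR_conv_of_real)
  qed
  have i: "integrable lborel (\<lambda>x. (1 / k) *\<^sub>R (complex_of_real (gauss 1 x) * cis (- 2 * pi * (x * t))))"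
    using lborel_integrable_real_affine[OF int, of k 0] k(1) unfolding eq by simp
  from integrable_scaleR_right[OF this, of k]
  show "integrable lborel (\<lambda>x::real. complex_of_real (gauss 1 x) * cis (- 2 * pi * (x * t)))"
    using k(1) by simp
  have "char std_normal_distribution (- (k * t)) = complex_of_real (exp (- ((k * t)\<^sup>2) / 2))"
    by (simp add: char_std_normal_distribution)
  also have "\<dots> = of_real (gauss 1 t)"
    by (simp add: gauss_def power_mult_distrib k(2))
  finally have "of_real (gauss 1 t) = (LINT x|lborel. std_normal_density x *\<^sub>R cis (- (k * t) * x))"
    unfolding char_def by (subst (asm) integral_density) (auto simp: cis_conv_exp mult_ac)
  also have "\<dots> = (LINT x|lborel. complex_of_real (gauss 1 x) * cis (- 2 * pi * (x * t)))"
    using k(1) lborel_integral_real_affine[of k "\<lambda>x. std_normal_density x *\<^sub>R cis (- (k * t) * x)" 0] unfolding eq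
    by simp
  finally show "(LINT x|lborel. complex_of_real (gauss 1 x) * cis (- 2 * pi * (x * t))) = of_real (gauss 1 t)" ..
qed

lemma fourier_gauss_unit:
  fixes \<xi> :: "'a::euclidean_space"
  shows integrable_gauss_unit: "integrable lborel (gauss 1 :: 'a \<Rightarrow> real)"
    and "fourier (\<lambda>x. of_real (gauss 1 x)) \<xi> = of_real (gauss 1 \<xi>)"
proof -
  have eq: "complex_of_real (gauss 1 x) * cis (- 2 * pi * (x \<bullet> \<eta>))
     = (\<Prod>b\<in>Basis. complex_of_real (gauss 1 (x \<bullet> b)) * cis (- 2 * pi * ((x \<bullet> b) * (\<eta> \<bullet> b))))" for x \<eta> :: 'a
    by (simp only: gauss_eq_prod[of 1 x] cis_inner_eq_prod of_real_prod prod.distrib)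
  have "complex_integrable lborel (\<lambda>x::'a. complex_of_real (gauss 1 x) * cis (- 2 * pi * (x \<bullet> 0)))"
    unfolding eq by (intro integrable_lborel_prod gauss_fourier_real)
  then have "complex_integrable lborel (\<lambda>x::'a. complex_of_real (gauss 1 x))" by simp
  then show "integrable lborel (gauss 1 :: 'a \<Rightarrow> real)" by (simp add: complex_of_real_integrable_eq)
  show "fourier (\<lambda>x. of_real (gauss 1 x)) \<xi> = of_real (gauss 1 \<xi>)"
    unfolding fourier_def eq gauss_eq_prod[of 1 \<xi>] of_real_prod
    by (subst integral_lborel_prod, rule gauss_fourier_real) (simp only: gauss_fourier_real)
qed

lemma integrable_gauss: "c > 0 \<Longrightarrow> integrable lborel (gauss c :: 'a::euclidean_space \<Rightarrow> real)"
  using integrable_lborel_affine_iff[of "sqrt c" "gauss 1 :: 'a \<Rightarrow> real" 0] integrable_gauss_unit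
  by (simp add: gauss_scale)

lemma fourier_affine:
  fixes f :: "'a::euclidean_space \<Rightarrow> complex"
  assumes "c \<noteq> 0"
  shows "fourier (\<lambda>x. f (t + c *\<^sub>R x)) \<xi> = of_real (1 / \<bar>c\<bar> ^ DIM('a)) * cis (2 * pi * (t \<bullet> \<xi>) / c) * fourier f (\<xi> /\<^sub>R c)"
proof -
  have "fourier f (\<xi> /\<^sub>R c) = \<bar>c\<bar> ^ DIM('a) *\<^sub>R (LINT x|lborel. f (t + c *\<^sub>R x) * cis (- 2 * pi * ((t + c *\<^sub>R x) \<bullet> (\<xi> /\<^sub>R c))))"
    unfolding fourier_def by (rule integral_lborel_affine) fact
  also have "(\<lambda>x. f (t + c *\<^sub>R x) * cis (- 2 * pi * ((t + c *\<^sub>R x) \<bullet> (\<xi> /\<^sub>R c))))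
     = (\<lambda>x. cis (- (2 * pi * (t \<bullet> \<xi>) / c)) * (f (t + c *\<^sub>R x) * cis (- 2 * pi * (x \<bullet> \<xi>))))"
  proof
    fix x
    have "- 2 * pi * ((t + c *\<^sub>R x) \<bullet> (\<xi> /\<^sub>R c)) = - (2 * pi * (t \<bullet> \<xi>) / c) + - 2 * pi * (x \<bullet> \<xi>)"
      using assms by (simp add: inner_add_left field_simps)
    then show "f (t + c *\<^sub>R x) * cis (- 2 * pi * ((t + c *\<^sub>R x) \<bullet> (\<xi> /\<^sub>R c))) = cis (- (2 * pi * (t \<bullet> \<xi>) / c)) * (f (t + c *\<^sub>R x) * cis (- 2 * pi * (x \<bullet> \<xi>)))"
      by (simp only: cis_mult[symmetric] mult_ac)
  qed
  finally have "fourier f (\<xi> /\<^sub>R c) = \<bar>c\<bar> ^ DIM('a) *\<^sub>R (cis (- (2 * pi * (t \<bullet> \<xi>) / c)) * fourier (\<lambda>x. f (t + c *\<^sub>R x)) \<xi>)"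
    by (simp add: fourier_def)
  moreover have "cis (2 * pi * (t \<bullet> \<xi>) / c) * cis (- (2 * pi * (t \<bullet> \<xi>) / c)) = 1"
    by (simp add: cis_mult)
  ultimately show ?thesis using assms
    by (simp add: scaleR_conv_of_real)
qed

lemma fourier_gauss:
  fixes \<xi> :: "'a::euclidean_space"
  assumes "c > 0"
  shows "fourier (\<lambda>x. of_real (gauss c x)) \<xi> = of_real (c powr (- (DIM('a) / 2)) * gauss (1 / c) \<xi>)"
proof -
  have "fourier (\<lambda>x::'a. of_real (gauss c x)) \<xi> = fourier (\<lambda>x. of_real (gauss 1 (0 + sqrt c *\<^sub>R x))) \<xi>"
    using assms by (simp add: gauss_scale)
  also have "\<dots> = of_real (1 / sqrt c ^ DIM('a) * gauss 1 (\<xi> /\<^sub>R sqrt c))"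
    using assms by (subst fourier_affine) (auto simp: fourier_gauss_unit(2))
  also have "1 / sqrt c ^ DIM('a) = c powr (- (DIM('a) / 2))"
  proof -
    have "sqrt c ^ DIM('a) = (c powr (1/2)) powr DIM('a)"
      using assms by (simp add: powr_half_sqrt powr_realpow)
    then show ?thesis using assms by (simp add: powr_powr powr_minus_divide)
  qed
  also have "gauss 1 (\<xi> /\<^sub>R sqrt c) = gauss (1 / c) \<xi>"
    using assms by (simp add: gauss_scale power_inverse divide_inverse)
  finally show ?thesis .
qed


text \<open>A product majorant \<open>f x * g y\<close> with integrable factors is all that most
  exchanges of integrals below have to exhibit.\<close>

lemma Fubini_dominated:
  fixes F :: "'a \<Rightarrow> 'b \<Rightarrow> 'c::{banach, second_countable_topology}"
  assumes "sigma_finite_measure M" "sigma_finite_measure N"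
    and [measurable]: "(\<lambda>(x, y). F x y) \<in> borel_measurable (M \<Otimes>\<^sub>M N)"
    and f: "integrable M (f :: 'a \<Rightarrow> real)" and g: "integrable N (g :: 'b \<Rightarrow> real)"
    and bound: "\<And>x y. norm (F x y) \<le> f x * g y"
  shows Fubini_dominated_pair: "integrable (M \<Otimes>\<^sub>M N) (\<lambda>(x, y). F x y)"
    and Fubini_dominated_eq: "(LINT x|M. (LINT y|N. F x y)) = (LINT y|N. (LINT x|M. F x y))"
    and Fubini_dominated_fst: "integrable M (\<lambda>x. LINT y|N. F x y)"
proof -
  interpret M: sigma_finite_measure M by fact
  interpret N: sigma_finite_measure N by fact
  interpret pair_sigma_finite M N ..
  have [measurable]: "f \<in> borel_measurable M" "g \<in> borel_measurable N" using f g by auto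
  have "integrable (M \<Otimes>\<^sub>M N) (\<lambda>(x, y). f x * g y)"
  proof (rule Fubini_integrable)
    show "integrable M (\<lambda>x. LINT y|N. norm (case (x, y) of (x, y) \<Rightarrow> f x * g y))"
      using f by (simp add: abs_mult)
    show "AE x in M. integrable N (\<lambda>y. case (x, y) of (x, y) \<Rightarrow> f x * g y)"
      using g by simp
  qed measurable
  then show int: "integrable (M \<Otimes>\<^sub>M N) (\<lambda>(x, y). F x y)"
  proof (rule Bochner_Integration.integrable_bound)
    show "AE z in M \<Otimes>\<^sub>M N. norm (case z of (x, y) \<Rightarrow> F x y) \<le> norm (case z of (x, y) \<Rightarrow> f x * g y)"
      by (rule AE_I2) (auto intro: order_trans[OF bound] abs_ge_self)
  qed measurable
  show "(LINT x|M. (LINT y|N. F x y)) = (LINT y|N. (LINT x|M. F x y))"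
    using Fubini_integral[OF int] by simp
  show "integrable M (\<lambda>x. LINT y|N. F x y)"
    using integrable_fst[OF int] by simp
qed

section \<open>Elementary properties of the Fourier transform, and inversion\<close>

lemma fourier_measurable [measurable]:
  assumes [measurable]: "f \<in> borel_measurable borel"
  shows "fourier f \<in> borel_measurable borel"
  unfolding fourier_def by measurable

lemma norm_fourier_le: "norm (fourier f \<xi>) \<le> (LINT x|lborel. norm (f x))"
  unfolding fourier_def by (rule order_trans[OF integral_norm_bound]) (simp add: norm_mult)

lemma integrable_mult_bounded:
  fixes f g :: "'a \<Rightarrow> 'b::{banach, second_countable_topology, real_normed_algebra}"
  assumes f: "integrable M f" and [measurable]: "g \<in> borel_measurable M" and B: "\<And>x. norm (g x) \<le> B"
  shows "integrable M (\<lambda>x. f x * g x)"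
proof -
  have [measurable]: "f \<in> borel_measurable M" using f by auto
  have "norm (f x * g x) \<le> norm (B * norm (f x))" for x
  proof -
    have "norm (f x * g x) \<le> norm (f x) * norm (g x)" by (rule norm_mult_ineq)
    also have "\<dots> \<le> norm (f x) * B" using B by (intro mult_left_mono) auto
    also have "\<dots> \<le> norm (B * norm (f x))" by (simp add: mult.commute)
    finally show ?thesis .
  qed
  then have "AE x in M. norm (f x * g x) \<le> norm (B * norm (f x))"
    by (intro AE_I2)
  then show ?thesis
    by (rule Bochner_Integration.integrable_bound[OF integrable_mult_right[OF integrable_norm[OF f]], rotated]) measurable
qed

lemma integrable_mult_cis:
  assumes "integrable M f" and [measurable]: "g \<in> borel_measurable M"
  shows "integrable M (\<lambda>x. f x * cis (g x))"
  by (rule integrable_mult_bounded[OF assms(1), where B=1]) auto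

lemma continuous_on_fourier:
  fixes f :: "'a::euclidean_space \<Rightarrow> complex"
  assumes f: "integrable lborel f"
  shows "continuous_on UNIV (fourier f)"
proof -
  have [measurable]: "f \<in> borel_measurable borel" using f by auto
  have "(\<lambda>n. fourier f (X n)) \<longlonglongrightarrow> fourier f x" if "X \<longlonglongrightarrow> x" for X x
    unfolding fourier_def
  proof (rule integral_dominated_convergence[where w="\<lambda>x. norm (f x)"])
    show "AE xa in lborel. (\<lambda>i. f xa * cis (- 2 * pi * (xa \<bullet> X i))) \<longlonglongrightarrow> f xa * cis (- 2 * pi * (xa \<bullet> x))"
      using that by (intro AE_I2 tendsto_intros)
  qed (use f in \<open>auto simp: norm_mult\<close>)
  then show ?thesis by (auto simp: continuous_on_sequentially o_def)
qed

text \<open>Fubini for the kernel \<open>g x * f y * cis (- 2 * pi * (x \<bullet> y))\<close>.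
  Together with inversion this is the only duality used; it also stands in for the convolution
  theorem.\<close>

lemma fourier_multiplication:
  fixes f g :: "'a::euclidean_space \<Rightarrow> complex"
  assumes f: "integrable lborel f" and g: "integrable lborel g"
  shows "(LINT x|lborel. fourier f x * g x) = (LINT x|lborel. f x * fourier g x)"
proof -
  have [measurable]: "f \<in> borel_measurable borel" "g \<in> borel_measurable borel" using f g by auto
  have "(LINT x|lborel. fourier f x * g x) = (LINT x|lborel. (LINT y|lborel. g x * f y * cis (- 2 * pi * (x \<bullet> y))))"
    unfolding fourier_def Bochner_Integration.integral_mult_left_zero[symmetric]
    by (intro Bochner_Integration.integral_cong refl) (simp add: mult_ac inner_commute)
  also have "\<dots> = (LINT y|lborel. (LINT x|lborel. g x * f y * cis (- 2 * pi * (x \<bullet> y))))"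
    by (rule Fubini_dominated_eq[where f="\<lambda>x. norm (g x)" and g="\<lambda>x. norm (f x)"])
       (use f g in \<open>auto simp: norm_mult sigma_finite_lborel\<close>)
  also have "\<dots> = (LINT x|lborel. f x * fourier g x)"
    unfolding fourier_def Bochner_Integration.integral_mult_right_zero[symmetric]
    by (intro Bochner_Integration.integral_cong refl) (simp add: mult_ac)
  finally show ?thesis .
qed

lemma fourier_modulated: "fourier (\<lambda>x. f x * cis (- 2 * pi * (z \<bullet> x))) \<xi> = fourier f (\<xi> + z)"
  unfolding fourier_def
proof (intro Bochner_Integration.integral_cong refl)
  fix x
  have "- 2 * pi * (z \<bullet> x) + - 2 * pi * (x \<bullet> \<xi>) = - 2 * pi * (x \<bullet> (\<xi> + z))"
    by (simp add: inner_add_right inner_commute[of z] ring_distribs)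
  then show "f x * cis (- 2 * pi * (z \<bullet> x)) * cis (- 2 * pi * (x \<bullet> \<xi>)) = f x * cis (- 2 * pi * (x \<bullet> (\<xi> + z)))"
    by (simp only: mult.assoc cis_mult)
qed

text \<open>Testing the transform against ever wider Gaussians turns the double transform into Gaussian averages of \<open>f\<close>
  that concentrate at the point \<open>- z\<close>.\<close>
theorem fourier_inversion:
  fixes f :: "'a::euclidean_space \<Rightarrow> complex"
  assumes f: "integrable lborel f" and f': "integrable lborel (fourier f)"
    and cont: "continuous_on UNIV f" and B: "\<And>x. norm (f x) \<le> B"
  shows "fourier (fourier f) z = f (- z)"
proof -
  have [measurable]: "f \<in> borel_measurable borel" using f by auto
  have lim0: "(\<lambda>n. 1 / real (Suc n)) \<longlonglongrightarrow> 0"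
    by (rule LIMSEQ_Suc[OF lim_1_over_n])
  \<comment> \<open>A square, so that the transformed Gaussian has the explicit width
    \<open>1 / Suc n\<close>.\<close>
  define c where "c n = (1 / real (Suc n))\<^sup>2" for n
  have c: "c n > 0" for n by (simp add: c_def)
  have c0: "c \<longlonglongrightarrow> 0" unfolding c_def using tendsto_power[OF lim0, of 2] by simp
  define I where "I n = (LINT \<xi>|lborel. fourier f \<xi> * (of_real (gauss (c n) \<xi>) * cis (- 2 * pi * (z \<bullet> \<xi>))))" for n
  have "I \<longlonglongrightarrow> (LINT \<xi>|lborel. fourier f \<xi> * (of_real 1 * cis (- 2 * pi * (z \<bullet> \<xi>))))"
    unfolding I_def
  proof (rule integral_dominated_convergence[where w="\<lambda>x. norm (fourier f x)"])
    have "(\<lambda>n. gauss (c n) x) \<longlonglongrightarrow> exp (- (pi * 0 * (norm x)\<^sup>2))" for x :: 'a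
      unfolding gauss_def by (intro tendsto_intros c0)
    then show "AE x in lborel. (\<lambda>i. fourier f x * (complex_of_real (gauss (c i) x) * cis (- 2 * pi * (z \<bullet> x))))
          \<longlonglongrightarrow> fourier f x * (complex_of_real 1 * cis (- 2 * pi * (z \<bullet> x)))"
      by (intro AE_I2 tendsto_intros) simp
    show "AE x in lborel. norm (fourier f x * (complex_of_real (gauss (c n) x) * cis (- 2 * pi * (z \<bullet> x)))) \<le> norm (fourier f x)" for n
      using c[of n] by (intro AE_I2) (simp add: norm_mult mult_left_le gauss_le_1)
  qed (use f' in auto)
  then have 1: "I \<longlonglongrightarrow> fourier (fourier f) z"
    by (simp add: fourier_def[of "fourier f"] inner_commute)
  \<comment> \<open>The multiplication formula moves the transform from \<open>f\<close> to the
    modulated Gaussian, which becomes a Gaussian centred at \<open>- z\<close>. Rescaling by its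
    width leaves a fixed Gaussian and lets the argument of \<open>f\<close> shrink to
    \<open>- z\<close>.\<close>
  have I_eq: "I n = (LINT x|lborel. f (- z + (1 / real (Suc n)) *\<^sub>R x) * of_real (gauss 1 x))" for n
  proof -
    have gi: "integrable lborel (\<lambda>\<xi>. complex_of_real (gauss (c n) \<xi>) * cis (- 2 * pi * (z \<bullet> \<xi>)))"
      using integrable_gauss[OF c, of n] by (intro integrable_mult_cis) auto
    have "I n = (LINT x|lborel. f x * fourier (\<lambda>\<xi>. of_real (gauss (c n) \<xi>) * cis (- 2 * pi * (z \<bullet> \<xi>))) x)"
      unfolding I_def by (rule fourier_multiplication[OF f gi])
    also have "\<dots> = (LINT x|lborel. f x * of_real (c n powr (- (DIM('a) / 2)) * gauss (1 / c n) (x + z)))"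
      by (simp only: fourier_modulated fourier_gauss[OF c])
    also have "\<dots> = (1 / real (Suc n)) ^ DIM('a) *\<^sub>R (LINT x|lborel. f (- z + (1 / real (Suc n)) *\<^sub>R x) *
        of_real (c n powr (- (DIM('a) / 2)) * gauss (1 / c n) ((1 / real (Suc n)) *\<^sub>R x)))"
      by (subst integral_lborel_affine[where c="1 / real (Suc n)" and t="-z"]) auto
    also have "\<dots> = (LINT x|lborel. ((1 / real (Suc n)) ^ DIM('a) * c n powr (- (DIM('a) / 2))) *\<^sub>R (f (- z + (1 / real (Suc n)) *\<^sub>R x) *
        of_real (gauss 1 x)))"
      unfolding integral_scaleR_right[symmetric]
      by (intro Bochner_Integration.integral_cong refl)
         (simp add: scaleR_conv_of_real gauss_scale c_def power_divide)
    also have "(1 / real (Suc n)) ^ DIM('a) * c n powr (- (DIM('a) / 2)) = 1"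
    proof -
      have "c n powr (- (DIM('a) / 2)) = (1 / real (Suc n)) powr (- real DIM('a))"
        unfolding c_def powr_powr powr_realpow[symmetric, OF zero_less_divide_1_iff[THEN iffD2, OF of_nat_0_less_iff[THEN iffD2, OF zero_less_Suc]]] by simp
      also have "\<dots> = inverse ((1 / real (Suc n)) ^ DIM('a))"
        by (subst powr_minus, subst powr_realpow) auto
      finally show ?thesis by simp
    qed
    finally show ?thesis by simp
  qed
  have "I \<longlonglongrightarrow> (LINT x|lborel. f (- z + 0 *\<^sub>R x) * of_real (gauss 1 x))"
    unfolding I_eq
  proof (rule integral_dominated_convergence[where w="\<lambda>x. B * gauss 1 x"])
    show "AE x in lborel. (\<lambda>i. f (- z + (1 / real (Suc i)) *\<^sub>R x) * complex_of_real (gauss 1 x))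
             \<longlonglongrightarrow> f (- z + 0 *\<^sub>R x) * complex_of_real (gauss 1 x)"
      using cont by (intro AE_I2 tendsto_intros lim0 isCont_tendsto_compose[of _ f])
        (auto simp: continuous_on_eq_continuous_at)
    show "AE x in lborel. norm (f (- z + (1 / real (Suc n)) *\<^sub>R x) * complex_of_real (gauss 1 x)) \<le> B * gauss 1 x" for n
      using B by (intro AE_I2) (auto simp: norm_mult intro!: mult_right_mono)
  qed (use integrable_gauss_unit in auto)
  moreover have "(LINT x|lborel. complex_of_real (gauss 1 (x::'a))) = 1"
    using fourier_gauss_unit(2)[of "0::'a"] by (simp add: fourier_def gauss_def)
  ultimately have "I \<longlonglongrightarrow> f (- z)" by simp
  with 1 show ?thesis by (rule LIMSEQ_unique)
qed

section \<open>Fourier multipliers\<close>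

text \<open>Convexity on the open half line, with the endpoint \<open>x = 0\<close> checked by hand,
  since Jensen is applied to functions that may vanish.\<close>

lemma powr_above_tangent:
  fixes a x u :: real
  assumes "a > 0" "x \<ge> 0" "u \<ge> 1"
  shows "a powr u + u * a powr (u - 1) * (x - a) \<le> x powr u"
proof (cases "x = 0")
  case True
  have "a powr u = a powr (u - 1) * a" using assms by (simp add: powr_diff)
  then have "a powr u + u * a powr (u - 1) * (x - a) = (1 - u) * a powr u" using True by (simp add: algebra_simps)
  also have "\<dots> \<le> 0" using assms by (intro mult_nonpos_nonneg) auto
  finally show ?thesis using True by simp
next
  case False
  have "x powr u - a powr u \<ge> u * a powr (u - 1) * (x - a)"
    by (rule convex_on_imp_above_tangent[where A="{0<..}"])
       (use assms False powr_convex[of u] in \<open>auto intro!: derivative_eq_intros simp: interior_open\<close>)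
  then show ?thesis by simp
qed

text \<open>The tangent inequality at the weighted mean \<open>A = I / K\<close>, multiplied by
  \<open>k\<close> and integrated: the linear terms cancel. The weight is not normalised, hence the
  factor with exponent \<open>u - 1\<close>. The bound \<open>D\<close> makes the integrals
  finite.\<close>

lemma weighted_Jensen_powr:
  fixes k g :: "'a \<Rightarrow> real"
  assumes k: "integrable M k" "\<And>x. 0 \<le> k x"
    and g [measurable]: "g \<in> borel_measurable M" and g0: "\<And>x. 0 \<le> g x" and gD: "\<And>x. g x \<le> D"
    and u: "u \<ge> 1"
  shows "integrable M (\<lambda>x. k x * g x powr u)"
    and "(LINT x|M. k x * g x) powr u \<le> (LINT x|M. k x) powr (u - 1) * (LINT x|M. k x * g x powr u)"
proof -
  show 1: "integrable M (\<lambda>x. k x * g x powr u)"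
    by (rule integrable_mult_bounded[OF k(1), where B="D powr u"]) (use u g0 gD in \<open>auto intro!: powr_mono2\<close>)
  have 2: "integrable M (\<lambda>x. k x * g x)"
    by (rule integrable_mult_bounded[OF k(1), where B=D]) (use g0 gD in auto)
  define K where "K = (LINT x|M. k x)"
  define I where "I = (LINT x|M. k x * g x)"
  have I0: "0 \<le> I" unfolding I_def using k(2) g0 by (intro integral_nonneg_AE AE_I2) auto
  have K0: "0 \<le> K" unfolding K_def using k(2) by (intro integral_nonneg_AE AE_I2) auto
  have R0: "0 \<le> (LINT x|M. k x * g x powr u)" using k(2) by (intro integral_nonneg_AE AE_I2) auto
  show "I powr u \<le> K powr (u - 1) * (LINT x|M. k x * g x powr u)"
  proof (cases "I = 0")
    case True
    then show ?thesis using R0 u by simp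
  next
    case False
    with I0 have I: "I > 0" by simp
    \<comment> \<open>A positive \<open>I\<close> forces \<open>K > 0\<close>, so that dividing by
      \<open>K\<close> is legitimate.\<close>
    have "I \<le> (LINT x|M. k x * D)"
      unfolding I_def by (rule integral_mono[OF 2]) (use k gD in \<open>auto intro!: mult_left_mono\<close>)
    also have "\<dots> = K * D" by (simp add: K_def)
    finally have "K \<noteq> 0" using I by auto
    with K0 have K: "K > 0" by simp
    define A where "A = I / K"
    have A: "A > 0" using I K by (simp add: A_def)
    have "K * A powr u = (LINT x|M. k x * (A powr u - u * A powr (u - 1) * A)) + (LINT x|M. (u * A powr (u - 1)) * (k x * g x))"
    proof -
      have e1: "(LINT x|M. k x * (A powr u - u * A powr (u - 1) * A)) = K * (A powr u - u * A powr (u - 1) * A)"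
        by (simp add: K_def)
      have e2: "(LINT x|M. (u * A powr (u - 1)) * (k x * g x)) = u * A powr (u - 1) * I"
        by (simp add: I_def)
      have "I = K * A" using K by (simp add: A_def)
      then show ?thesis unfolding e1 e2 by (simp add: algebra_simps)
    qed
    also have "\<dots> = (LINT x|M. k x * (A powr u - u * A powr (u - 1) * A) + (u * A powr (u - 1)) * (k x * g x))"
      by (rule Bochner_Integration.integral_add[symmetric]) (use k 2 in \<open>auto intro!: integrable_mult_right integrable_mult_left\<close>)
    also have "\<dots> \<le> (LINT x|M. k x * g x powr u)"
    proof (rule integral_mono[OF _ 1])
      show "k x * (A powr u - u * A powr (u - 1) * A) + (u * A powr (u - 1)) * (k x * g x) \<le> k x * g x powr u" for x
        using mult_left_mono[OF powr_above_tangent[OF A g0[of x] u] k(2)[of x]] by (simp add: algebra_simps)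
    qed (use k 2 in \<open>auto intro!: integrable_mult_right integrable_mult_left\<close>)
    finally have "K * A powr u \<le> (LINT x|M. k x * g x powr u)" .
    then have "K powr (u - 1) * (K * A powr u) \<le> K powr (u - 1) * (LINT x|M. k x * g x powr u)"
      by (intro mult_left_mono) auto
    moreover have "K powr (u - 1) * (K * A powr u) = I powr u"
      using K I by (simp add: A_def powr_divide powr_diff)
    ultimately show ?thesis by simp
  qed
qed

text \<open>The \<open>u\<close>-th power of the norm as an extended nonnegative real: bounds pass
  from one function to another before anything is known to be finite, and no roots appear.\<close>

definition lp_mass :: "real \<Rightarrow> ('a::euclidean_space \<Rightarrow> complex) \<Rightarrow> ennreal" where
  "lp_mass u g = (\<integral>\<^sup>+x. ennreal (norm (g x) powr u) \<partial>lborel)"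

text \<open>Minkowski's integral inequality for the \<open>u\<close>-th power. Pointwise Jensen
  gives a factor \<open>K powr (u - 1)\<close>, and Tonelli returns one more factor
  \<open>K\<close>.\<close>

lemma lp_mass_average:
  fixes k :: "'b \<Rightarrow> complex" and g :: "'b \<Rightarrow> 'a::euclidean_space \<Rightarrow> complex"
  assumes M: "sigma_finite_measure M" and k: "integrable M k"
    and g [measurable]: "(\<lambda>(v, x). g v x) \<in> borel_measurable (M \<Otimes>\<^sub>M borel)"
    and gD: "\<And>v x. norm (g v x) \<le> D" and u: "u \<ge> 1"
    and W: "\<And>v. v \<in> space M \<Longrightarrow> lp_mass u (g v) \<le> W"
  shows "lp_mass u (\<lambda>x. LINT v|M. k v * g v x) \<le> ennreal ((LINT v|M. norm (k v)) powr u) * W"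
proof -
  interpret sigma_finite_measure M by fact
  interpret pair_sigma_finite M "lborel :: 'a measure" ..
  have [measurable]: "k \<in> borel_measurable M" using k by auto
  define K where "K = (LINT v|M. norm (k v))"
  have K: "0 \<le> K" by (simp add: K_def)
  have k': "integrable M (\<lambda>v. norm (k v))" using k by auto
  have [measurable]: "(\<lambda>v. g v x) \<in> borel_measurable M" for x
  proof -
    have "(\<lambda>v. case (v, x) of (v, x) \<Rightarrow> g v x) \<in> borel_measurable M"
      by (rule measurable_compose[OF _ g]) measurable
    then show ?thesis by simp
  qed
  note J = weighted_Jensen_powr[OF k', of "\<lambda>v. norm (g v x)" D u for x]
  have "norm (LINT v|M. k v * g v x) powr u \<le> K powr (u - 1) * (LINT v|M. norm (k v) * norm (g v x) powr u)" for x
  proof -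
    have "norm (LINT v|M. k v * g v x) \<le> (LINT v|M. norm (k v) * norm (g v x))"
      by (rule order_trans[OF integral_norm_bound]) (simp add: norm_mult)
    then have "norm (LINT v|M. k v * g v x) powr u \<le> (LINT v|M. norm (k v) * norm (g v x)) powr u"
      using u by (intro powr_mono2) auto
    also have "\<dots> \<le> K powr (u - 1) * (LINT v|M. norm (k v) * norm (g v x) powr u)"
      unfolding K_def by (rule J(2)) (use gD u in auto)
    finally show ?thesis .
  qed
  moreover have "ennreal (LINT v|M. norm (k v) * norm (g v x) powr u) = (\<integral>\<^sup>+v. ennreal (norm (k v) * norm (g v x) powr u) \<partial>M)" for x
    by (rule nn_integral_eq_integral[symmetric]) (use J(1)[of x] gD u in auto)
  ultimately have "ennreal (norm (LINT v|M. k v * g v x) powr u) \<le>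
      ennreal (K powr (u - 1)) * (\<integral>\<^sup>+v. ennreal (norm (k v) * norm (g v x) powr u) \<partial>M)" for x
    by (metis ennreal_leI ennreal_mult' powr_ge_zero)
  then have "lp_mass u (\<lambda>x. LINT v|M. k v * g v x) \<le>
     (\<integral>\<^sup>+x. ennreal (K powr (u - 1)) * (\<integral>\<^sup>+v. ennreal (norm (k v) * norm (g v x) powr u) \<partial>M) \<partial>lborel)"
    unfolding lp_mass_def by (intro nn_integral_mono)
  also have "\<dots> = ennreal (K powr (u - 1)) * (\<integral>\<^sup>+x. (\<integral>\<^sup>+v. ennreal (norm (k v) * norm (g v x) powr u) \<partial>M) \<partial>lborel)"
    by (rule nn_integral_cmult) measurable
  also have "(\<integral>\<^sup>+x. (\<integral>\<^sup>+v. ennreal (norm (k v) * norm (g v x) powr u) \<partial>M) \<partial>lborel) =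
     (\<integral>\<^sup>+v. (\<integral>\<^sup>+x. ennreal (norm (k v) * norm (g v x) powr u) \<partial>lborel) \<partial>M)"
    by (rule Fubini') measurable
  also have "\<dots> = (\<integral>\<^sup>+v. ennreal (norm (k v)) * lp_mass u (g v) \<partial>M)"
    unfolding lp_mass_def
    by (intro nn_integral_cong) (simp add: ennreal_mult' nn_integral_cmult)
  also have "\<dots> \<le> (\<integral>\<^sup>+v. ennreal (norm (k v)) * W \<partial>M)"
    using W by (intro nn_integral_mono mult_left_mono) auto
  also have "\<dots> = ennreal K * W"
    using k' by (simp add: nn_integral_multc nn_integral_eq_integral K_def)
  also have "ennreal (K powr (u - 1)) * (ennreal K * W) = ennreal (K powr u) * W"
    using K by (simp add: mult.assoc[symmetric] ennreal_mult'[symmetric] powr_diff)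
  finally show ?thesis by (simp add: K_def mult_left_mono)
qed

lemma lp_mass_affine:
  fixes f :: "'a::euclidean_space \<Rightarrow> complex"
  assumes [measurable]: "f \<in> borel_measurable borel" and c: "c \<noteq> 0"
  shows "lp_mass u (\<lambda>x. f (t + c *\<^sub>R x)) = ennreal (1 / \<bar>c\<bar> ^ DIM('a)) * lp_mass u f"
proof -
  have "lp_mass u f = ennreal (\<bar>c\<bar> ^ DIM('a)) * lp_mass u (\<lambda>x. f (t + c *\<^sub>R x))"
    unfolding lp_mass_def by (rule nn_integral_lborel_affine) (use c in auto)
  then show ?thesis using c
    by (simp add: mult.assoc[symmetric] ennreal_mult'[symmetric])
qed

lemma lp_mass_cmult:
  fixes f :: "'a::euclidean_space \<Rightarrow> complex"
  assumes [measurable]: "f \<in> borel_measurable borel"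
  shows "lp_mass u (\<lambda>x. z * f x) = ennreal (norm z powr u) * lp_mass u f"
  unfolding lp_mass_def by (simp add: norm_mult powr_mult ennreal_mult' nn_integral_cmult)

text \<open>\<open>\<mu>\<close> is a Fourier multiplier of norm at most \<open>B\<close>, tested on
  transforms of integrable functions. The pointwise bound makes that class stable under
  multiplication by \<open>\<mu>\<close>, so products of multipliers need no density argument, and
  it provides the domination when integrals are exchanged.\<close>

definition fmult :: "real \<Rightarrow> real \<Rightarrow> ('a::euclidean_space \<Rightarrow> complex) \<Rightarrow> bool" where
  "fmult u B \<mu> \<longleftrightarrow> \<mu> \<in> borel_measurable borel \<and> (\<forall>y. norm (\<mu> y) \<le> B) \<and>
     (\<forall>H. integrable lborel H \<longrightarrow>
        lp_mass u (fourier (\<lambda>y. \<mu> y * H y)) \<le> ennreal (B powr u) * lp_mass u (fourier H))"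

lemma fmultD:
  assumes "fmult u B \<mu>"
  shows fmult_measurable: "\<mu> \<in> borel_measurable borel"
    and fmult_norm_le: "norm (\<mu> y) \<le> B"
    and fmult_nonneg: "0 \<le> B"
    and fmult_lp_mass: "integrable lborel H \<Longrightarrow> lp_mass u (fourier (\<lambda>y. \<mu> y * H y)) \<le> ennreal (B powr u) * lp_mass u (fourier H)"
  using assms order_trans[OF norm_ge_zero, of "\<mu> undefined" B] by (auto simp: fmult_def)

lemma fmult_integrable:
  assumes "fmult u B \<mu>" "integrable lborel H"
  shows "integrable lborel (\<lambda>y. \<mu> y * H y)"
  using integrable_mult_bounded[OF assms(2), of \<mu> B] fmultD[OF assms(1)] by (simp add: mult.commute)

lemma fmult_mono:
  assumes "fmult u B \<mu>" "B \<le> B'" "u \<ge> 0"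
  shows "fmult u B' \<mu>"
proof -
  have "ennreal (B powr u) \<le> ennreal (B' powr u)"
    using assms fmult_nonneg[OF assms(1)] by (intro ennreal_leI powr_mono2) auto
  then have "ennreal (B powr u) * x \<le> ennreal (B' powr u) * x" for x by (rule mult_right_mono) simp
  then show ?thesis using assms unfolding fmult_def by (meson order_trans)
qed

lemma fmult_mult:
  assumes 1: "fmult u B \<mu>" and 2: "fmult u C \<nu>"
  shows "fmult u (B * C) (\<lambda>y. \<mu> y * \<nu> y)"
  unfolding fmult_def
proof (intro conjI allI impI)
  show "(\<lambda>y. \<mu> y * \<nu> y) \<in> borel_measurable borel"
    using fmult_measurable[OF 1] fmult_measurable[OF 2] by measurable
  show "norm (\<mu> y * \<nu> y) \<le> B * C" for y
    unfolding norm_mult using fmult_norm_le[OF 1] fmult_norm_le[OF 2] fmult_nonneg[OF 1] by (intro mult_mono) auto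
  fix H :: "'a \<Rightarrow> complex" assume H: "integrable lborel H"
  have "lp_mass u (fourier (\<lambda>y. \<mu> y * (\<nu> y * H y))) \<le> ennreal (B powr u) * lp_mass u (fourier (\<lambda>y. \<nu> y * H y))"
    by (rule fmult_lp_mass[OF 1 fmult_integrable[OF 2 H]])
  also have "\<dots> \<le> ennreal (B powr u) * (ennreal (C powr u) * lp_mass u (fourier H))"
    by (intro mult_left_mono fmult_lp_mass[OF 2 H]) auto
  also have "\<dots> = ennreal ((B * C) powr u) * lp_mass u (fourier H)"
    using fmult_nonneg[OF 1] fmult_nonneg[OF 2] by (simp add: powr_mult ennreal_mult' mult.assoc)
  finally show "lp_mass u (fourier (\<lambda>y. \<mu> y * \<nu> y * H y)) \<le> ennreal ((B * C) powr u) * lp_mass u (fourier H)"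
    by (simp add: mult.assoc)
qed

lemma fmult_cmult:
  assumes 1: "fmult u B \<mu>"
  shows "fmult u (norm z * B) (\<lambda>y. z * \<mu> y)"
  unfolding fmult_def
proof (intro conjI allI impI)
  note [measurable] = fmult_measurable[OF 1]
  show "(\<lambda>y. z * \<mu> y) \<in> borel_measurable borel" by measurable
  show "norm (z * \<mu> y) \<le> norm z * B" for y
    unfolding norm_mult using fmult_norm_le[OF 1] by (intro mult_left_mono) auto
  fix H :: "'a \<Rightarrow> complex" assume H: "integrable lborel H"
  then have [measurable]: "H \<in> borel_measurable borel" by auto
  have "fourier (\<lambda>y. z * \<mu> y * H y) = (\<lambda>\<xi>. z * fourier (\<lambda>y. \<mu> y * H y) \<xi>)"
    by (rule ext) (simp add: fourier_def mult.assoc)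
  then have "lp_mass u (fourier (\<lambda>y. z * \<mu> y * H y)) = ennreal (norm z powr u) * lp_mass u (fourier (\<lambda>y. \<mu> y * H y))"
    by (simp add: lp_mass_cmult)
  also have "\<dots> \<le> ennreal (norm z powr u) * (ennreal (B powr u) * lp_mass u (fourier H))"
    by (intro mult_left_mono fmult_lp_mass[OF 1 H]) auto
  also have "\<dots> = ennreal ((norm z * B) powr u) * lp_mass u (fourier H)"
    using fmult_nonneg[OF 1] by (simp add: powr_mult ennreal_mult' mult.assoc)
  finally show "lp_mass u (fourier (\<lambda>y. z * \<mu> y * H y)) \<le> ennreal ((norm z * B) powr u) * lp_mass u (fourier H)" .
qed

lemma fmult_const_1: "fmult u 1 (\<lambda>y. 1)"
  by (simp add: fmult_def)

lemma fmult_const_0: "u > 0 \<Longrightarrow> B \<ge> 0 \<Longrightarrow> fmult u B (\<lambda>y. 0)"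
  by (simp add: fmult_def fourier_def lp_mass_def)

lemma fmult_power: "fmult u B \<mu> \<Longrightarrow> fmult u (B ^ n) (\<lambda>y. \<mu> y ^ n)"
  by (induction n) (auto intro: fmult_const_1 fmult_mult)

lemma lp_mass_fourier_affine:
  fixes f :: "'a::euclidean_space \<Rightarrow> complex"
  assumes [measurable]: "f \<in> borel_measurable borel" and c: "c \<noteq> 0"
  shows "lp_mass u (fourier (\<lambda>x. f (t + c *\<^sub>R x))) =
     ennreal ((1 / \<bar>c\<bar> ^ DIM('a)) powr u) * (ennreal (\<bar>c\<bar> ^ DIM('a)) * lp_mass u (fourier f))"
proof -
  have "lp_mass u (fourier (\<lambda>x. f (t + c *\<^sub>R x))) = lp_mass u (\<lambda>\<xi>. of_real (1 / \<bar>c\<bar> ^ DIM('a)) * fourier f (0 + (1 / c) *\<^sub>R \<xi>))"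
    unfolding lp_mass_def using c by (intro nn_integral_cong) (simp add: fourier_affine norm_mult divide_inverse)
  also have "\<dots> = ennreal ((1 / \<bar>c\<bar> ^ DIM('a)) powr u) * (ennreal (\<bar>c\<bar> ^ DIM('a)) * lp_mass u (fourier f))"
    using c lp_mass_affine[of "fourier f" "1/c" u 0]
    by (subst lp_mass_cmult) (auto simp: power_divide norm_divide norm_power simp del: of_real_divide)
  finally show ?thesis .
qed

text \<open>Dilating or translating the symbol corresponds to the inverse substitution in
  \<open>H\<close>, which scales both masses by the same factor.\<close>

lemma fmult_affine:
  fixes \<mu> :: "'a::euclidean_space \<Rightarrow> complex"
  assumes \<mu>: "fmult u B \<mu>" and c: "c \<noteq> 0"
  shows "fmult u B (\<lambda>y. \<mu> (t + c *\<^sub>R y))"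
  unfolding fmult_def
proof (intro conjI allI impI)
  note [measurable] = fmult_measurable[OF \<mu>]
  show "(\<lambda>y. \<mu> (t + c *\<^sub>R y)) \<in> borel_measurable borel" by measurable
  show "norm (\<mu> (t + c *\<^sub>R y)) \<le> B" for y by (rule fmult_norm_le[OF \<mu>])
  fix H :: "'a \<Rightarrow> complex" assume H: "integrable lborel H"
  then have [measurable]: "H \<in> borel_measurable borel" by auto
  define K where "K y = H (- (t /\<^sub>R c) + (1 / c) *\<^sub>R y)" for y
  have [measurable]: "K \<in> borel_measurable borel" unfolding K_def by measurable
  have K: "integrable lborel K"
    unfolding K_def using c H by (subst integrable_lborel_affine_iff) auto
  have HK: "H = (\<lambda>y. K (t + c *\<^sub>R y))"
    using c by (auto simp: K_def scaleR_add_right divide_inverse)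
  have "lp_mass u (fourier (\<lambda>y. \<mu> (t + c *\<^sub>R y) * H y)) =
    ennreal ((1 / \<bar>c\<bar> ^ DIM('a)) powr u) * (ennreal (\<bar>c\<bar> ^ DIM('a)) * lp_mass u (fourier (\<lambda>y. \<mu> y * K y)))"
    unfolding HK using c by (intro lp_mass_fourier_affine[of "\<lambda>y. \<mu> y * K y"]) auto
  also have "\<dots> \<le> ennreal ((1 / \<bar>c\<bar> ^ DIM('a)) powr u) * (ennreal (\<bar>c\<bar> ^ DIM('a)) * (ennreal (B powr u) * lp_mass u (fourier K)))"
    by (intro mult_left_mono fmult_lp_mass[OF \<mu> K]) auto
  also have "\<dots> = ennreal (B powr u) * lp_mass u (fourier H)"
    unfolding HK using c by (subst lp_mass_fourier_affine) (auto simp: mult_ac)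
  finally show "lp_mass u (fourier (\<lambda>y. \<mu> (t + c *\<^sub>R y) * H y)) \<le> ennreal (B powr u) * lp_mass u (fourier H)" .
qed

text \<open>The source of the nontrivial multipliers: superpositions of multipliers with uniform
  norm. The measure space is arbitrary because Lebesgue measure, a two-point space (for sums) and
  counting measure (for power series) all occur.\<close>

lemma fmult_average:
  fixes k :: "'b \<Rightarrow> complex" and \<mu> :: "'b \<Rightarrow> 'a::euclidean_space \<Rightarrow> complex"
  assumes M: "sigma_finite_measure M" and k: "integrable M k" and u: "u \<ge> 1"
    and \<mu>m [measurable]: "(\<lambda>(v, x). \<mu> v x) \<in> borel_measurable (M \<Otimes>\<^sub>M borel)"
    and \<mu>: "\<And>v. fmult u B (\<mu> v)"
  shows "fmult u ((LINT v|M. norm (k v)) * B) (\<lambda>y. LINT v|M. k v * \<mu> v y)"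
  unfolding fmult_def
proof (intro conjI allI impI)
  interpret sigma_finite_measure M by fact
  have B: "0 \<le> B" by (rule fmult_nonneg[OF \<mu>])
  have [measurable]: "k \<in> borel_measurable M" using k by auto
  show [measurable]: "(\<lambda>y. LINT v|M. k v * \<mu> v y) \<in> borel_measurable borel" by measurable
  show "norm (LINT v|M. k v * \<mu> v y) \<le> (LINT v|M. norm (k v)) * B" for y
  proof -
    have "norm (LINT v|M. k v * \<mu> v y) \<le> (LINT v|M. norm (k v) * B)"
    proof (rule order_trans[OF integral_norm_bound integral_mono'])
      show "norm (k v * \<mu> v y) \<le> norm (k v) * B" for v
        unfolding norm_mult using fmult_norm_le[OF \<mu>] by (intro mult_left_mono) auto
    qed (use k B in auto)
    then show ?thesis by simp
  qed
  fix H :: "'a \<Rightarrow> complex" assume H: "integrable lborel H"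
  then have [measurable]: "H \<in> borel_measurable borel" by auto
  have "fourier (\<lambda>y. (LINT v|M. k v * \<mu> v y) * H y) = (\<lambda>\<xi>. LINT v|M. k v * fourier (\<lambda>y. \<mu> v y * H y) \<xi>)"
  proof
    fix \<xi>
    have "fourier (\<lambda>y. (LINT v|M. k v * \<mu> v y) * H y) \<xi> = (LINT y|lborel. (LINT v|M. k v * \<mu> v y * H y * cis (- 2 * pi * (y \<bullet> \<xi>))))"
      by (simp add: fourier_def mult.assoc[symmetric])
    also have "\<dots> = (LINT v|M. (LINT y|lborel. k v * \<mu> v y * H y * cis (- 2 * pi * (y \<bullet> \<xi>))))"
    proof (rule Fubini_dominated_eq[where f="\<lambda>y. B * norm (H y)" and g="\<lambda>v. norm (k v)"])
      show "norm (k v * \<mu> v y * H y * cis (- 2 * pi * (y \<bullet> \<xi>))) \<le> B * norm (H y) * norm (k v)" for y v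
        using mult_right_mono[OF fmult_norm_le[OF \<mu>, of v y], of "norm (H y) * norm (k v)"]
        by (simp add: norm_mult mult_ac)
    qed (use M H k in \<open>auto simp: sigma_finite_lborel\<close>)
    also have "\<dots> = (LINT v|M. k v * fourier (\<lambda>y. \<mu> v y * H y) \<xi>)"
      by (simp add: fourier_def mult.assoc)
    finally show "fourier (\<lambda>y. (LINT v|M. k v * \<mu> v y) * H y) \<xi> = (LINT v|M. k v * fourier (\<lambda>y. \<mu> v y * H y) \<xi>)" .
  qed
  then have "lp_mass u (fourier (\<lambda>y. (LINT v|M. k v * \<mu> v y) * H y)) = lp_mass u (\<lambda>\<xi>. LINT v|M. k v * fourier (\<lambda>y. \<mu> v y * H y) \<xi>)"
    by simp
  also have "\<dots> \<le> ennreal ((LINT v|M. norm (k v)) powr u) * (ennreal (B powr u) * lp_mass u (fourier H))"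
  proof (rule lp_mass_average[OF M k _ _ u])
    show "(\<lambda>(v, \<xi>). fourier (\<lambda>y. \<mu> v y * H y) \<xi>) \<in> borel_measurable (M \<Otimes>\<^sub>M borel)"
      unfolding fourier_def by measurable
    show "norm (fourier (\<lambda>y. \<mu> v y * H y) \<xi>) \<le> B * (LINT y|lborel. norm (H y))" for v \<xi>
    proof -
      have "(LINT y|lborel. norm (\<mu> v y * H y)) \<le> (LINT y|lborel. B * norm (H y))"
        by (rule integral_mono')
           (use H B fmult_norm_le[OF \<mu>] in \<open>auto simp: norm_mult intro!: mult_right_mono\<close>)
      then show ?thesis using norm_fourier_le[of "\<lambda>y. \<mu> v y * H y" \<xi>] by simp
    qed
    show "lp_mass u (fourier (\<lambda>y. \<mu> v y * H y)) \<le> ennreal (B powr u) * lp_mass u (fourier H)" for v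
      by (rule fmult_lp_mass[OF \<mu> H])
  qed
  also have "\<dots> = ennreal (((LINT v|M. norm (k v)) * B) powr u) * lp_mass u (fourier H)"
    using B by (simp add: powr_mult ennreal_mult' mult.assoc)
  finally show "lp_mass u (fourier (\<lambda>y. (LINT v|M. k v * \<mu> v y) * H y)) \<le> ennreal (((LINT v|M. norm (k v)) * B) powr u) * lp_mass u (fourier H)" .
qed

lemma fmult_cis: "fmult u 1 (\<lambda>y. cis (- 2 * pi * (v \<bullet> y)))"
  unfolding fmult_def
proof (intro conjI allI impI)
  fix H :: "'a \<Rightarrow> complex" assume H: "integrable lborel H"
  then have [measurable]: "H \<in> borel_measurable borel" by auto
  have "fourier (\<lambda>y. cis (- 2 * pi * (v \<bullet> y)) * H y) = (\<lambda>\<xi>. fourier H (v + 1 *\<^sub>R \<xi>))"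
    using fourier_modulated[of H v] by (intro ext) (simp add: mult.commute add.commute)
  then show "lp_mass u (fourier (\<lambda>y. cis (- 2 * pi * (v \<bullet> y)) * H y)) \<le> ennreal (1 powr u) * lp_mass u (fourier H)"
    using lp_mass_affine[of "fourier H" 1 u v] by simp
qed auto

text \<open>Young's inequality: \<open>fourier k\<close> is a superposition of characters, and each
  character acts as a translation, an isometry.\<close>

lemma fmult_fourier:
  assumes k: "integrable lborel k" and u: "u \<ge> 1"
  shows "fmult u (LINT v|lborel. norm (k v)) (fourier k)"
proof -
  have "fmult u ((LINT v|lborel. norm (k v)) * 1) (\<lambda>y. LINT v|lborel. k v * cis (- 2 * pi * (v \<bullet> y)))"
    by (rule fmult_average[OF sigma_finite_lborel k u _ fmult_cis]) measurable
  then show ?thesis by (simp add: fourier_def[abs_def])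
qed

section \<open>Symbols generated by Gaussians\<close>

lemma gauss_norm_mult_le: "norm x * gauss 1 x \<le> gauss (1/2) x"
proof -
  define t where "t = norm x"
  have "t \<le> 1 + pi * t\<^sup>2 / 2"
  proof -
    have "0 \<le> (t - 1)\<^sup>2" by simp
    then have "2 * t \<le> 1 + t\<^sup>2" by (simp add: power2_diff)
    moreover have "0 \<le> t" by (simp add: t_def)
    ultimately have "t \<le> 1 + t\<^sup>2" by linarith
    also have "\<dots> \<le> 1 + pi * t\<^sup>2 / 2" using mult_right_mono[of 2 pi "t\<^sup>2"] pi_ge_two by simp
    finally show ?thesis .
  qed
  also have "\<dots> \<le> exp (pi * t\<^sup>2 / 2)" by (rule exp_ge_add_one_self)
  finally have "t * exp (- (pi * t\<^sup>2)) \<le> exp (pi * t\<^sup>2 / 2) * exp (- (pi * t\<^sup>2))"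
    by (rule mult_right_mono) simp
  then show ?thesis by (simp add: gauss_def t_def exp_add[symmetric])
qed

lemma integrable_norm_gauss: "integrable lborel (\<lambda>x::'a::euclidean_space. norm x * gauss 1 x)"
  by (rule Bochner_Integration.integrable_bound[OF integrable_gauss[of "1/2"]])
     (auto intro!: AE_I2 gauss_norm_mult_le)

lemma norm_cis_minus_1_le: "norm (cis x - 1) \<le> \<bar>x\<bar>"
  using iexp_approx1[of x 0] by (simp add: cis_conv_exp)

lemma cis_quotient_tendsto: "((\<lambda>h. (cis (h * b) - 1) / of_real h) \<longlongrightarrow> \<i> * of_real b) (at 0)"
proof (rule Lim_null[THEN iffD2, OF Lim_null_comparison])
  show "\<forall>\<^sub>F h in at 0. norm ((cis (h * b) - 1) / of_real h - \<i> * of_real b) \<le> \<bar>h\<bar> * b\<^sup>2 / 2"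
    unfolding eventually_at_filter
  proof (intro always_eventually allI impI)
    fix h :: real assume h: "h \<noteq> 0"
    have "norm (cis (h * b) - 1 - \<i> * of_real (h * b)) \<le> (h * b)\<^sup>2 / 2"
      using iexp_approx1[of "h * b" 1] by (simp add: cis_conv_exp algebra_simps power2_eq_square)
    then have e1: "norm (cis (h * b) - 1 - \<i> * of_real (h * b)) / \<bar>h\<bar> \<le> (h * b)\<^sup>2 / 2 / \<bar>h\<bar>"
      by (rule divide_right_mono) simp
    have e2: "(cis (h * b) - 1) / of_real h - \<i> * of_real b = (cis (h * b) - 1 - \<i> * of_real (h * b)) / of_real h"
      using h by (simp add: field_simps)
    have e3: "(h * b)\<^sup>2 / 2 / \<bar>h\<bar> = \<bar>h\<bar> * b\<^sup>2 / 2"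
      using h by (simp add: power_mult_distrib power2_eq_square field_simps)
    show "norm ((cis (h * b) - 1) / of_real h - \<i> * of_real b) \<le> \<bar>h\<bar> * b\<^sup>2 / 2"
      using e1 unfolding e2 e3 norm_divide norm_of_real .
  qed
  show "((\<lambda>h. \<bar>h\<bar> * b\<^sup>2 / 2) \<longlongrightarrow> 0) (at (0::real))"
    by (rule tendsto_eq_intros tendsto_rabs_zero refl | simp)+
qed

text \<open>Obtained by differentiating the transform of the Gaussian in the direction \<open>v\<close>.\<close>
lemma fourier_gauss_moment:
  fixes v y :: "'a::euclidean_space"
  shows "fourier (\<lambda>x. of_real ((x \<bullet> v) * gauss 1 x)) y = - \<i> * of_real ((v \<bullet> y) * gauss 1 y)"
proof -
  define h where "h n = 1 / real (Suc n)" for n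
  have h0: "h \<longlonglongrightarrow> 0" unfolding h_def by (rule LIMSEQ_Suc[OF lim_1_over_n])
  have hpos: "h n > 0" for n by (simp add: h_def)
  have hat: "filterlim h (at 0) sequentially"
    using h0 hpos by (simp add: filterlim_at less_imp_neq[THEN not_sym])
  \<comment> \<open>The integrand of the difference quotient of the transform of
    \<open>gauss 1\<close> at \<open>y\<close> in direction \<open>v\<close> with step
    \<open>h n\<close>. The limit of its integral is evaluated twice: under the integral sign, and
    from the closed form of the transform.\<close>
  define D where "D n x = of_real (gauss 1 x) * cis (- 2 * pi * (x \<bullet> y)) * ((cis (h n * (- 2 * pi * (x \<bullet> v))) - 1) / of_real (h n))" for n and x :: 'a
  have gi: "integrable lborel (\<lambda>x::'a. complex_of_real (gauss 1 x))"
    using integrable_gauss_unit[where 'a='a] by simp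
  have L1: "(\<lambda>n. LINT x|lborel. D n x) \<longlonglongrightarrow> (LINT x|lborel. of_real (gauss 1 x) * cis (- 2 * pi * (x \<bullet> y)) * (\<i> * of_real (- 2 * pi * (x \<bullet> v))))"
    unfolding D_def
  proof (rule integral_dominated_convergence[where w="\<lambda>x. 2 * pi * norm v * (norm x * gauss 1 x)"])
    show "integrable lborel (\<lambda>x::'a. 2 * pi * norm v * (norm x * gauss 1 x))"
      using integrable_norm_gauss by (intro integrable_mult_right) auto
    show "AE x in lborel. (\<lambda>n. of_real (gauss 1 x) * cis (- 2 * pi * (x \<bullet> y)) * ((cis (h n * (- 2 * pi * (x \<bullet> v))) - 1) / of_real (h n))) \<longlonglongrightarrow>
       of_real (gauss 1 x) * cis (- 2 * pi * (x \<bullet> y)) * (\<i> * of_real (- 2 * pi * (x \<bullet> v)))"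
      by (intro AE_I2 tendsto_mult tendsto_const filterlim_compose[OF cis_quotient_tendsto hat])
    show "AE x in lborel. norm (of_real (gauss 1 x) * cis (- 2 * pi * (x \<bullet> y)) * ((cis (h n * (- 2 * pi * (x \<bullet> v))) - 1) / of_real (h n))) \<le> 2 * pi * norm v * (norm x * gauss 1 x)" for n
    proof (rule AE_I2)
      fix x :: 'a
      have "norm (cis (h n * (- 2 * pi * (x \<bullet> v))) - 1) \<le> h n * (2 * pi * (norm x * norm v))"
      proof -
        have "\<bar>h n * (- 2 * pi * (x \<bullet> v))\<bar> = h n * (2 * pi * \<bar>x \<bullet> v\<bar>)"
          using hpos[of n] by (simp add: abs_mult)
        also have "\<dots> \<le> h n * (2 * pi * (norm x * norm v))"
          using hpos[of n] by (intro mult_left_mono Cauchy_Schwarz_ineq2) auto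
        finally show ?thesis using norm_cis_minus_1_le[of "h n * (- 2 * pi * (x \<bullet> v))"] by simp
      qed
      then have "norm ((cis (h n * (- 2 * pi * (x \<bullet> v))) - 1) / of_real (h n)) \<le> 2 * pi * (norm x * norm v)"
        using hpos[of n] by (simp add: norm_divide divide_le_eq mult.commute)
      then have "gauss 1 x * norm ((cis (h n * (- 2 * pi * (x \<bullet> v))) - 1) / of_real (h n)) \<le> gauss 1 x * (2 * pi * (norm x * norm v))"
        by (rule mult_left_mono) simp
      then show "norm (of_real (gauss 1 x) * cis (- 2 * pi * (x \<bullet> y)) * ((cis (h n * (- 2 * pi * (x \<bullet> v))) - 1) / of_real (h n))) \<le> 2 * pi * norm v * (norm x * gauss 1 x)"
        by (simp only: norm_mult norm_cis norm_of_real abs_of_nonneg[OF gauss_nonneg] mult_1_right) (simp only: mult_ac)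
    qed
  qed measurable
  have L2: "(LINT x|lborel. D n x) = of_real ((gauss 1 (y + h n *\<^sub>R v) - gauss 1 y) / h n)" for n
  proof -
    have "D n x = (1 / of_real (h n)) * (of_real (gauss 1 x) * cis (- 2 * pi * (x \<bullet> (y + h n *\<^sub>R v))) - of_real (gauss 1 x) * cis (- 2 * pi * (x \<bullet> y)))" for x
    proof -
      have "- 2 * pi * (x \<bullet> (y + h n *\<^sub>R v)) = - 2 * pi * (x \<bullet> y) + h n * (- 2 * pi * (x \<bullet> v))"
        by (simp add: inner_add_right algebra_simps)
      then show ?thesis unfolding D_def by (simp only: cis_mult[symmetric]) (simp add: algebra_simps diff_divide_distrib)
    qed
    then have "(LINT x|lborel. D n x) = (1 / of_real (h n)) * (LINT x|lborel. of_real (gauss 1 x) * cis (- 2 * pi * (x \<bullet> (y + h n *\<^sub>R v))) - of_real (gauss 1 x) * cis (- 2 * pi * (x \<bullet> y)))"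
      by simp
    also have "\<dots> = (1 / of_real (h n)) * (fourier (\<lambda>x. of_real (gauss 1 x)) (y + h n *\<^sub>R v) - fourier (\<lambda>x. of_real (gauss 1 x)) y)"
      unfolding fourier_def
      by (subst Bochner_Integration.integral_diff) (auto intro!: integrable_mult_cis gi)
    finally show ?thesis unfolding fourier_gauss_unit(2) by simp
  qed
  have L3: "(\<lambda>n. complex_of_real ((gauss 1 (y + h n *\<^sub>R v) - gauss 1 y) / h n)) \<longlonglongrightarrow> of_real (- 2 * pi * (v \<bullet> y) * gauss 1 y)"
  proof (rule tendsto_of_real)
    have "gauss 1 (y + t *\<^sub>R v) = exp (- (pi * ((norm y)\<^sup>2 + 2 * t * (v \<bullet> y) + t\<^sup>2 * (norm v)\<^sup>2)))" for t
    proof -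
      have "(norm (y + t *\<^sub>R v))\<^sup>2 = (norm y)\<^sup>2 + 2 * t * (v \<bullet> y) + t\<^sup>2 * (norm v)\<^sup>2"
        unfolding power2_norm_eq_inner
        by (simp add: inner_add_left inner_add_right inner_commute[of y v] power2_eq_square algebra_simps)
      then show ?thesis by (simp add: gauss_def)
    qed
    then have "((\<lambda>t. gauss 1 (y + t *\<^sub>R v)) has_field_derivative (- 2 * pi * (v \<bullet> y) * gauss 1 y)) (at 0)"
      by (auto intro!: derivative_eq_intros simp: gauss_def)
    then have "((\<lambda>t. (gauss 1 (y + t *\<^sub>R v) - gauss 1 y) / t) \<longlongrightarrow> - 2 * pi * (v \<bullet> y) * gauss 1 y) (at 0)"
      by (simp add: has_field_derivative_iff)
    then show "(\<lambda>n. (gauss 1 (y + h n *\<^sub>R v) - gauss 1 y) / h n) \<longlonglongrightarrow> - 2 * pi * (v \<bullet> y) * gauss 1 y"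
      by (rule filterlim_compose[OF _ hat])
  qed
  have "(LINT x|lborel. of_real (gauss 1 x) * cis (- 2 * pi * (x \<bullet> y)) * (\<i> * of_real (- 2 * pi * (x \<bullet> v)))) = complex_of_real (- 2 * pi * (v \<bullet> y) * gauss 1 y)"
    by (rule LIMSEQ_unique[OF L1[unfolded L2] L3])
  moreover have "(LINT x|lborel. of_real (gauss 1 x) * cis (- 2 * pi * (x \<bullet> y)) * (\<i> * of_real (- 2 * pi * (x \<bullet> v))))
     = - 2 * pi * \<i> * fourier (\<lambda>x. of_real ((x \<bullet> v) * gauss 1 x)) y"
    unfolding fourier_def Bochner_Integration.integral_mult_right_zero[symmetric]
    by (intro Bochner_Integration.integral_cong refl) (simp add: mult_ac)
  ultimately have "(- 2 * pi * \<i>) * fourier (\<lambda>x. of_real ((x \<bullet> v) * gauss 1 x)) y = (- 2 * pi * \<i>) * (- \<i> * of_real ((v \<bullet> y) * gauss 1 y))"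
    by (simp add: algebra_simps)
  then show ?thesis by (subst (asm) mult_left_cancel) auto
qed

text \<open>The Laplace representation of \<open>q powr (- a)\<close>. With \<open>q\<close> affine
  in \<open>|y|^2\<close> it exhibits powers of quadratic expressions as superpositions of
  Gaussians.\<close>

lemma Gamma_integral_scaled:
  fixes a q :: real
  assumes "a > 0" "q > 0"
  shows "has_bochner_integral lborel (\<lambda>t. indicator {0<..} t * (t powr (a - 1) * exp (- (q * t)))) (Gamma a * q powr (- a))"
proof -
  define f where "f t = indicator {0<..} t * (t powr (a - 1) * exp (- t))" for t :: real
  have [measurable]: "f \<in> borel_measurable borel" unfolding f_def by measurable
  have "(\<integral>\<^sup>+t. ennreal (f t) \<partial>lborel) = ennreal (Gamma a)"
    unfolding Gamma_conv_nn_integral_real[OF assms(1)]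
    by (intro nn_integral_cong) (auto simp: f_def indicator_def exp_minus field_simps)
  then have "has_bochner_integral lborel f (Gamma a)"
    using assms by (intro has_bochner_integral_nn_integral AE_I2) (auto simp: f_def intro!: Gamma_real_nonneg)
  then have "has_bochner_integral lborel (\<lambda>t. f (0 + q * t)) (Gamma a /\<^sub>R \<bar>q\<bar>)"
    by (subst lborel_has_bochner_integral_real_affine_iff[of q _ _ 0, symmetric]) (use assms in auto)
  then have "has_bochner_integral lborel (\<lambda>t. q powr (1 - a) * f (q * t)) (q powr (1 - a) * (Gamma a / q))"
    using assms by (intro has_bochner_integral_mult_right) (auto simp: divide_inverse mult.commute)
  moreover have "q powr (1 - a) * f (q * t) = indicator {0<..} t * (t powr (a - 1) * exp (- (q * t)))" for t
    using assms by (auto simp: f_def indicator_def powr_mult powr_add[symmetric] zero_less_mult_iff mult.assoc[symmetric])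
  moreover have "q powr (1 - a) * (Gamma a / q) = Gamma a * q powr (- a)"
    using assms by (simp add: powr_diff powr_minus field_simps)
  ultimately show ?thesis by simp
qed

text \<open>\<open>gauss 1\<close> is the transform of a probability density, hence norm 1; the
  other widths are dilates.\<close>

lemma fmult_gauss:
  assumes u: "u \<ge> 1" and c: "c \<ge> 0"
  shows "fmult u 1 (\<lambda>y::'a::euclidean_space. of_real (gauss c y))"
proof (cases "c = 0")
  case True
  then show ?thesis by (simp add: gauss_def fmult_const_1)
next
  case False
  have "(LINT x|lborel. complex_of_real (gauss 1 (x::'a))) = 1"
    using fourier_gauss_unit(2)[of "0::'a"] by (simp add: fourier_def gauss_def)
  then have "(LINT v|lborel. norm (complex_of_real (gauss 1 (v::'a)))) = 1"
    by simp
  moreover have "fourier (\<lambda>x. complex_of_real (gauss 1 x)) = (\<lambda>y::'a. of_real (gauss 1 y))"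
    by (rule ext) (rule fourier_gauss_unit(2))
  ultimately have "fmult u 1 (\<lambda>y::'a. of_real (gauss 1 y))"
    using fmult_fourier[of "\<lambda>v::'a. complex_of_real (gauss 1 v)" u] u integrable_gauss_unit[where 'a='a] by simp
  from fmult_affine[OF this, of "sqrt c" 0] show ?thesis using False c by (simp add: gauss_scale)
qed

definition gauss_mom :: "'a::euclidean_space itself \<Rightarrow> real" where
  "gauss_mom _ = (LINT x|lborel. norm (x::'a) * gauss 1 x)"

lemma gauss_mom_nonneg: "0 \<le> gauss_mom TYPE('a::euclidean_space)"
  unfolding gauss_mom_def by (intro integral_nonneg_AE AE_I2) auto

text \<open>Up to the factor \<open>- \<i>\<close> the symbol is the transform of
  \<open>(x \<bullet> v) * gauss 1 x\<close>, whose L^1 norm is controlled by the Gaussian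
  moment.\<close>

lemma fmult_gauss_moment:
  fixes v :: "'a::euclidean_space"
  assumes u: "u \<ge> 1"
  shows "fmult u (gauss_mom TYPE('a) * norm v) (\<lambda>y. of_real ((v \<bullet> y) * gauss 1 y))"
proof -
  have i: "integrable lborel (\<lambda>x::'a. norm v * (norm x * gauss 1 x))"
    using integrable_norm_gauss by (intro integrable_mult_right) auto
  have b: "norm (complex_of_real ((x \<bullet> v) * gauss 1 x)) \<le> norm v * (norm x * gauss 1 x)" for x
    using mult_right_mono[OF Cauchy_Schwarz_ineq2[of x v], of "gauss 1 x"] by (simp add: norm_mult mult_ac)
  have k: "integrable lborel (\<lambda>x. complex_of_real ((x \<bullet> v) * gauss 1 x))"
    by (rule Bochner_Integration.integrable_bound[OF i]) (use b in \<open>auto intro!: AE_I2 order_trans[OF b]\<close>)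
  have "fourier (\<lambda>x. complex_of_real ((x \<bullet> v) * gauss 1 x)) = (\<lambda>y. - \<i> * of_real ((v \<bullet> y) * gauss 1 y))"
    by (rule ext) (rule fourier_gauss_moment)
  then have "fmult u (LINT x|lborel. norm (complex_of_real ((x \<bullet> v) * gauss 1 x))) (\<lambda>y. - \<i> * of_real ((v \<bullet> y) * gauss 1 y))"
    using fmult_fourier[OF k u] by simp
  from fmult_cmult[OF this, of \<i>]
  have f: "fmult u (LINT x|lborel. norm (complex_of_real ((x \<bullet> v) * gauss 1 x))) (\<lambda>y. of_real ((v \<bullet> y) * gauss 1 y))"
    by (simp add: mult.assoc[symmetric])
  have le: "(LINT x|lborel. norm (complex_of_real ((x \<bullet> v) * gauss 1 x))) \<le> (LINT x|lborel. norm v * (norm (x::'a) * gauss 1 x))"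
    using k by (intro integral_mono i integrable_norm b)
  show ?thesis using fmult_mono[OF f le] u by (simp add: gauss_mom_def mult.commute)
qed

text \<open>The resolvent symbol is the Laplace transform in \<open>t\<close> of the Gaussians \<open>gauss (4 pi t)\<close>.\<close>
lemma fmult_resolvent:
  assumes u: "u \<ge> 1"
  shows "fmult u 1 (\<lambda>y::'a::euclidean_space. of_real (1 / (1 + 4 * pi\<^sup>2 * (norm y)\<^sup>2)))"
proof -
  define k where "k t = complex_of_real (indicator {0<..} t * (t powr (1 - 1) * exp (- (1 * t))))" for t :: real
  have hb: "has_bochner_integral lborel (\<lambda>t. indicator {0<..} t * (t powr (1 - 1) * exp (- (q * t)))) (1 / q)" if "q > 0" for q :: real
    using Gamma_integral_scaled[of 1 q] that by (simp add: powr_minus_divide)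
  have k: "integrable lborel k"
    unfolding k_def complex_of_real_integrable_eq using hb[of 1] by (simp add: has_bochner_integral_iff)
  have "norm (k t) = indicator {0<..} t * (t powr (1 - 1) * exp (- (1 * t)))" for t
    by (simp add: k_def norm_mult)
  then have nk: "(LINT t|lborel. norm (k t)) = 1"
    using hb[of 1] by (simp add: has_bochner_integral_iff)
  \<comment> \<open>\<open>max t 0\<close> makes every member of the family a multiplier of norm at
    most 1; \<open>k\<close> vanishes for \<open>t \<le> 0\<close>.\<close>
  have "fmult u ((LINT t|lborel. norm (k t)) * 1) (\<lambda>y::'a. LINT t|lborel. k t * of_real (gauss (4 * pi * max t 0) y))"
    by (rule fmult_average[OF sigma_finite_lborel k u _ fmult_gauss[OF u]]) (auto simp: gauss_def)
  moreover have "(LINT t|lborel. k t * of_real (gauss (4 * pi * max t 0) y)) = of_real (1 / (1 + 4 * pi\<^sup>2 * (norm y)\<^sup>2))" for y :: 'a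
  proof -
    define q where "q = 1 + 4 * pi\<^sup>2 * (norm y)\<^sup>2"
    have q: "q > 0" unfolding q_def by (intro add_pos_nonneg) auto
    have eq: "(\<lambda>t. k t * of_real (gauss (4 * pi * max t 0) y)) = (\<lambda>t. complex_of_real (indicator {0<..} t * (t powr (1 - 1) * exp (- (q * t)))))"
      by (rule ext) (auto simp: k_def gauss_def indicator_def q_def exp_add[symmetric] exp_minus[symmetric] power2_eq_square algebra_simps
          simp flip: of_real_mult)
    show ?thesis
      unfolding eq integral_complex_of_real has_bochner_integral_integral_eq[OF hb[OF q]] by (simp add: q_def)
  qed
  ultimately show ?thesis by (simp add: nk)
qed

text \<open>Splitting the constant 1 in the Laplace integral as \<open>t powr (-1/2)\<close> times
  \<open>sqrt t\<close> compensates the unbounded factor \<open>v \<bullet> y\<close>: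
  \<open>sqrt t * (v \<bullet> y) * gauss (4 * pi * t) y\<close> is a multiple of a dilated Gaussian
  moment, with norm bound independent of \<open>t\<close>. The remaining weight has mass
  \<open>Gamma (1/2) = sqrt pi\<close>.\<close>

lemma fmult_resolvent_gradient:
  fixes v :: "'a::euclidean_space"
  assumes u: "u \<ge> 1"
  shows "fmult u (gauss_mom TYPE('a) * norm v) (\<lambda>y. of_real ((v \<bullet> y) / (1 + 4 * pi\<^sup>2 * (norm y)\<^sup>2)))"
proof -
  define k where "k t = complex_of_real (indicator {0<..} t * (t powr (1/2 - 1) * exp (- (1 * t))))" for t :: real
  have hk: "has_bochner_integral lborel (\<lambda>t. indicator {0<..} t * (t powr (1/2 - 1) * exp (- (1 * t)))) (sqrt pi)"
    using Gamma_integral_scaled[of "1/2" 1] by (simp add: Gamma_one_half_real)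
  have hb: "has_bochner_integral lborel (\<lambda>t. indicator {0<..} t * (t powr (1 - 1) * exp (- (q * t)))) (1 / q)" if "q > 0" for q :: real
    using Gamma_integral_scaled[of 1 q] that by (simp add: powr_minus_divide)
  have k: "integrable lborel k"
    unfolding k_def complex_of_real_integrable_eq using hk by (simp add: has_bochner_integral_iff)
  have "norm (k t) = indicator {0<..} t * (t powr (1/2 - 1) * exp (- (1 * t)))" for t
    by (simp add: k_def norm_mult)
  then have nk: "(LINT t|lborel. norm (k t)) = sqrt pi"
    using hk by (simp add: has_bochner_integral_iff)
  define \<mu> where "\<mu> t y = complex_of_real (sqrt (max t 0) * (v \<bullet> y) * gauss (4 * pi * max t 0) y)" for t y
  have "fmult u (gauss_mom TYPE('a) * norm v / sqrt (4 * pi)) (\<mu> t)" for t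
  proof (cases "t > 0")
    case True
    define \<tau> where "\<tau> = sqrt (4 * pi * t)"
    have \<tau>: "\<tau> > 0" "\<tau>\<^sup>2 = 4 * pi * t" using True by (auto simp: \<tau>_def)
    have "fmult u (norm (complex_of_real (1 / sqrt (4 * pi))) * (gauss_mom TYPE('a) * norm v))
       (\<lambda>y. of_real (1 / sqrt (4 * pi)) * of_real ((v \<bullet> (0 + \<tau> *\<^sub>R y)) * gauss 1 (0 + \<tau> *\<^sub>R y)))"
      using \<tau>(1) by (intro fmult_cmult fmult_affine[OF fmult_gauss_moment[OF u]]) auto
    moreover have "of_real (1 / sqrt (4 * pi)) * of_real ((v \<bullet> (0 + \<tau> *\<^sub>R y)) * gauss 1 (0 + \<tau> *\<^sub>R y)) = \<mu> t y" for y
    proof -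
      have "1 / sqrt (4 * pi) * ((v \<bullet> (0 + \<tau> *\<^sub>R y)) * gauss 1 (0 + \<tau> *\<^sub>R y)) = sqrt (max t 0) * (v \<bullet> y) * gauss (4 * pi * max t 0) y"
        using True by (simp add: gauss_scale \<tau>(2)) (simp add: \<tau>_def real_sqrt_mult max_def)
      then show ?thesis unfolding \<mu>_def of_real_mult[symmetric] by (simp only:)
    qed
    ultimately show ?thesis by (simp add: norm_divide)
  next
    case False
    then have "\<mu> t = (\<lambda>y. 0)" by (simp add: \<mu>_def max_def fun_eq_iff)
    then show ?thesis using u gauss_mom_nonneg[where 'a='a] by (auto intro!: fmult_const_0 divide_nonneg_nonneg mult_nonneg_nonneg)
  qed
  then have "fmult u ((LINT t|lborel. norm (k t)) * (gauss_mom TYPE('a) * norm v / sqrt (4 * pi))) (\<lambda>y. LINT t|lborel. k t * \<mu> t y)"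
    by (rule fmult_average[OF sigma_finite_lborel k u, rotated]) (auto simp: \<mu>_def gauss_def)
  moreover have "(LINT t|lborel. k t * \<mu> t y) = of_real ((v \<bullet> y) / (1 + 4 * pi\<^sup>2 * (norm y)\<^sup>2))" for y :: 'a
  proof -
    define q where "q = 1 + 4 * pi\<^sup>2 * (norm y)\<^sup>2"
    have q: "q > 0" unfolding q_def by (intro add_pos_nonneg) auto
    have eq: "k t * \<mu> t y = complex_of_real ((v \<bullet> y) * (indicator {0<..} t * (t powr (1 - 1) * exp (- (q * t)))))" for t
    proof (cases "t > 0")
      case True
      have "t powr (1/2 - 1) * sqrt t = 1"
        using True by (simp add: powr_half_sqrt[symmetric] powr_add[symmetric])
      then have "(t powr (1/2 - 1) * exp (- t)) * (sqrt t * (v \<bullet> y) * gauss (4 * pi * t) y) = (v \<bullet> y) * (exp (- t) * gauss (4 * pi * t) y)"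
        by (simp add: mult_ac)
      moreover have "exp (- t) * gauss (4 * pi * t) y = exp (- (q * t))"
        by (simp add: gauss_def exp_add[symmetric] q_def power2_eq_square algebra_simps)
      ultimately show ?thesis using True by (simp add: k_def \<mu>_def max_def flip: of_real_mult)
    qed (simp add: k_def)
    show ?thesis
      unfolding eq integral_complex_of_real Bochner_Integration.integral_mult_right_zero
        has_bochner_integral_integral_eq[OF hb[OF q]] by (simp add: q_def)
  qed
  ultimately have f: "fmult u (sqrt pi * (gauss_mom TYPE('a) * norm v / sqrt (4 * pi))) (\<lambda>y. of_real ((v \<bullet> y) / (1 + 4 * pi\<^sup>2 * (norm y)\<^sup>2)))"
    by (simp add: nk)
  have "sqrt pi * (gauss_mom TYPE('a) * norm v / sqrt (4 * pi)) \<le> gauss_mom TYPE('a) * norm v"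
    using gauss_mom_nonneg[where 'a='a] by (simp add: real_sqrt_mult)
  then show ?thesis using fmult_mono[OF f] u by simp
qed

text \<open>The sum is an average of the normalised symbols over a two-point space with weights
  \<open>B\<close> and \<open>C\<close>, so the triangle inequality comes from
  \<open>fmult_average\<close>.\<close>

lemma fmult_add:
  fixes \<mu> \<nu> :: "'a::euclidean_space \<Rightarrow> complex"
  assumes 1: "fmult u B \<mu>" and 2: "fmult u C \<nu>" and "B > 0" "C > 0" "u \<ge> 1"
  shows "fmult u (B + C) (\<lambda>y. \<mu> y + \<nu> y)"
proof -
  define k where "k b = complex_of_real (if b then B else C)" for b
  define g where "g b y = (if b then \<mu> y / of_real B else \<nu> y / of_real C)" for b y
  note [measurable] = fmult_measurable[OF 1] fmult_measurable[OF 2]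
  have [measurable]: "g b \<in> borel_measurable borel" for b
    unfolding g_def by (cases b) auto
  have "fmult u ((LINT b|count_space UNIV. norm (k b)) * 1) (\<lambda>y. LINT b|count_space UNIV. k b * g b y)"
  proof (rule fmult_average)
    show "sigma_finite_measure (count_space (UNIV :: bool set))"
      by (rule sigma_finite_measure_count_space_countable) simp
    show "integrable (count_space UNIV) k" by (rule integrable_count_space) simp
    show "(\<lambda>(v, x). g v x) \<in> borel_measurable (count_space UNIV \<Otimes>\<^sub>M borel)"
      by (rule measurable_pair_measure_countable1) auto
    show "fmult u 1 (g v)" for v
      using fmult_cmult[OF 1, of "1 / of_real B"] fmult_cmult[OF 2, of "1 / of_real C"] assms
      by (cases v) (auto simp: g_def[abs_def] norm_divide)
  qed fact
  moreover have "(LINT b|count_space UNIV. norm (k b)) = B + C"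
    using assms by (subst lebesgue_integral_count_space_finite) (auto simp: UNIV_bool k_def)
  moreover have "(LINT b|count_space UNIV. k b * g b y) = \<mu> y + \<nu> y" for y
    using assms by (subst lebesgue_integral_count_space_finite) (auto simp: UNIV_bool k_def g_def)
  ultimately show ?thesis by simp
qed

text \<open>The binomial series in \<open>b\<close> is an average of the powers
  \<open>(2 * b) ^ n\<close>, of norm at most 1, with weights
  \<open>(\<alpha> gchoose n) * (1/2) ^ n\<close>. The constant depends on \<open>\<alpha>\<close>
  but not on \<open>b\<close>; this uniformity permits iteration.\<close>

lemma fmult_binomial:
  fixes \<alpha> :: real
  obtains C where "C \<ge> 1"
    "\<And>(b :: 'a::euclidean_space \<Rightarrow> real). fmult u (1/2) (\<lambda>y. of_real (b y)) \<Longrightarrow> u \<ge> 1 \<Longrightarrow>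
       fmult u C (\<lambda>y. of_real ((1 + b y) powr \<alpha>))"
proof -
  define k where "k n = complex_of_real ((\<alpha> gchoose n) * (1/2) ^ n)" for n
  \<comment> \<open>Any point strictly between 1/2 and 1 would do: convergence there gives absolute
    convergence at 1/2.\<close>
  have "summable (\<lambda>n. (\<alpha> gchoose n) * (3/4) ^ n)"
    using gen_binomial_real[of "3/4" \<alpha>] by (simp add: sums_iff)
  from powser_insidea[OF this, of "1/2"] have "summable (\<lambda>n. norm (k n))"
    by (simp add: k_def norm_mult norm_power abs_mult power_abs)
  then have ki: "integrable (count_space UNIV) k"
    by (simp add: integrable_count_space_nat_iff)
  define C where "C = max 1 (LINT n|count_space UNIV. norm (k n))"
  have "fmult u C (\<lambda>y. of_real ((1 + b y) powr \<alpha>))"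
    if b: "fmult u (1/2) (\<lambda>y. of_real (b y))" and u: "u \<ge> 1" for b :: "'a \<Rightarrow> real"
  proof -
    note [measurable] = fmult_measurable[OF b]
    define g where "g n y = (2 * complex_of_real (b y)) ^ n" for n y
    have b2: "fmult u 1 (\<lambda>y. 2 * complex_of_real (b y))"
      using fmult_cmult[OF b, of 2] by simp
    have g: "fmult u 1 (g n)" for n
      using fmult_power[OF b2, of n] by (simp add: g_def[abs_def])
    have av: "fmult u ((LINT n|count_space UNIV. norm (k n)) * 1) (\<lambda>y. LINT n|count_space UNIV. k n * g n y)"
    proof (rule fmult_average[OF _ ki u _ g])
      show "sigma_finite_measure (count_space (UNIV :: nat set))"
        by (rule sigma_finite_measure_count_space_countable) simp
      show "(\<lambda>(v, x). g v x) \<in> borel_measurable (count_space UNIV \<Otimes>\<^sub>M borel)"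
        by (rule measurable_pair_measure_countable1) (use fmult_measurable[OF g] in auto)
    qed
    have "(LINT n|count_space UNIV. k n * g n y) = of_real ((1 + b y) powr \<alpha>)" for y
    proof -
      have "norm (g n y) \<le> 1" for n using fmult_norm_le[OF g] .
      then have "integrable (count_space UNIV) (\<lambda>n. k n * g n y)"
        by (intro integrable_mult_bounded[OF ki]) auto
      then have "(\<lambda>n. k n * g n y) sums (LINT n|count_space UNIV. k n * g n y)"
        by (rule sums_integral_count_space_nat)
      moreover have "\<bar>b y\<bar> < 1" using fmult_norm_le[OF b, of y] by simp
      from gen_binomial_real[OF this, of \<alpha>] have "(\<lambda>n. complex_of_real ((\<alpha> gchoose n) * b y ^ n)) sums of_real ((1 + b y) powr \<alpha>)"
        by (rule sums_of_real)
      moreover have "complex_of_real ((\<alpha> gchoose n) * b y ^ n) = k n * g n y" for n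
        by (simp add: k_def g_def power_mult_distrib power_divide)
      ultimately show ?thesis by (simp add: sums_iff)
    qed
    with av have "fmult u (LINT n|count_space UNIV. norm (k n)) (\<lambda>y. of_real ((1 + b y) powr \<alpha>))" by simp
    then show ?thesis by (rule fmult_mono) (use u in \<open>auto simp: C_def\<close>)
  qed
  then show thesis by (intro that[of C]) (auto simp: C_def)
qed


lemma resolvent_rescale:
  fixes y :: "'a::euclidean_space"
  assumes "A > 0"
  shows "1 + 4 * pi\<^sup>2 * (norm (0 + (1 / sqrt A) *\<^sub>R y))\<^sup>2 = (A + 4 * pi\<^sup>2 * (norm y)\<^sup>2) / A"
  using assms by (simp add: power_divide power_mult_distrib field_simps)

lemma fmult_resolvent_scaled:
  assumes u: "u \<ge> 1" and A: "A > 0"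
  shows "fmult u 1 (\<lambda>y::'a::euclidean_space. of_real (A / (A + 4 * pi\<^sup>2 * (norm y)\<^sup>2)))"
proof -
  have "fmult u 1 (\<lambda>y::'a. of_real (1 / (1 + 4 * pi\<^sup>2 * (norm (0 + (1 / sqrt A) *\<^sub>R y))\<^sup>2)))"
    by (rule fmult_affine[OF fmult_resolvent[OF u]]) (use A in auto)
  then show ?thesis unfolding resolvent_rescale[OF A] by (simp only: divide_divide_eq_right mult_1)
qed

text \<open>The norm bound does not depend on \<open>A\<close>, so without the factor
  \<open>sqrt A\<close> the symbol has norm at most of order \<open>A powr (-1/2)\<close>: the cross
  term of a translation by \<open>v\<close> is small once \<open>A\<close> is large compared with
  \<open>|v|^2\<close>.\<close>

lemma fmult_resolvent_gradient_scaled: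
  fixes v :: "'a::euclidean_space"
  assumes u: "u \<ge> 1" and A: "A > 0"
  shows "fmult u (gauss_mom TYPE('a) * norm v) (\<lambda>y. of_real (sqrt A * (v \<bullet> y) / (A + 4 * pi\<^sup>2 * (norm y)\<^sup>2)))"
proof -
  have F: "fmult u (gauss_mom TYPE('a) * norm v) (\<lambda>y::'a. of_real ((v \<bullet> (0 + (1 / sqrt A) *\<^sub>R y)) / (1 + 4 * pi\<^sup>2 * (norm (0 + (1 / sqrt A) *\<^sub>R y))\<^sup>2)))"
    by (rule fmult_affine[OF fmult_resolvent_gradient[OF u]]) (use A in auto)
  have eq: "(v \<bullet> (0 + (1 / sqrt A) *\<^sub>R y)) / ((A + 4 * pi\<^sup>2 * (norm y)\<^sup>2) / A) = sqrt A * (v \<bullet> y) / (A + 4 * pi\<^sup>2 * (norm y)\<^sup>2)" for y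
  proof -
    have "(v \<bullet> (0 + (1 / sqrt A) *\<^sub>R y)) / ((A + 4 * pi\<^sup>2 * (norm y)\<^sup>2) / A) = (A / sqrt A) * (v \<bullet> y) / (A + 4 * pi\<^sup>2 * (norm y)\<^sup>2)"
      by (simp only: add_0 inner_scaleR_right divide_divide_eq_right times_divide_eq_left times_divide_eq_right mult_1_left mult_ac)
    then show ?thesis using A by (simp only: real_div_sqrt less_imp_le)
  qed
  show ?thesis using F unfolding resolvent_rescale[OF A] eq .
qed

text \<open>One step changes the constant by a factor of at most 3/2, which keeps the relative
  perturbation, in both directions, within the 1/2 required by the binomial series. \<open>K\<close>
  steps cost \<open>C ^ K\<close>; with \<open>K\<close> logarithmic in \<open>B / A\<close> this
  becomes a power of \<open>B / A\<close>.\<close>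

lemma fmult_resolvent_ratio:
  fixes \<alpha> :: real
  assumes u: "u \<ge> 1" and C: "C \<ge> 1"
    and binom: "\<And>(b :: 'a::euclidean_space \<Rightarrow> real). fmult u (1/2) (\<lambda>y. of_real (b y)) \<Longrightarrow>
       fmult u C (\<lambda>y. of_real ((1 + b y) powr \<alpha>))"
  shows "0 < A \<Longrightarrow> A \<le> B \<Longrightarrow> B \<le> A * (3/2) ^ K \<Longrightarrow>
    fmult u (C ^ K) (\<lambda>y::'a. of_real (((A + 4 * pi\<^sup>2 * (norm y)\<^sup>2) / (B + 4 * pi\<^sup>2 * (norm y)\<^sup>2)) powr \<alpha>)) \<and>
    fmult u (C ^ K) (\<lambda>y::'a. of_real (((B + 4 * pi\<^sup>2 * (norm y)\<^sup>2) / (A + 4 * pi\<^sup>2 * (norm y)\<^sup>2)) powr \<alpha>))"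
proof (induction K arbitrary: B)
  case 0
  have "A + 4 * pi\<^sup>2 * (norm (y::'a))\<^sup>2 > 0" for y using 0 by (intro add_pos_nonneg) auto
  then have "A + 4 * pi\<^sup>2 * (norm (y::'a))\<^sup>2 \<noteq> 0" for y by (metis less_irrefl)
  moreover have "B = A" using 0 by simp
  ultimately show ?case by (simp add: fmult_const_1)
next
  case (Suc K)
  define Q where "Q A y = A + 4 * pi\<^sup>2 * (norm y)\<^sup>2" for A :: real and y :: 'a
  have Q: "Q A y > 0" if "A > 0" for A y using that by (auto simp: Q_def intro!: add_pos_nonneg)
  have res: "fmult u 1 (\<lambda>y. of_real (A / Q A y))" if "A > 0" for A
    unfolding Q_def by (rule fmult_resolvent_scaled[OF u that])
  \<comment> \<open>The step is truncated at \<open>A\<close>, so that the induction hypothesis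
    still sees \<open>A \<le> B'\<close>.\<close>
  define B' where "B' = max A (B * (2/3))"
  have B': "A \<le> B'" "B' \<le> A * (3/2) ^ K" "B' \<le> B" "B \<le> B' * (3/2)" "B' > 0" "B > 0"
    using Suc.prems by (auto simp: B'_def max_def mult_ac)
  note IH = Suc.IH[OF Suc.prems(1) B'(1,2), folded Q_def]
  have step1: "fmult u C (\<lambda>y. of_real ((Q B' y / Q B y) powr \<alpha>))"
  proof -
    have "fmult u (norm (complex_of_real (- ((B - B') / B))) * 1) (\<lambda>y. of_real (- ((B - B') / B)) * of_real (B / Q B y))"
      using B' by (intro fmult_cmult res)
    then have "fmult u (1/2) (\<lambda>y. of_real (- ((B - B') / B)) * of_real (B / Q B y))"
      by (rule fmult_mono) (use B' u in \<open>auto simp: norm_minus_cancel norm_of_real divide_le_eq simp del: of_real_divide of_real_minus\<close>)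
    then have f: "fmult u (1/2) (\<lambda>y. of_real (- ((B - B') / B) * (B / Q B y)))"
      by (simp only: of_real_mult)
    have "1 + - ((B - B') / B) * (B / Q B y) = Q B' y / Q B y" for y
    proof -
      have "- ((B - B') / B) * (B / Q B y) = (B' - B) / Q B y" using B' by simp
      moreover have "Q B' y = Q B y + (B' - B)" by (simp add: Q_def)
      ultimately show ?thesis using Q[of B y] B' by (simp add: add_divide_distrib)
    qed
    then show ?thesis using binom[OF f] by (simp only:)
  qed
  have step2: "fmult u C (\<lambda>y. of_real ((Q B y / Q B' y) powr \<alpha>))"
  proof -
    have "fmult u (norm (complex_of_real ((B - B') / B')) * 1) (\<lambda>y. of_real ((B - B') / B') * of_real (B' / Q B' y))"
      using B' by (intro fmult_cmult res)
    then have "fmult u (1/2) (\<lambda>y. of_real ((B - B') / B') * of_real (B' / Q B' y))"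
      by (rule fmult_mono) (use B' u in \<open>auto simp: norm_of_real divide_le_eq simp del: of_real_divide of_real_minus\<close>)
    then have f: "fmult u (1/2) (\<lambda>y. of_real ((B - B') / B' * (B' / Q B' y)))"
      by (simp only: of_real_mult)
    have "1 + (B - B') / B' * (B' / Q B' y) = Q B y / Q B' y" for y
    proof -
      have "(B - B') / B' * (B' / Q B' y) = (B - B') / Q B' y" using B' by simp
      moreover have "Q B y = Q B' y + (B - B')" by (simp add: Q_def)
      ultimately show ?thesis using Q[of B' y] B' by (simp add: add_divide_distrib)
    qed
    then show ?thesis using binom[OF f] by (simp only:)
  qed
  have "fmult u (C * C ^ K) (\<lambda>y. of_real ((Q B' y / Q B y) powr \<alpha>) * of_real ((Q A y / Q B' y) powr \<alpha>))"
    using IH by (intro fmult_mult step1) auto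
  moreover have "complex_of_real ((Q B' y / Q B y) powr \<alpha>) * of_real ((Q A y / Q B' y) powr \<alpha>) = of_real ((Q A y / Q B y) powr \<alpha>)" for y
    using Q[of B' y] Q[of A y] Q[of B y] B' Suc.prems by (simp add: powr_mult[symmetric] flip: of_real_mult)
  moreover have "fmult u (C * C ^ K) (\<lambda>y. of_real ((Q B y / Q B' y) powr \<alpha>) * of_real ((Q B' y / Q A y) powr \<alpha>))"
    using IH by (intro fmult_mult step2) auto
  moreover have "complex_of_real ((Q B y / Q B' y) powr \<alpha>) * of_real ((Q B' y / Q A y) powr \<alpha>) = of_real ((Q B y / Q A y) powr \<alpha>)" for y
    using Q[of B' y] Q[of A y] Q[of B y] B' Suc.prems by (simp add: powr_mult[symmetric] flip: of_real_mult)
  ultimately show ?case unfolding Q_def[symmetric] power_Suc by (simp only: simp_thms)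
qed

lemma real_power_bracket:
  fixes x :: real
  assumes "x \<ge> 1"
  obtains K :: nat where "x \<le> (3/2) ^ K" "(3/2) ^ K \<le> 3/2 * x"
proof -
  define K where "K = (LEAST K. x \<le> (3/2) ^ K)"
  have ex: "\<exists>K. x \<le> (3/2) ^ K" using real_arch_pow[of "3/2" x] by (auto intro: less_imp_le)
  have "x \<le> (3/2) ^ K" unfolding K_def by (rule LeastI_ex[OF ex])
  moreover have "(3/2) ^ K \<le> 3/2 * x"
  proof (cases K)
    case 0
    then show ?thesis using assms by simp
  next
    case (Suc k)
    then have "\<not> x \<le> (3/2) ^ k" using not_less_Least[of k "\<lambda>K. x \<le> (3/2) ^ K"] by (simp add: K_def)
    then show ?thesis using Suc by simp
  qed
  ultimately show thesis by (rule that)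
qed

text \<open>With \<open>Q A y = A + 4 pi\<^sup>2 |y|\<^sup>2\<close>, the ratio \<open>Q 1 (r y + v) / Q 1 y\<close> is passed through
  \<open>A = B\<close> for some \<open>B\<close> of size \<open>(1 + |v|)\<^sup>2\<close>, at which the translation by \<open>v\<close> is a perturbation of norm at most 1/2.\<close>
lemma fmult_bessel_ratio:
  fixes s u :: real
  assumes u: "u \<ge> 1" and s: "s \<ge> 0"
  obtains C N where "C \<ge> 0"
    "\<And>r (v::'a::euclidean_space). 1/4 \<le> r \<Longrightarrow> r \<le> 4 \<Longrightarrow>
       fmult u (C * (1 + norm v) ^ N) (\<lambda>y. bessel_weight s (v + r *\<^sub>R y) / bessel_weight s y)"
proof -
  define \<alpha> where "\<alpha> = s / 2"
  have \<alpha>: "\<alpha> \<ge> 0" using s by (simp add: \<alpha>_def)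
  obtain C where C: "C \<ge> 1"
    and binom: "\<And>(b :: 'a \<Rightarrow> real). fmult u (1/2) (\<lambda>y. of_real (b y)) \<Longrightarrow>
       fmult u C (\<lambda>y. of_real ((1 + b y) powr \<alpha>))"
    using fmult_binomial[of u \<alpha>] u by metis
  define g where "g = gauss_mom TYPE('a)"
  have g: "g \<ge> 0" unfolding g_def by (rule gauss_mom_nonneg)
  \<comment> \<open>Large enough that both perturbation terms \<open>b1\<close> and
    \<open>b2\<close> below get norm at most 1/4.\<close>
  define \<kappa> where "\<kappa> = 16 * pi\<^sup>2 * (g + 1)"
  have pi2: "pi\<^sup>2 \<ge> 1" using pi_ge_two power_mono[of 1 pi 2] by simp
  have \<kappa>1: "\<kappa> \<ge> 16 * pi\<^sup>2" using g by (simp add: \<kappa>_def)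
  have \<kappa>: "\<kappa> \<ge> 1" using \<kappa>1 pi2 by linarith
  have \<kappa>g: "\<kappa> \<ge> 16 * pi\<^sup>2 * g" by (simp add: \<kappa>_def)
  \<comment> \<open>Converts the cost \<open>C ^ K\<close> into \<open>((3/2) ^ K) ^ n0\<close>,
    hence into a power of \<open>1 + norm v\<close>.\<close>
  obtain n0 where n0: "C \<le> (3/2) ^ n0"
    using real_arch_pow[of "3/2" C] by (auto intro: less_imp_le)
  define Q where "Q A y = A + 4 * pi\<^sup>2 * (norm y)\<^sup>2" for A :: real and y :: 'a
  have Q: "Q A y > 0" if "A > 0" for A y using that by (auto simp: Q_def intro!: add_pos_nonneg)
  define D where "D = 16 powr \<alpha> * C ^ 8 * (24 * \<kappa>\<^sup>2) ^ (2 * n0)"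
  have main: "fmult u (D * (1 + norm v) ^ (4 * n0)) (\<lambda>y. bessel_weight s (v + r *\<^sub>R y) / bessel_weight s y)"
    if r: "1/4 \<le> r" "r \<le> 4" for r and v :: 'a
  proof -
    define x where "x = 16 * \<kappa>\<^sup>2 * (1 + norm v)\<^sup>2"
    have "1 \<le> \<kappa>\<^sup>2" "1 \<le> (1 + norm v)\<^sup>2" using \<kappa> by (auto intro!: one_le_power)
    then have "1 * 1 \<le> \<kappa>\<^sup>2 * (1 + norm v)\<^sup>2" by (intro mult_mono) auto
    then have x16: "x \<ge> 16" by (simp add: x_def)
    obtain K where K: "x \<le> (3/2) ^ K" "(3/2) ^ K \<le> 3/2 * x"
      using real_power_bracket[of x] x16 by auto
    define B where "B = (3/2 :: real) ^ K"
    have B: "B > 0" "B \<ge> 16" "B \<ge> 1" using K x16 by (auto simp: B_def)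
    \<comment> \<open>The constant for which \<open>Q B (v + r *\<^sub>R y)\<close> equals
      \<open>r\<^sup>2 * Q B' y\<close> plus terms containing \<open>v\<close>.\<close>
    define B' where "B' = B / r\<^sup>2"
    have r0: "r > 0" using r by simp
    have l2: "1/16 \<le> r\<^sup>2" "r\<^sup>2 \<le> 16"
      using power_mono[OF r(1), of 2] power_mono[OF r(2), of 2] r0 by (auto simp: power2_eq_square)
    have B': "B' \<ge> 1" "B' > 0"
      using l2 B r0 by (auto simp: B'_def le_divide_eq)
    \<comment> \<open>Seven extra steps pay for \<open>1 / r^2 \<le> 16\<close>, as
      \<open>(3/2)^7 > 16\<close>.\<close>
    have B'le: "B' \<le> 1 * (3/2) ^ (K + 7)"
    proof -
      have "B \<le> B * 16 * r\<^sup>2" using l2(1) B(1) by simp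
      then have "B' \<le> B * 16" using r0 by (simp add: B'_def divide_le_eq)
      also have "\<dots> \<le> B * (3/2) ^ 7" using B(1) by (intro mult_left_mono) (auto simp: power_divide)
      finally show ?thesis by (simp add: B_def power_add)
    qed
    have sB: "sqrt B \<ge> 4 * \<kappa> * (1 + norm v)"
    proof (rule real_le_rsqrt)
      show "(4 * \<kappa> * (1 + norm v))\<^sup>2 \<le> B" using K(1) by (simp add: B_def x_def power_mult_distrib)
    qed
    have sBB': "sqrt B = r * sqrt B'" using r0 by (simp add: B'_def real_sqrt_divide)

    \<comment> \<open>\<open>b1\<close> comes from the cross term and \<open>b2\<close> from
      \<open>|v|^2\<close> in the expansion of \<open>|v + r y|^2\<close>, both multiplied by
      \<open>4 pi^2\<close> and divided by \<open>r^2 * Q B' y\<close>.\<close>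
    define b1 where "b1 y = (8 * pi\<^sup>2 / sqrt B) * (sqrt B' * (v \<bullet> y) / Q B' y)" for y
    define b2 where "b2 y = (4 * pi\<^sup>2 * (norm v)\<^sup>2 / B) * (B' / Q B' y)" for y
    have "fmult u (norm (complex_of_real (8 * pi\<^sup>2 / sqrt B)) * (g * norm v)) (\<lambda>y. of_real (8 * pi\<^sup>2 / sqrt B) * of_real (sqrt B' * (v \<bullet> y) / Q B' y))"
      unfolding Q_def g_def by (intro fmult_cmult fmult_resolvent_gradient_scaled u B')
    then have f1: "fmult u (1/4) (\<lambda>y. of_real (b1 y))"
      unfolding b1_def of_real_mult[symmetric]
    proof (rule fmult_mono)
      have "0 \<le> pi\<^sup>2 * (g * norm v)" using g by simp
      moreover have "16 * (pi\<^sup>2 * (g * norm v)) \<le> \<kappa> * norm v"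
        using mult_right_mono[OF \<kappa>g, of "norm v"] by (simp add: mult.assoc)
      ultimately have "8 * pi\<^sup>2 * (g * norm v) \<le> \<kappa> * norm v" by linarith
      also have "\<dots> \<le> \<kappa> * (1 + norm v)" using \<kappa> by simp
      also have "\<dots> \<le> 1/4 * sqrt B" using sB by simp
      finally have "8 * pi\<^sup>2 * (g * norm v) / sqrt B \<le> 1/4" using B by (simp add: divide_le_eq)
      then show "norm (complex_of_real (8 * pi\<^sup>2 / sqrt B)) * (g * norm v) \<le> 1/4"
        using B unfolding norm_of_real by simp
    qed (use u in auto)
    have "fmult u (norm (complex_of_real (4 * pi\<^sup>2 * (norm v)\<^sup>2 / B)) * 1) (\<lambda>y. of_real (4 * pi\<^sup>2 * (norm v)\<^sup>2 / B) * of_real (B' / Q B' y))"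
      unfolding Q_def by (intro fmult_cmult fmult_resolvent_scaled u B')
    then have f2: "fmult u (1/4) (\<lambda>y. of_real (b2 y))"
      unfolding b2_def of_real_mult[symmetric]
    proof (rule fmult_mono)
      have "16 * pi\<^sup>2 * (norm v)\<^sup>2 \<le> \<kappa> * (1 + norm v)\<^sup>2"
        using \<kappa>1 \<kappa> by (intro mult_mono power_mono) auto
      also have "\<dots> \<le> \<kappa>\<^sup>2 * (1 + norm v)\<^sup>2"
        using \<kappa> by (intro mult_right_mono) (auto simp: power2_eq_square)
      also have "\<dots> \<le> x" by (simp add: x_def)
      also have "\<dots> \<le> B" using K by (simp add: B_def)
      finally have "4 * pi\<^sup>2 * (norm v)\<^sup>2 / B \<le> 1/4" using B by (simp add: divide_le_eq)
      then show "norm (complex_of_real (4 * pi\<^sup>2 * (norm v)\<^sup>2 / B)) * 1 \<le> 1/4"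
        using B unfolding norm_of_real by simp
    qed (use u in auto)
    have "fmult u (1/4 + 1/4) (\<lambda>y. of_real (b1 y) + of_real (b2 y))"
      by (rule fmult_add[OF f1 f2 _ _ u]) auto
    then have "fmult u (1/2) (\<lambda>y. of_real (b1 y + b2 y))" by (simp only: of_real_add) simp
    then have F2: "fmult u C (\<lambda>y. of_real ((1 + (b1 y + b2 y)) powr \<alpha>))" by (rule binom)
    have bb: "1 + (b1 y + b2 y) = Q B (v + r *\<^sub>R y) / (r\<^sup>2 * Q B' y)" for y
    proof -
      have "(norm (v + r *\<^sub>R y))\<^sup>2 = (norm v)\<^sup>2 + 2 * r * (v \<bullet> y) + r\<^sup>2 * (norm y)\<^sup>2"
        unfolding power2_norm_eq_inner
        by (simp add: inner_add_left inner_add_right inner_commute[of y v] power2_eq_square algebra_simps)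
      moreover have "r\<^sup>2 * Q B' y = B + 4 * pi\<^sup>2 * r\<^sup>2 * (norm y)\<^sup>2"
        using r0 by (simp add: Q_def B'_def distrib_left)
      ultimately have "Q B (v + r *\<^sub>R y) = r\<^sup>2 * Q B' y + 8 * pi\<^sup>2 * r * (v \<bullet> y) + 4 * pi\<^sup>2 * (norm v)\<^sup>2"
        by (simp add: Q_def algebra_simps)
      moreover have "b1 y = 8 * pi\<^sup>2 * r * (v \<bullet> y) / (r\<^sup>2 * Q B' y)"
        using B' r0 by (simp add: b1_def sBB' power2_eq_square)
      moreover have "b2 y = 4 * pi\<^sup>2 * (norm v)\<^sup>2 / (r\<^sup>2 * Q B' y)"
        using B r0 by (simp add: b2_def B'_def)
      ultimately show ?thesis using Q[OF B'(2), of y] r0 by (simp add: add_divide_distrib)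
    qed
    have "fmult u (C ^ K) (\<lambda>y. of_real ((Q 1 y / Q B y) powr \<alpha>))"
      using fmult_resolvent_ratio[OF u C binom, of 1 B K] B unfolding Q_def by (simp add: B_def)
    from fmult_affine[OF this, of r v] r0
    have F1: "fmult u (C ^ K) (\<lambda>y. of_real ((Q 1 (v + r *\<^sub>R y) / Q B (v + r *\<^sub>R y)) powr \<alpha>))" by simp
    have F3: "fmult u (C ^ (K + 7)) (\<lambda>y. of_real ((Q B' y / Q 1 y) powr \<alpha>))"
      unfolding Q_def
      by (rule fmult_resolvent_ratio[OF u C, THEN conjunct2, OF _ zero_less_one B'(1) B'le]) (rule binom)
    \<comment> \<open>Three multipliers telescope: from the constant 1 to \<open>B\<close> at the
      point \<open>v + r y\<close>, the translation at level \<open>B\<close>, and from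
      \<open>B'\<close> back to 1 at the point \<open>y\<close>.\<close>
    have F: "fmult u (norm (complex_of_real ((r\<^sup>2) powr \<alpha>)) * (C ^ K * (C * C ^ (K + 7)))) (\<lambda>y. of_real ((r\<^sup>2) powr \<alpha>) *
       (of_real ((Q 1 (v + r *\<^sub>R y) / Q B (v + r *\<^sub>R y)) powr \<alpha>) * (of_real ((1 + (b1 y + b2 y)) powr \<alpha>) * of_real ((Q B' y / Q 1 y) powr \<alpha>))))"
      by (intro fmult_cmult fmult_mult F1 F2 F3)
    have eq: "of_real ((r\<^sup>2) powr \<alpha>) * (of_real ((Q 1 (v + r *\<^sub>R y) / Q B (v + r *\<^sub>R y)) powr \<alpha>) * (of_real ((1 + (b1 y + b2 y)) powr \<alpha>) * of_real ((Q B' y / Q 1 y) powr \<alpha>)))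
       = bessel_weight s (v + r *\<^sub>R y) / bessel_weight s y" for y
    proof -
      have "(r\<^sup>2) powr \<alpha> * ((Q 1 (v + r *\<^sub>R y) / Q B (v + r *\<^sub>R y)) powr \<alpha> * ((1 + (b1 y + b2 y)) powr \<alpha> * (Q B' y / Q 1 y) powr \<alpha>))
        = (r\<^sup>2 * ((Q 1 (v + r *\<^sub>R y) / Q B (v + r *\<^sub>R y)) * (Q B (v + r *\<^sub>R y) / (r\<^sup>2 * Q B' y) * (Q B' y / Q 1 y)))) powr \<alpha>"
        unfolding bb using Q[of 1 "v + r *\<^sub>R y"] Q[of B "v + r *\<^sub>R y"] Q[of B' y] Q[of 1 y] B B' r0
        by (simp add: powr_mult powr_divide)
      also have "r\<^sup>2 * ((Q 1 (v + r *\<^sub>R y) / Q B (v + r *\<^sub>R y)) * (Q B (v + r *\<^sub>R y) / (r\<^sup>2 * Q B' y) * (Q B' y / Q 1 y))) = Q 1 (v + r *\<^sub>R y) / Q 1 y"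
        using Q[of B "v + r *\<^sub>R y"] Q[of B' y] Q[of 1 y] B B' r0 by simp
      also have "(Q 1 (v + r *\<^sub>R y) / Q 1 y) powr \<alpha> = Q 1 (v + r *\<^sub>R y) powr \<alpha> / Q 1 y powr \<alpha>"
        by (rule powr_divide)
      finally have "complex_of_real ((r\<^sup>2) powr \<alpha> * ((Q 1 (v + r *\<^sub>R y) / Q B (v + r *\<^sub>R y)) powr \<alpha> * ((1 + (b1 y + b2 y)) powr \<alpha> * (Q B' y / Q 1 y) powr \<alpha>))) = of_real (Q 1 (v + r *\<^sub>R y) powr \<alpha> / Q 1 y powr \<alpha>)"
        by (simp only:)
      then show ?thesis by (simp only: of_real_mult of_real_divide bessel_weight_def Q_def \<alpha>_def)
    qed
    have "norm (complex_of_real ((r\<^sup>2) powr \<alpha>)) * (C ^ K * (C * C ^ (K + 7))) = (r\<^sup>2) powr \<alpha> * (C ^ 8 * (C ^ K)\<^sup>2)"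
      by (simp add: power_add power2_eq_square power_numeral_reduce)
    also have "\<dots> \<le> 16 powr \<alpha> * (C ^ 8 * (B ^ n0)\<^sup>2)"
    proof (intro mult_mono powr_mono2 \<alpha> l2 power_mono order_refl)
      have "C ^ K \<le> ((3/2) ^ n0) ^ K" using n0 C by (intro power_mono) auto
      also have "\<dots> = B ^ n0" by (simp add: B_def power_mult[symmetric] mult.commute)
      finally show "C ^ K \<le> B ^ n0" .
    qed (use C in auto)
    also have "\<dots> \<le> 16 powr \<alpha> * (C ^ 8 * ((3/2 * x) ^ n0)\<^sup>2)"
      using C B K by (intro mult_left_mono power_mono) (auto simp: B_def)
    also have "\<dots> = D * (1 + norm v) ^ (4 * n0)"
    proof -
      have e: "3/2 * x = 24 * \<kappa>\<^sup>2 * (1 + norm v)\<^sup>2" by (simp add: x_def)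
      have "((3/2 * x) ^ n0)\<^sup>2 = (3/2 * x) ^ (2 * n0)" by (metis power_mult mult.commute)
      also have "\<dots> = (24 * \<kappa>\<^sup>2) ^ (2 * n0) * ((1 + norm v)\<^sup>2) ^ (2 * n0)"
        unfolding e by (rule power_mult_distrib)
      also have "((1 + norm v)\<^sup>2) ^ (2 * n0) = (1 + norm v) ^ (4 * n0)"
        by (simp add: power_mult[symmetric])
      finally show ?thesis by (simp add: D_def mult_ac)
    qed
    finally have le: "norm (complex_of_real ((r\<^sup>2) powr \<alpha>)) * (C ^ K * (C * C ^ (K + 7))) \<le> D * (1 + norm v) ^ (4 * n0)" .
    show ?thesis using fmult_mono[OF F[unfolded eq] le] u by simp
  qed
  show thesis by (rule that[OF _ main]) (use C in \<open>auto simp: D_def\<close>)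
qed

section \<open>A cutoff with compactly supported Fourier transform\<close>

lemma integrable_inverse_square_weight:
  "integrable lborel (\<lambda>x::'a::euclidean_space. \<Prod>b\<in>Basis. 1 / (1 + (x \<bullet> b)\<^sup>2))"
proof -
  have "integrable lborel (\<lambda>x::real. inverse (1 + x\<^sup>2))"
    using integrable_inverse_1_plus_square by (simp add: set_integrable_def)
  then have "integrable lborel (\<lambda>x::real. complex_of_real (1 / (1 + x\<^sup>2)))"
    unfolding complex_of_real_integrable_eq by (simp add: divide_inverse)
  then have "integrable lborel (\<lambda>x::'a. \<Prod>b\<in>Basis. complex_of_real (1 / (1 + (x \<bullet> b)\<^sup>2)))"
    by (rule integrable_lborel_prod)
  then show ?thesis unfolding of_real_prod[symmetric] complex_of_real_integrable_eq .
qed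

text \<open>\<open>(1 + norm x)^2\<close> dominates \<open>1 + (x \<bullet> b)^2\<close> for every
  coordinate, so the exponent \<open>2 * DIM('a)\<close> allots to each of them a factor integrable
  on the line.\<close>

lemma integrable_norm_weight:
  "integrable lborel (\<lambda>x::'a::euclidean_space. 1 / (1 + norm x) ^ (2 * DIM('a)))"
proof (rule Bochner_Integration.integrable_bound[OF integrable_inverse_square_weight])
  show "AE x in lborel. norm (1 / (1 + norm x) ^ (2 * DIM('a))) \<le> norm (\<Prod>b\<in>Basis. 1 / (1 + ((x::'a) \<bullet> b)\<^sup>2))"
  proof (rule AE_I2)
    fix x :: 'a
    have pos: "0 < 1 + (x \<bullet> b)\<^sup>2" for b by (intro add_pos_nonneg) auto
    have "1 / (1 + norm x) ^ (2 * DIM('a)) = (\<Prod>b\<in>(Basis::'a set). 1 / (1 + norm x)\<^sup>2)"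
      by (simp add: power_mult power_one_over)
    also have "\<dots> \<le> (\<Prod>b\<in>Basis. 1 / (1 + (x \<bullet> b)\<^sup>2))"
    proof (rule prod_mono, intro conjI)
      fix b :: 'a assume b: "b \<in> Basis"
      have "(x \<bullet> b)\<^sup>2 \<le> (norm x)\<^sup>2" using power_mono[OF Basis_le_norm[OF b, of x] abs_ge_zero, of 2] by simp
      then have "1 + (x \<bullet> b)\<^sup>2 \<le> (1 + norm x)\<^sup>2" by (simp add: power2_sum add_increasing2)
      then show "1 / (1 + norm x)\<^sup>2 \<le> 1 / (1 + (x \<bullet> b)\<^sup>2)" using pos[of b] by (intro frac_le) auto
    qed simp
    finally show "norm (1 / (1 + norm x) ^ (2 * DIM('a))) \<le> norm (\<Prod>b\<in>Basis. 1 / (1 + (x \<bullet> b)\<^sup>2))"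
      using less_imp_le[OF pos] by (simp add: abs_prod)
  qed
qed measurable

lemma schwartz_weight_integrable:
  fixes f :: "'a::euclidean_space \<Rightarrow> complex"
  assumes "schwartz f"
  shows schwartz_measurable: "f \<in> borel_measurable borel"
    and "integrable lborel (\<lambda>x. of_real ((1 + norm x) ^ N) * f x)"
proof -
  have c: "continuous_on UNIV f" and d: "\<exists>C. \<forall>x. (1 + norm x) ^ N * norm (f x) \<le> C" for N
    using assms[unfolded schwartz_def, rule_format, of "[]"] by auto
  show m [measurable]: "f \<in> borel_measurable borel" by (rule borel_measurable_continuous_onI[OF c])
  \<comment> \<open>Of the decay, \<open>2 * DIM('a)\<close> orders are spent on integrability and
    \<open>N\<close> remain for the weight.\<close>
  obtain C where C: "\<And>x. (1 + norm x) ^ (N + 2 * DIM('a)) * norm (f x) \<le> C" using d by blast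
  have i: "integrable lborel (\<lambda>x::'a. C * (1 / (1 + norm x) ^ (2 * DIM('a))))"
    by (rule integrable_mult_right[OF integrable_norm_weight])
  show "integrable lborel (\<lambda>x. of_real ((1 + norm x) ^ N) * f x)"
  proof (rule Bochner_Integration.integrable_bound[OF i])
    show "AE x in lborel. norm (of_real ((1 + norm x) ^ N) * f x) \<le> norm (C * (1 / (1 + norm x) ^ (2 * DIM('a))))"
    proof (rule AE_I2)
      fix x :: 'a
      have p: "(1 + norm x) ^ (2 * DIM('a)) > 0" by (intro zero_less_power) (simp add: add_pos_nonneg)
      have "(1 + norm x) ^ N * norm (f x) \<le> C / (1 + norm x) ^ (2 * DIM('a))"
        using C[of x] p by (simp add: power_add pos_le_divide_eq mult_ac)
      also have "\<dots> \<le> norm (C * (1 / (1 + norm x) ^ (2 * DIM('a))))" by (simp add: divide_right_mono)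
      finally show "norm (of_real ((1 + norm x) ^ N) * f x) \<le> norm (C * (1 / (1 + norm x) ^ (2 * DIM('a))))"
        by (simp only: norm_mult norm_of_real) simp
    qed
  qed measurable
qed

section \<open>Tents and Fejer kernels\<close>

lemma integrable_indicator_Icc: "integrable lborel (indicator {a..b::real} :: real \<Rightarrow> real)"
  by (intro integrable_real_indicator) (auto simp: emeasure_lborel_Icc_eq)

definition tent :: "real \<Rightarrow> real \<Rightarrow> real" where
  "tent h t = max 0 (h - \<bar>t\<bar>)"

lemma tent_measurable [measurable]: "tent h \<in> borel_measurable borel"
  unfolding tent_def by measurable

definition iv_ft :: "real \<Rightarrow> real \<Rightarrow> complex" where
  "iv_ft h \<xi> = (LINT x|lborel. of_real (indicator {0..h} x) * cis (- 2 * pi * (x * \<xi>)))"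

lemma norm_iv_ft_le: "0 \<le> h \<Longrightarrow> norm (iv_ft h \<xi>) \<le> h"
proof -
  assume h: "0 \<le> h"
  have "norm (iv_ft h \<xi>) \<le> (LINT x|lborel. indicator {0..h} x)"
    unfolding iv_ft_def by (rule order_trans[OF integral_norm_bound]) (simp add: norm_mult)
  then show ?thesis using h by simp
qed

lemma norm_iv_ft_le_inverse:
  assumes h: "0 \<le> h" and \<xi>: "\<xi> \<noteq> 0"
  shows "norm (iv_ft h \<xi>) \<le> 1 / (pi * \<bar>\<xi>\<bar>)"
proof -
  define k where "k = - (2 * pi * \<xi>)"
  have k: "k \<noteq> 0" using \<xi> by (simp add: k_def)
  define F where "F x = cis (k * x) / (\<i> * of_real k)" for x
  have "(LINT x|lborel. indicator {0..h} x *\<^sub>R cis (k * x)) = F h - F 0"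
  proof (rule integral_FTC_atLeastAtMost[OF h])
    show "(F has_vector_derivative cis (k * x)) (at x within {0..h})" for x
    proof -
      have "((\<lambda>z. exp (\<i> * of_real k * z) / (\<i> * of_real k)) has_field_derivative exp (\<i> * of_real k * of_real x)) (at (of_real x))"
        using k by (auto intro!: derivative_eq_intros)
      from has_vector_derivative_real_field[OF this]
      have "((\<lambda>x. exp (\<i> * of_real k * of_real x) / (\<i> * of_real k)) has_vector_derivative exp (\<i> * of_real k * of_real x)) (at x within {0..h})" .
      then show ?thesis by (simp add: F_def[abs_def] cis_conv_exp mult.assoc)
    qed
    show "continuous_on {0..h} (\<lambda>x. cis (k * x))" by (intro continuous_intros)
  qed
  moreover have "iv_ft h \<xi> = (LINT x|lborel. indicator {0..h} x *\<^sub>R cis (k * x))"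
    by (simp add: iv_ft_def scaleR_conv_of_real k_def mult_ac)
  ultimately have "norm (iv_ft h \<xi>) \<le> norm (F h) + norm (F 0)"
    using norm_triangle_ineq4[of "F h" "F 0"] by simp
  also have "\<dots> = 1 / (pi * \<bar>\<xi>\<bar>)" by (simp add: F_def norm_divide norm_mult k_def abs_mult field_simps)
  finally show ?thesis .
qed

lemma integrable_tent: "h \<ge> 0 \<Longrightarrow> integrable lborel (\<lambda>t. complex_of_real (tent h t))"
proof -
  assume h: "h \<ge> 0"
  have "integrable lborel (\<lambda>t::real. h * indicator {-h..h} t)" by (intro integrable_mult_right integrable_indicator_Icc)
  then have "integrable lborel (tent h)"
    by (rule Bochner_Integration.integrable_bound) (use h in \<open>auto simp: tent_def indicator_def\<close>)
  then show ?thesis by simp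
qed

text \<open>The tent is the autocorrelation of the indicator of \<open>{0..h}\<close>, so its transform is a squared modulus.\<close>
lemma fourier_tent:
  assumes h: "h \<ge> 0"
  shows "(LINT t|lborel. complex_of_real (tent h t) * cis (- 2 * pi * (t * \<xi>))) = of_real ((norm (iv_ft h \<xi>))\<^sup>2)"
proof -
  define I where "I x = complex_of_real (indicator {0..h} x)" for x :: real
  have [measurable]: "I \<in> borel_measurable borel" unfolding I_def by measurable
  have Ii: "integrable lborel I" unfolding I_def complex_of_real_integrable_eq by (rule integrable_indicator_Icc)
  have tent: "complex_of_real (tent h t) = (LINT x|lborel. I x * I (t + x))" for t
  proof -
    have "(\<lambda>x. I x * I (t + x)) = (\<lambda>x. of_real (indicator {max 0 (-t)..min h (h - t)} x))"
      by (auto simp: I_def indicator_def fun_eq_iff)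
    moreover have "(LINT x|lborel. indicator {max 0 (-t)..min h (h - t)} x) = tent h t"
      using h by (auto simp: tent_def measure_def emeasure_lborel_Icc_eq max_def min_def)
    ultimately show ?thesis by (simp only: integral_complex_of_real)
  qed
  \<comment> \<open>The inserted \<open>indicator {-h..h} t\<close> changes nothing, as the tent
    vanishes outside, but supplies a product majorant for Fubini.\<close>
  have "(LINT t|lborel. complex_of_real (tent h t) * cis (- 2 * pi * (t * \<xi>))) =
     (LINT t|lborel. (LINT x|lborel. indicator {-h..h} t * (I x * I (t + x)) * cis (- 2 * pi * (t * \<xi>))))"
  proof (intro Bochner_Integration.integral_cong refl)
    fix t
    have "complex_of_real (tent h t) = indicator {-h..h} t * complex_of_real (tent h t)"
      by (auto simp: tent_def indicator_def)
    then show "complex_of_real (tent h t) * cis (- 2 * pi * (t * \<xi>)) =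
        (LINT x|lborel. indicator {-h..h} t * (I x * I (t + x)) * cis (- 2 * pi * (t * \<xi>)))"
      by (simp only: tent Bochner_Integration.integral_mult_left_zero Bochner_Integration.integral_mult_right_zero)
  qed
  also have "\<dots> = (LINT x|lborel. (LINT t|lborel. indicator {-h..h} t * (I x * I (t + x)) * cis (- 2 * pi * (t * \<xi>))))"
  proof (rule Fubini_dominated_eq[where f="\<lambda>t. indicator {-h..h} t" and g="\<lambda>x. indicator {0..h} x"])
    show "norm (indicator {-h..h} t * (I x * I (t + x)) * cis (- 2 * pi * (t * \<xi>))) \<le> indicator {-h..h} t * indicator {0..h} x" for t x
      by (auto simp: I_def indicator_def norm_mult)
  qed (auto simp: sigma_finite_lborel integrable_indicator_Icc)
  also have "\<dots> = (LINT x|lborel. I x * cis (2 * pi * (x * \<xi>)) * iv_ft h \<xi>)"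
  proof (intro Bochner_Integration.integral_cong refl)
    fix x
    have "(LINT t|lborel. indicator {-h..h} t * (I x * I (t + x)) * cis (- 2 * pi * (t * \<xi>))) =
       (LINT t|lborel. I x * I (x + 1 *\<^sub>R t) * cis (- 2 * pi * ((x + 1 *\<^sub>R t) * \<xi>)) * cis (2 * pi * (x * \<xi>)))"
      by (intro Bochner_Integration.integral_cong refl) (auto simp: I_def indicator_def mult.assoc cis_mult algebra_simps)
    also have "\<dots> = (LINT t|lborel. I x * I t * cis (- 2 * pi * (t * \<xi>)) * cis (2 * pi * (x * \<xi>)))"
      by (subst integral_lborel_affine[where c=1 and t=x and f="\<lambda>t. I x * I t * cis (- 2 * pi * (t * \<xi>)) * cis (2 * pi * (x * \<xi>))"]) auto
    also have "\<dots> = I x * cis (2 * pi * (x * \<xi>)) * iv_ft h \<xi>"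
      unfolding iv_ft_def Bochner_Integration.integral_mult_right_zero[symmetric] I_def
      by (intro Bochner_Integration.integral_cong refl) (simp add: mult_ac)
    finally show "(LINT t|lborel. indicator {-h..h} t * (I x * I (t + x)) * cis (- 2 * pi * (t * \<xi>))) = I x * cis (2 * pi * (x * \<xi>)) * iv_ft h \<xi>" .
  qed
  also have "\<dots> = cnj (iv_ft h \<xi>) * iv_ft h \<xi>"
  proof -
    have "cnj (iv_ft h \<xi>) = (LINT x|lborel. cnj (of_real (indicator {0..h} x) * cis (- 2 * pi * (x * \<xi>))))"
      unfolding iv_ft_def by (rule Bochner_Integration.integral_cnj[symmetric])
    also have "\<dots> = (LINT x|lborel. I x * cis (2 * pi * (x * \<xi>)))"
      by (simp add: I_def cis_cnj)
    finally show ?thesis by simp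
  qed
  also have "\<dots> = of_real ((norm (iv_ft h \<xi>))\<^sup>2)"
    by (simp only: complex_norm_square mult.commute)
  finally show ?thesis .
qed

text \<open>A tensor product of Fejer kernels: nonnegative, with compactly supported transform.
  Powers keep both properties and improve the decay.\<close>

definition fejer :: "real \<Rightarrow> 'a::euclidean_space \<Rightarrow> real" where
  "fejer h y = (\<Prod>b\<in>Basis. (norm (iv_ft h (y \<bullet> b)))\<^sup>2)"

lemma iv_ft_measurable [measurable]: "iv_ft h \<in> borel_measurable borel"
  unfolding iv_ft_def by measurable

lemma fejer_measurable [measurable]: "fejer h \<in> borel_measurable borel"
  unfolding fejer_def by measurable

lemma fejer_nonneg: "0 \<le> fejer h y"
  by (simp add: fejer_def prod_nonneg)

lemma fejer_eq_fourier:
  assumes "h \<ge> 0"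
  shows "fourier (\<lambda>x::'a::euclidean_space. \<Prod>b\<in>Basis. complex_of_real (tent h (x \<bullet> b))) y = of_real (fejer h y)"
proof -
  have "fourier (\<lambda>x::'a. \<Prod>b\<in>Basis. complex_of_real (tent h (x \<bullet> b))) y =
     (LINT x|lborel. (\<Prod>b\<in>Basis. complex_of_real (tent h (x \<bullet> b)) * cis (- 2 * pi * ((x \<bullet> b) * (y \<bullet> b)))))"
    unfolding fourier_def by (simp only: cis_inner_eq_prod prod.distrib)
  also have "\<dots> = (\<Prod>b\<in>Basis. (LINT t|lborel. complex_of_real (tent h t) * cis (- 2 * pi * (t * (y \<bullet> b)))))"
    by (rule integral_lborel_prod) (intro integrable_mult_cis integrable_tent assms, simp)
  also have "\<dots> = of_real (fejer h y)"
    unfolding fourier_tent[OF assms] fejer_def of_real_prod ..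
  finally show ?thesis .
qed

lemma integrable_prod_tent:
  "h \<ge> 0 \<Longrightarrow> integrable lborel (\<lambda>x::'a::euclidean_space. \<Prod>b\<in>Basis. complex_of_real (tent h (x \<bullet> b)))"
  by (intro integrable_lborel_prod integrable_tent)

lemma fejer_factor_le:
  assumes "h \<ge> 0"
  shows "(norm (iv_ft h t))\<^sup>2 \<le> (h\<^sup>2 + 1) * (1 / (1 + t\<^sup>2))"
proof -
  have "(norm (iv_ft h t))\<^sup>2 \<le> h\<^sup>2" using norm_iv_ft_le[OF assms, of t] by (intro power_mono) auto
  moreover have "(norm (iv_ft h t))\<^sup>2 * t\<^sup>2 \<le> 1"
  proof (cases "t = 0")
    case False
    have "norm (iv_ft h t) * \<bar>t\<bar> \<le> 1 / pi"
      using norm_iv_ft_le_inverse[OF assms False] False by (simp add: field_simps)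
    also have "\<dots> \<le> 1" using pi_ge_two by simp
    finally have "(norm (iv_ft h t) * \<bar>t\<bar>)\<^sup>2 \<le> 1\<^sup>2" by (intro power_mono) auto
    then show ?thesis by (simp add: power_mult_distrib)
  qed simp
  ultimately have "(norm (iv_ft h t))\<^sup>2 * (1 + t\<^sup>2) \<le> h\<^sup>2 + 1" by (simp add: distrib_left)
  moreover have "1 + t\<^sup>2 > 0" by (intro add_pos_nonneg) auto
  ultimately show ?thesis by (simp add: field_simps)
qed

lemma one_plus_abs_le_square: "1 + \<bar>t\<bar> \<le> 2 * (1 + t\<^sup>2)" for t :: real
proof -
  define a q where "a = \<bar>t\<bar>" and "q = t\<^sup>2"
  have "0 \<le> (a - 1)\<^sup>2" "a\<^sup>2 = q" "0 \<le> q" by (simp_all add: a_def q_def)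
  then have "2 * a \<le> 1 + q" by (simp add: power2_diff)
  with \<open>0 \<le> q\<close> have "1 + a \<le> 2 * (1 + q)" by simp
  then show ?thesis by (simp only: a_def q_def)
qed

lemma one_plus_sum_le_prod:
  fixes f :: "'b \<Rightarrow> real"
  assumes "finite A" "\<And>x. x \<in> A \<Longrightarrow> 0 \<le> f x"
  shows "1 + sum f A \<le> (\<Prod>x\<in>A. 1 + f x)"
  using assms
proof (induction A rule: finite_induct)
  case (insert a A)
  have "1 + (f a + sum f A) \<le> (1 + f a) * (1 + sum f A)"
    using insert.prems by (auto simp: algebra_simps intro!: mult_nonneg_nonneg sum_nonneg)
  also have "\<dots> \<le> (1 + f a) * (\<Prod>x\<in>A. 1 + f x)"
    using insert by (intro mult_left_mono) auto
  finally show ?case using insert by simp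
qed simp

text \<open>In each coordinate one factor \<open>fejer\<close> decays like
  \<open>1 / (1 + t^2)\<close>. \<open>N\<close> of them absorb \<open>(1 + norm y) ^ N\<close>,
  since \<open>1 + norm y\<close> is at most the product of the
  \<open>2 * (1 + (y \<bullet> b)^2)\<close>; the last one gives integrability, hence
  \<open>Suc N\<close>.\<close>

lemma fejer_power_integrable:
  fixes N :: nat
  assumes h: "h \<ge> 0"
  shows "integrable lborel (\<lambda>y::'a::euclidean_space. (1 + norm y) ^ N * fejer h y ^ Suc N)"
proof -
  define K where "K = (2 ^ N * (h\<^sup>2 + 1) ^ Suc N) ^ DIM('a)"
  have "integrable lborel (\<lambda>y::'a. K * (\<Prod>b\<in>Basis. 1 / (1 + (y \<bullet> b)\<^sup>2)))"
    by (rule integrable_mult_right[OF integrable_inverse_square_weight])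
  then show ?thesis
  proof (rule Bochner_Integration.integrable_bound)
    show "AE y in lborel. norm ((1 + norm y) ^ N * fejer h y ^ Suc N) \<le> norm (K * (\<Prod>b\<in>Basis. 1 / (1 + ((y::'a) \<bullet> b)\<^sup>2)))"
    proof (rule AE_I2)
      fix y :: 'a
      have pos: "0 < 1 + (y \<bullet> b)\<^sup>2" for b by (intro add_pos_nonneg) auto
      have "1 + norm y \<le> 1 + (\<Sum>b\<in>Basis. \<bar>y \<bullet> b\<bar>)" using norm_le_l1[of y] by simp
      also have "\<dots> \<le> (\<Prod>b\<in>Basis. 1 + \<bar>y \<bullet> b\<bar>)" by (rule one_plus_sum_le_prod) auto
      also have "\<dots> \<le> (\<Prod>b\<in>Basis. 2 * (1 + (y \<bullet> b)\<^sup>2))"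
      proof (rule prod_mono, intro conjI)
        fix b
        show "1 + \<bar>y \<bullet> b\<bar> \<le> 2 * (1 + (y \<bullet> b)\<^sup>2)" by (rule one_plus_abs_le_square)
      qed auto
      finally have "(1 + norm y) ^ N \<le> (\<Prod>b\<in>Basis. 2 * (1 + (y \<bullet> b)\<^sup>2)) ^ N" by (intro power_mono) auto
      then have 1: "(1 + norm y) ^ N \<le> (\<Prod>b\<in>Basis. (2 * (1 + (y \<bullet> b)\<^sup>2)) ^ N)" by (simp only: prod_power_distrib)
      have "fejer h y \<le> (\<Prod>b\<in>Basis. (h\<^sup>2 + 1) * (1 / (1 + (y \<bullet> b)\<^sup>2)))"
        unfolding fejer_def by (intro prod_mono conjI fejer_factor_le h) auto
      then have "fejer h y ^ Suc N \<le> (\<Prod>b\<in>Basis. (h\<^sup>2 + 1) * (1 / (1 + (y \<bullet> b)\<^sup>2))) ^ Suc N"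
        by (intro power_mono fejer_nonneg)
      then have 2: "fejer h y ^ Suc N \<le> (\<Prod>b\<in>Basis. ((h\<^sup>2 + 1) * (1 / (1 + (y \<bullet> b)\<^sup>2))) ^ Suc N)" by (simp only: prod_power_distrib)
      have "(1 + norm y) ^ N * fejer h y ^ Suc N \<le> (\<Prod>b\<in>Basis. (2 * (1 + (y \<bullet> b)\<^sup>2)) ^ N) * (\<Prod>b\<in>Basis. ((h\<^sup>2 + 1) * (1 / (1 + (y \<bullet> b)\<^sup>2))) ^ Suc N)"
        by (intro mult_mono 1 2 prod_nonneg zero_le_power fejer_nonneg ballI) (use less_imp_le[OF pos] in auto)
      also have "\<dots> = (\<Prod>b\<in>Basis. (2 ^ N * (h\<^sup>2 + 1) ^ Suc N) * (1 / (1 + (y \<bullet> b)\<^sup>2)))"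
        unfolding prod.distrib[symmetric]
      proof (rule prod.cong[OF refl])
        fix b
        define q where "q = 1 + (y \<bullet> b)\<^sup>2"
        have "q \<noteq> 0" using pos[of b] by (simp add: q_def)
        then have "(2 * q) ^ N * ((h\<^sup>2 + 1) * (1 / q)) ^ Suc N = (2 ^ N * (h\<^sup>2 + 1) ^ Suc N) * (1 / q)"
          by (simp add: power_mult_distrib power_divide field_simps)
        then show "(2 * (1 + (y \<bullet> b)\<^sup>2)) ^ N * ((h\<^sup>2 + 1) * (1 / (1 + (y \<bullet> b)\<^sup>2))) ^ Suc N = (2 ^ N * (h\<^sup>2 + 1) ^ Suc N) * (1 / (1 + (y \<bullet> b)\<^sup>2))"
          by (simp only: q_def)
      qed
      also have "\<dots> = K * (\<Prod>b\<in>Basis. 1 / (1 + (y \<bullet> b)\<^sup>2))" by (simp only: K_def prod.distrib prod_constant power_mult_distrib)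
      finally have le: "(1 + norm y) ^ N * fejer h y ^ Suc N \<le> K * (\<Prod>b\<in>Basis. 1 / (1 + (y \<bullet> b)\<^sup>2))" .
      have e: "norm ((1 + norm y) ^ N * fejer h y ^ Suc N) = (1 + norm y) ^ N * fejer h y ^ Suc N"
        using fejer_nonneg[of h y] by (simp add: abs_mult)
      show "norm ((1 + norm y) ^ N * fejer h y ^ Suc N) \<le> norm (K * (\<Prod>b\<in>Basis. 1 / (1 + (y \<bullet> b)\<^sup>2)))"
        unfolding e using order_trans[OF le abs_ge_self] by simp
    qed
  qed measurable
qed


lemma integrable_fejer_power:
  assumes h: "h \<ge> 0"
  shows "integrable lborel (\<lambda>y::'a::euclidean_space. complex_of_real (fejer h y ^ Suc q))"
  unfolding complex_of_real_integrable_eq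
proof (rule Bochner_Integration.integrable_bound[OF fejer_power_integrable[OF h, of q]])
  show "AE y in lborel. norm (fejer h (y::'a) ^ Suc q) \<le> norm ((1 + norm y) ^ q * fejer h y ^ Suc q)"
  proof (rule AE_I2)
    fix y :: 'a
    have "1 * fejer h y ^ Suc q \<le> (1 + norm y) ^ q * fejer h y ^ Suc q"
      by (intro mult_right_mono one_le_power zero_le_power fejer_nonneg) auto
    then show "norm (fejer h y ^ Suc q) \<le> norm ((1 + norm y) ^ q * fejer h y ^ Suc q)"
      using fejer_nonneg[of h y] by (simp add: abs_mult)
  qed
qed measurable

text \<open>Inversion applied to the product of tents, which is even.\<close>

lemma fourier_fejer:
  fixes z :: "'a::euclidean_space"
  assumes h: "h \<ge> 0"
  shows "fourier (\<lambda>y. of_real (fejer h y)) z = (\<Prod>b\<in>Basis. complex_of_real (tent h (z \<bullet> b)))"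
proof -
  let ?\<beta> = "\<lambda>x::'a. \<Prod>b\<in>Basis. complex_of_real (tent h (x \<bullet> b))"
  have eq: "fourier ?\<beta> = (\<lambda>y. of_real (fejer h y))" by (rule ext) (rule fejer_eq_fourier[OF h])
  have "fourier (fourier ?\<beta>) z = ?\<beta> (- z)"
  proof (rule fourier_inversion[where B="h ^ DIM('a)"])
    show "integrable lborel (fourier ?\<beta>)" unfolding eq using integrable_fejer_power[OF h, of 0] by simp
    show "continuous_on UNIV ?\<beta>" unfolding tent_def by (intro continuous_intros)
    show "norm (?\<beta> x) \<le> h ^ DIM('a)" for x
    proof -
      have "norm (?\<beta> x) = (\<Prod>b\<in>Basis. tent h (x \<bullet> b))"
        unfolding prod_norm[symmetric] by (rule prod.cong) (auto simp: tent_def)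
      also have "\<dots> \<le> (\<Prod>b\<in>(Basis::'a set). h)" by (rule prod_mono) (use h in \<open>auto simp: tent_def\<close>)
      finally show ?thesis by simp
    qed
  qed (rule integrable_prod_tent[OF h])
  then show ?thesis unfolding eq by (simp add: tent_def)
qed

lemma prod_tent_support:
  fixes x :: "'a::euclidean_space" and h :: real
  assumes "(\<Prod>b\<in>Basis. complex_of_real (tent h (x \<bullet> b))) \<noteq> 0"
  shows "norm x \<le> DIM('a) * h"
proof -
  have "\<bar>x \<bullet> b\<bar> \<le> h" if "b \<in> Basis" for b
    using assms that by (auto simp: tent_def max_def split: if_splits)
  then have "(\<Sum>b\<in>Basis. \<bar>x \<bullet> b\<bar>) \<le> (\<Sum>b\<in>(Basis::'a set). h)" by (intro sum_mono)
  then show ?thesis using norm_le_l1[of x] by simp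
qed

text \<open>The multiplication formula writes the transform of a product as a convolution integral,
  and supports add: each further factor contributes radius \<open>DIM('a) * h\<close>.\<close>

lemma fourier_fejer_power_support:
  fixes z :: "'a::euclidean_space" and h :: real
  assumes h: "h \<ge> 0" and "fourier (\<lambda>y. of_real (fejer h y ^ Suc q)) z \<noteq> 0"
  shows "norm z \<le> Suc q * (DIM('a) * h)"
  using assms(2)
proof (induction q arbitrary: z)
  case 0
  then show ?case using prod_tent_support[of h z] by (simp add: fourier_fejer[OF h])
next
  case (Suc q)
  let ?\<beta> = "\<lambda>x::'a. \<Prod>b\<in>Basis. complex_of_real (tent h (x \<bullet> b))"
  let ?g = "\<lambda>y::'a. complex_of_real (fejer h y ^ Suc q)"
  have "fourier (\<lambda>y. of_real (fejer h y ^ Suc (Suc q))) z = (LINT y|lborel. (?g y * cis (- 2 * pi * (z \<bullet> y))) * fourier ?\<beta> y)"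
    unfolding fourier_def[of _ z] fejer_eq_fourier[OF h]
    by (intro Bochner_Integration.integral_cong refl) (simp add: mult_ac inner_commute)
  also have "\<dots> = (LINT y|lborel. fourier (\<lambda>y. ?g y * cis (- 2 * pi * (z \<bullet> y))) y * ?\<beta> y)"
    by (rule fourier_multiplication[symmetric]) (auto intro!: integrable_mult_cis integrable_fejer_power integrable_prod_tent h simp del: of_real_power power_Suc)
  also have "\<dots> = (LINT y|lborel. fourier ?g (y + z) * ?\<beta> y)" by (simp only: fourier_modulated)
  finally have "(LINT y|lborel. fourier ?g (y + z) * ?\<beta> y) \<noteq> 0" using Suc.prems by simp
  then obtain y where "fourier ?g (y + z) * ?\<beta> y \<noteq> 0"
    by (metis (mono_tags, lifting) Bochner_Integration.integral_cong Bochner_Integration.integral_zero)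
  then have "norm (y + z) \<le> Suc q * (DIM('a) * h)" "norm y \<le> DIM('a) * h"
    using Suc.IH[of "y + z"] prod_tent_support[of h y] by auto
  then show ?case using norm_triangle_ineq4[of "y + z" y] by (simp add: algebra_simps)
qed

text \<open>Positivity is demanded in space and localisation in frequency. A bump chosen in
  frequency would in general lose the sign in space; a high power of a Fejer kernel keeps it.
  \<open>N\<close> will be the degree of growth of the multiplier bounds.\<close>

lemma exists_cutoff:
  fixes N :: nat
  obtains X :: "'a::euclidean_space \<Rightarrow> real" where
    "\<And>y. 0 \<le> X y" "continuous_on UNIV X" "X 0 > 0" "integrable lborel X"
    "integrable lborel (\<lambda>y. (1 + norm y) ^ N * X y)"
    "\<And>\<xi>. fourier (\<lambda>y. of_real (X y)) \<xi> \<noteq> 0 \<Longrightarrow> norm \<xi> \<le> 1/2"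
proof -
  \<comment> \<open>Makes the support radius \<open>Suc N * (DIM('a) * h)\<close> equal to 1/2, so
    that the cutoff shifted to a unit vector stays away from the origin.\<close>
  define h where "h = 1 / (2 * real (Suc N) * DIM('a))"
  have h: "h > 0" by (simp add: h_def)
  define X where "X y = fejer h (y::'a) ^ Suc N" for y
  have c: "continuous_on UNIV (fejer h :: 'a \<Rightarrow> real)"
  proof -
    have "continuous_on UNIV (fourier (\<lambda>x::'a. \<Prod>b\<in>Basis. complex_of_real (tent h (x \<bullet> b))))"
      using h by (intro continuous_on_fourier integrable_prod_tent) auto
    moreover have "fejer h y = Re (fourier (\<lambda>x::'a. \<Prod>b\<in>Basis. complex_of_real (tent h (x \<bullet> b))) y)" for y
      using h by (subst fejer_eq_fourier) auto
    ultimately show ?thesis by (simp add: continuous_on_Re)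
  qed
  show thesis
  proof (rule that[of X])
    show "0 \<le> X y" for y by (simp add: X_def fejer_nonneg)
    show "continuous_on UNIV X" unfolding X_def by (intro continuous_intros c)
    have "iv_ft h 0 = of_real h" using h by (simp add: iv_ft_def)
    then show "X 0 > 0" using h by (simp add: X_def fejer_def)
    show "integrable lborel X"
      using integrable_fejer_power[of h N, where 'a='a] h unfolding X_def[abs_def] complex_of_real_integrable_eq by simp
    show "integrable lborel (\<lambda>y. (1 + norm y) ^ N * X y)"
      unfolding X_def by (rule fejer_power_integrable) (use h in simp)
    show "norm \<xi> \<le> 1/2" if "fourier (\<lambda>y. of_real (X y)) \<xi> \<noteq> 0" for \<xi>
    proof -
      have "norm \<xi> \<le> Suc N * (DIM('a) * h)"
        by (rule fourier_fejer_power_support) (use h that in \<open>auto simp: X_def[abs_def] simp del: of_real_power power_Suc\<close>)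
      also have "\<dots> = 1/2" by (simp add: h_def)
      finally show ?thesis .
    qed
  qed
qed

section \<open>Modulated Gaussians\<close>

text \<open>Continuous, closed under directional derivatives and of polynomial growth: what the
  Schwartz property of \<open>mgauss\<close> requires of the factors produced by
  differentiation.\<close>

inductive poly_fun :: "('a::euclidean_space \<Rightarrow> complex) \<Rightarrow> bool" where
  const: "poly_fun (\<lambda>x. c)"
| coord: "poly_fun (\<lambda>x. of_real (x \<bullet> b))"
| add: "poly_fun p \<Longrightarrow> poly_fun q \<Longrightarrow> poly_fun (\<lambda>x. p x + q x)"
| mult: "poly_fun p \<Longrightarrow> poly_fun q \<Longrightarrow> poly_fun (\<lambda>x. p x * q x)"

lemma poly_fun_continuous: "poly_fun p \<Longrightarrow> continuous_on UNIV p"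
  by (induction rule: poly_fun.induct) (auto intro!: continuous_intros)

lemma poly_fun_growth: "poly_fun p \<Longrightarrow> \<exists>C k. \<forall>x. norm (p x) \<le> C * (1 + norm x) ^ k"
proof (induction rule: poly_fun.induct)
  case (const c)
  show ?case by (intro exI[of _ "norm c"] exI[of _ 0]) simp
next
  case (coord b)
  have "norm (complex_of_real (x \<bullet> b)) \<le> norm b * (1 + norm x) ^ 1" for x
    using Cauchy_Schwarz_ineq2[of x b] by (simp add: algebra_simps add_increasing)
  then show ?case by blast
next
  case (add p q)
  then obtain C k D l where C: "\<And>x. norm (p x) \<le> C * (1 + norm x) ^ k" and D: "\<And>x. norm (q x) \<le> D * (1 + norm x) ^ l"
    by blast
  have "norm (p x + q x) \<le> (\<bar>C\<bar> + \<bar>D\<bar>) * (1 + norm x) ^ (k + l)" for x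
  proof -
    have "norm (p x) \<le> \<bar>C\<bar> * (1 + norm x) ^ (k + l)"
      by (rule order_trans[OF C[of x]]) (intro mult_mono power_increasing, auto)
    moreover have "norm (q x) \<le> \<bar>D\<bar> * (1 + norm x) ^ (k + l)"
      by (rule order_trans[OF D[of x]]) (intro mult_mono power_increasing, auto)
    ultimately show ?thesis using norm_triangle_ineq[of "p x" "q x"] by (simp add: distrib_right)
  qed
  then show ?case by blast
next
  case (mult p q)
  then obtain C k D l where C: "\<And>x. norm (p x) \<le> C * (1 + norm x) ^ k" and D: "\<And>x. norm (q x) \<le> D * (1 + norm x) ^ l"
    by blast
  have "norm (p x * q x) \<le> (C * D) * (1 + norm x) ^ (k + l)" for x
    using mult_mono'[OF C[of x] D[of x]] by (simp add: norm_mult power_add mult_ac)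
  then show ?case by blast
qed

lemma poly_fun_deriv:
  "poly_fun p \<Longrightarrow> \<exists>p'. poly_fun p' \<and> (\<forall>x. ((\<lambda>t::real. p (x + t *\<^sub>R b)) has_vector_derivative p' x) (at 0))"
proof (induction rule: poly_fun.induct)
  case (const c)
  show ?case by (intro exI[of _ "\<lambda>x. 0"] conjI poly_fun.const) auto
next
  case (coord b')
  have "((\<lambda>t::real. complex_of_real ((x + t *\<^sub>R b) \<bullet> b')) has_vector_derivative of_real (b \<bullet> b')) (at 0)" for x
    unfolding inner_add_left inner_scaleR_left
    by (rule has_vector_derivative_of_real) (auto intro!: derivative_eq_intros)
  then show ?case by (intro exI[of _ "\<lambda>x. of_real (b \<bullet> b')"] conjI poly_fun.const) auto
next
  case (add p q)
  then obtain p' q' where "poly_fun p'" "poly_fun q'"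
    "\<And>x. ((\<lambda>t::real. p (x + t *\<^sub>R b)) has_vector_derivative p' x) (at 0)"
    "\<And>x. ((\<lambda>t::real. q (x + t *\<^sub>R b)) has_vector_derivative q' x) (at 0)" by blast
  then show ?case
    by (intro exI[of _ "\<lambda>x. p' x + q' x"] conjI allI poly_fun.add has_vector_derivative_add)
next
  case (mult p q)
  then obtain p' q' where d: "poly_fun p'" "poly_fun q'"
    "\<And>x. ((\<lambda>t::real. p (x + t *\<^sub>R b)) has_vector_derivative p' x) (at 0)"
    "\<And>x. ((\<lambda>t::real. q (x + t *\<^sub>R b)) has_vector_derivative q' x) (at 0)" by blast
  have "((\<lambda>t::real. p (x + t *\<^sub>R b) * q (x + t *\<^sub>R b)) has_vector_derivative p x * q' x + p' x * q x) (at 0)" for x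
    using has_vector_derivative_mult[OF d(3)[of x] d(4)[of x]] by simp
  with mult d show ?case
    by (intro exI[of _ "\<lambda>x. p x * q' x + p' x * q x"] conjI allI poly_fun.intros) auto
qed

text \<open>The cutoff and \<open>H\<close> will carry the same character as this input, so that all
  phases combine into one.\<close>

definition mgauss :: "'a::euclidean_space \<Rightarrow> real \<Rightarrow> 'a \<Rightarrow> complex" where
  "mgauss a c x = of_real (gauss c x) * cis (2 * pi * (a \<bullet> x))"

lemma mgauss_deriv:
  "((\<lambda>t::real. mgauss a c (x + t *\<^sub>R b)) has_vector_derivative
     (\<i> * of_real (2 * pi * (a \<bullet> b)) + of_real (- 2 * pi * c) * of_real (x \<bullet> b)) * mgauss a c x) (at 0)"
proof -
  \<comment> \<open>Along a line the exponent is the quadratic \<open>A + B t + D t^2\<close>, so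
    the derivative at 0 is \<open>B\<close> times the value.\<close>
  define A where "A = complex_of_real (- (pi * c * (norm x)\<^sup>2)) + \<i> * of_real (2 * pi * (a \<bullet> x))"
  define B where "B = \<i> * of_real (2 * pi * (a \<bullet> b)) + of_real (- 2 * pi * c) * of_real (x \<bullet> b)"
  define D where "D = complex_of_real (- (pi * c * (norm b)\<^sup>2))"
  have "mgauss a c (x + t *\<^sub>R b) = exp (A + B * of_real t + D * (of_real t)\<^sup>2)" for t
  proof -
    have n: "(norm (x + t *\<^sub>R b))\<^sup>2 = (norm x)\<^sup>2 + 2 * t * (x \<bullet> b) + t\<^sup>2 * (norm b)\<^sup>2"
      unfolding power2_norm_eq_inner
      by (simp add: inner_add_left inner_add_right inner_commute[of b x] power2_eq_square algebra_simps)
    have "mgauss a c (x + t *\<^sub>R b) = exp (of_real (- (pi * c * (norm (x + t *\<^sub>R b))\<^sup>2)) + \<i> * of_real (2 * pi * (a \<bullet> (x + t *\<^sub>R b))))"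
      by (simp only: mgauss_def gauss_def cis_conv_exp exp_add exp_of_real)
    also have "of_real (- (pi * c * (norm (x + t *\<^sub>R b))\<^sup>2)) + \<i> * of_real (2 * pi * (a \<bullet> (x + t *\<^sub>R b))) = A + B * of_real t + D * (of_real t)\<^sup>2"
      unfolding n A_def B_def D_def by (simp add: inner_add_right algebra_simps)
    finally show ?thesis .
  qed
  moreover have "((\<lambda>t::real. exp (A + B * of_real t + D * (of_real t)\<^sup>2)) has_vector_derivative exp A * B) (at 0)"
  proof -
    have "((\<lambda>z. exp (A + B * z + D * z\<^sup>2)) has_field_derivative exp A * B) (at (of_real 0))"
      by (auto intro!: derivative_eq_intros)
    from has_vector_derivative_real_field[OF this] show ?thesis by simp
  qed
  moreover have "exp A = mgauss a c x"
    by (simp only: A_def mgauss_def gauss_def cis_conv_exp exp_add exp_of_real)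
  ultimately show ?thesis by (simp add: B_def mult.commute)
qed

lemma poly_mult_gauss_bounded:
  assumes c: "c > 0"
  shows "\<exists>C. \<forall>x::'a::euclidean_space. (1 + norm x) ^ M * gauss c x \<le> C"
proof (intro exI allI)
  fix x :: 'a
  define t where "t = norm x"
  have t: "t \<ge> 0" by (simp add: t_def)
  have "(1 + t) ^ M \<le> exp t ^ M" using t by (intro power_mono exp_ge_add_one_self) auto
  also have "\<dots> = exp (M * t)" by (simp add: exp_of_nat_mult)
  finally have "(1 + t) ^ M * gauss c x \<le> exp (M * t) * exp (- (pi * c * t\<^sup>2))"
    unfolding gauss_def t_def by (rule mult_right_mono) simp
  also have "\<dots> = exp (M * t - pi * c * t\<^sup>2)"
    by (simp add: exp_diff exp_minus field_simps)
  also have "\<dots> \<le> exp ((real M)\<^sup>2 / (4 * pi * c))"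
  proof -
    \<comment> \<open>Completing the square: the maximum of \<open>M t - pi c t^2\<close> is
      \<open>M^2 / (4 pi c)\<close>.\<close>
    have "0 \<le> (2 * pi * c * t - M)\<^sup>2" by simp
    then have "(M * t - pi * c * t\<^sup>2) * (4 * pi * c) \<le> (real M)\<^sup>2" by (simp add: power2_eq_square algebra_simps)
    then have "M * t - pi * c * t\<^sup>2 \<le> (real M)\<^sup>2 / (4 * pi * c)" using c by (simp add: le_divide_eq)
    then show ?thesis by simp
  qed
  finally show "(1 + norm x) ^ M * gauss c x \<le> exp ((real M)\<^sup>2 / (4 * pi * c))" by (simp add: t_def)
qed

text \<open>By induction on the list of directions every iterated derivative is a
  \<open>poly_fun\<close> times the same modulated Gaussian, and the Gaussian beats every
  polynomial.\<close>

lemma schwartz_mgauss: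
  fixes a :: "'a::euclidean_space"
  assumes c: "c > 0"
  shows "schwartz (mgauss a c)"
proof -
  have deriv: "\<exists>p'. poly_fun p' \<and> (\<forall>x. ((\<lambda>t::real. p (x + t *\<^sub>R b) * mgauss a c (x + t *\<^sub>R b)) has_vector_derivative p' x * mgauss a c x) (at 0))"
    if p: "poly_fun p" for p and b :: 'a
  proof -
    obtain p' where p': "poly_fun p'" "\<And>x. ((\<lambda>t::real. p (x + t *\<^sub>R b)) has_vector_derivative p' x) (at 0)"
      using poly_fun_deriv[OF p] by blast
    define r where "r x = \<i> * of_real (2 * pi * (a \<bullet> b)) + of_real (- 2 * pi * c) * of_real (x \<bullet> b)" for x :: 'a
    have r: "poly_fun r" unfolding r_def by (intro poly_fun.intros)
    have "((\<lambda>t::real. p (x + t *\<^sub>R b) * mgauss a c (x + t *\<^sub>R b)) has_vector_derivative (p x * r x + p' x) * mgauss a c x) (at 0)" for x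
      using has_vector_derivative_mult[OF p'(2)[of x] mgauss_deriv[of a c x b]] by (simp add: r_def algebra_simps)
    then show ?thesis
      by (intro exI[of _ "\<lambda>x. p x * r x + p' x"] conjI allI poly_fun.add poly_fun.mult p r p'(1))
  qed
  have iter: "\<exists>p. poly_fun p \<and> iter_pderiv bs (mgauss a c) = (\<lambda>x. p x * mgauss a c x)" for bs
  proof (induction bs)
    case Nil
    show ?case by (intro exI[of _ "\<lambda>x. 1"] conjI poly_fun.const) simp
  next
    case (Cons b bs)
    then obtain p where p: "poly_fun p" "iter_pderiv bs (mgauss a c) = (\<lambda>x. p x * mgauss a c x)" by blast
    obtain p' where p': "poly_fun p'" "\<And>x. ((\<lambda>t::real. p (x + t *\<^sub>R b) * mgauss a c (x + t *\<^sub>R b)) has_vector_derivative p' x * mgauss a c x) (at 0)"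
      using deriv[OF p(1)] by blast
    have "iter_pderiv (b # bs) (mgauss a c) = (\<lambda>x. p' x * mgauss a c x)"
      using vector_derivative_at[OF p'(2)] by (simp add: p(2) pderiv_dir_def fun_eq_iff)
    with p'(1) show ?case by blast
  qed
  show ?thesis
    unfolding schwartz_def
  proof (intro allI impI)
    fix bs :: "'a list"
    obtain p where p: "poly_fun p" "iter_pderiv bs (mgauss a c) = (\<lambda>x. p x * mgauss a c x)" using iter by blast
    have 1: "continuous_on UNIV (\<lambda>x. p x * mgauss a c x)"
      unfolding mgauss_def by (intro continuous_intros poly_fun_continuous p(1))
    have 2: "(\<lambda>t::real. p (x + t *\<^sub>R b) * mgauss a c (x + t *\<^sub>R b)) differentiable (at 0)" for x b
      using deriv[OF p(1), of b] by (auto intro: differentiableI_vector)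
    have 3: "\<exists>C. \<forall>x. (1 + norm x) ^ N * norm (p x * mgauss a c x) \<le> C" for N
    proof -
      obtain C k where C: "\<And>x. norm (p x) \<le> C * (1 + norm x) ^ k" using poly_fun_growth[OF p(1)] by blast
      obtain D where D: "\<And>x::'a. (1 + norm x) ^ (N + k) * gauss c x \<le> D" using poly_mult_gauss_bounded[OF c] by blast
      have "(1 + norm x) ^ N * norm (p x * mgauss a c x) \<le> \<bar>C\<bar> * D" for x
      proof -
        have "norm (p x * mgauss a c x) = norm (p x) * gauss c x"
          by (simp add: mgauss_def norm_mult)
        also have "\<dots> \<le> (\<bar>C\<bar> * (1 + norm x) ^ k) * gauss c x"
          by (intro mult_right_mono order_trans[OF C[of x]]) auto
        finally have "(1 + norm x) ^ N * norm (p x * mgauss a c x) \<le> (1 + norm x) ^ N * ((\<bar>C\<bar> * (1 + norm x) ^ k) * gauss c x)"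
          by (rule mult_left_mono) simp
        also have "\<dots> = \<bar>C\<bar> * ((1 + norm x) ^ (N + k) * gauss c x)" by (simp add: power_add mult_ac)
        also have "\<dots> \<le> \<bar>C\<bar> * D" by (intro mult_left_mono D) simp
        finally show ?thesis .
      qed
      then show ?thesis by blast
    qed
    show "continuous_on UNIV (iter_pderiv bs (mgauss a c)) \<and>
      (\<forall>b\<in>Basis. \<forall>x. (\<lambda>t::real. iter_pderiv bs (mgauss a c) (x + t *\<^sub>R b)) differentiable (at 0)) \<and>
      (\<forall>N. \<exists>C. \<forall>x. (1 + norm x) ^ N * norm (iter_pderiv bs (mgauss a c) x) \<le> C)"
      unfolding p(2) using 1 2 3 by blast
  qed
qed

lemma fourier_mgauss:
  fixes a :: "'a::euclidean_space"
  assumes "c > 0"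
  shows "fourier (mgauss a c) \<xi> = of_real (c powr (- (DIM('a) / 2)) * gauss (1 / c) (\<xi> - a))"
  using fourier_modulated[of "\<lambda>x. of_real (gauss c x)" "- a" \<xi>] fourier_gauss[OF assms, of "\<xi> - a"]
  unfolding mgauss_def by simp

section \<open>Bessel potentials of superpositions\<close>

lemma continuous_on_dominated_integral:
  fixes k :: "'b \<Rightarrow> complex" and g :: "'b \<Rightarrow> 'a::euclidean_space \<Rightarrow> complex"
  assumes k: "integrable M k" and [measurable]: "\<And>y. (\<lambda>v. g v y) \<in> borel_measurable M"
    and g: "\<And>v. continuous_on UNIV (g v)" and D: "\<And>v y. norm (g v y) \<le> D"
  shows "continuous_on UNIV (\<lambda>y. LINT v|M. k v * g v y)"
proof -
  have [measurable]: "k \<in> borel_measurable M" using k by auto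
  have "(\<lambda>n. LINT v|M. k v * g v (X n)) \<longlonglongrightarrow> (LINT v|M. k v * g v x)" if "X \<longlonglongrightarrow> x" for X x
  proof (rule integral_dominated_convergence[where w="\<lambda>v. norm (k v) * D"])
    show "AE v in M. (\<lambda>i. k v * g v (X i)) \<longlonglongrightarrow> k v * g v x"
      using that g by (intro AE_I2 tendsto_mult tendsto_const isCont_tendsto_compose[of _ "g _"])
        (auto simp: continuous_on_eq_continuous_at)
    show "AE v in M. norm (k v * g v (X i)) \<le> norm (k v) * D" for i
      using D by (intro AE_I2) (auto simp: norm_mult intro!: mult_left_mono)
  qed (use k in auto)
  then show ?thesis by (auto simp: continuous_on_sequentially o_def)
qed

lemma lp_norm_eq_lp_mass: "lp_norm u G = (if lp_mass u G = \<infinity> then \<infinity> else ennreal (enn2real (lp_mass u G) powr (1 / u)))"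
  by (simp add: lp_norm_def lp_mass_def Let_def)

lemma lp_norm_le:
  assumes "lp_mass u G \<le> ennreal T" "0 \<le> T" "u > 0"
  shows "lp_norm u G \<le> ennreal (T powr (1 / u))"
proof -
  have "lp_mass u G \<noteq> \<infinity>" using assms(1) by (auto simp: top_unique)
  moreover have "enn2real (lp_mass u G) \<le> T" using enn2real_mono[OF assms(1)] assms(2) by simp
  ultimately show ?thesis using assms(3)
    by (auto simp: lp_norm_eq_lp_mass intro!: ennreal_leI powr_mono2)
qed

text \<open>\<open>\<Phi>\<close> is \<open>\<omega>\<close> times a superposition of copies of
  \<open>N\<close>, dilated by \<open>r\<close> and translated by \<open>\<sigma> v\<close>.
  Substituting \<open>z = \<sigma> v + r y\<close> copy by copy moves \<open>\<omega>\<close> next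
  to \<open>N\<close>, where the assumed bound controls it; the factor
  \<open>1 / r ^ DIM('a)\<close> cancels the Jacobian. Used with the Bessel weight as
  \<open>\<omega>\<close>, with \<open>\<omega> = 1\<close>, and for smearing by a Gaussian.\<close>

lemma superposition:
  fixes \<kappa> :: "'b \<Rightarrow> complex" and \<sigma> :: "'b \<Rightarrow> 'a::euclidean_space" and N \<omega> :: "'a \<Rightarrow> complex"
  assumes M: "sigma_finite_measure M"
    and [measurable]: "\<kappa> \<in> borel_measurable M" "B \<in> borel_measurable M" "\<sigma> \<in> borel_measurable M"
      "N \<in> borel_measurable borel" "\<omega> \<in> borel_measurable borel"
    and \<kappa>B: "integrable M (\<lambda>v. B v * norm (\<kappa> v))" and r: "r > 0"
    and h: "integrable lborel (h :: 'a \<Rightarrow> real)"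
    and bound: "\<And>v y. norm (\<omega> (\<sigma> v + r *\<^sub>R y) * N y) \<le> B v * h y"
  defines "\<Phi> \<equiv> \<lambda>z. \<omega> z * (LINT v|M. \<kappa> v * (of_real (1 / r ^ DIM('a)) * N ((1 / r) *\<^sub>R (z - \<sigma> v))))"
  shows superposition_integrable: "integrable lborel \<Phi>"
    and superposition_fourier: "fourier \<Phi> \<eta> = (LINT v|M. \<kappa> v * (cis (- 2 * pi * (\<sigma> v \<bullet> \<eta>)) * fourier (\<lambda>y. \<omega> (\<sigma> v + r *\<^sub>R y) * N y) (r *\<^sub>R \<eta>)))"
proof -
  interpret M: sigma_finite_measure M by fact
  interpret pair_sigma_finite M "lborel :: 'a measure" ..
  have [measurable]: "h \<in> borel_measurable borel" using h by auto
  define c where "c = complex_of_real (1 / r ^ DIM('a))"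
  define P where "P v z = \<kappa> v * (\<omega> z * (c * N ((1 / r) *\<^sub>R (z - \<sigma> v))))" for v z
  have [measurable]: "(\<lambda>(v, z). P v z) \<in> borel_measurable (M \<Otimes>\<^sub>M lborel)"
    unfolding P_def by measurable
  have shift: "P v (\<sigma> v + r *\<^sub>R y) = \<kappa> v * (c * (\<omega> (\<sigma> v + r *\<^sub>R y) * N y))" for v y
    using r by (simp add: P_def mult_ac)
  have iy: "integrable lborel (\<lambda>y. \<omega> (\<sigma> v + r *\<^sub>R y) * N y)" for v
  proof (rule Bochner_Integration.integrable_bound)
    show "integrable lborel (\<lambda>y. B v * h y)" using h by simp
    show "AE y in lborel. norm (\<omega> (\<sigma> v + r *\<^sub>R y) * N y) \<le> norm (B v * h y)"
      by (intro AE_I2 order_trans[OF bound]) simp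
  qed measurable
  have iz: "integrable lborel (P v)" for v
    using integrable_lborel_affine_iff[of r "P v" "\<sigma> v"] r iy[of v] by (simp add: shift)
  have nz: "(LINT z|lborel. norm (P v z)) \<le> (LINT y|lborel. h y) * (B v * norm (\<kappa> v))" for v
  proof -
    have "(LINT z|lborel. norm (P v z)) = r ^ DIM('a) * (LINT y|lborel. norm (P v (\<sigma> v + r *\<^sub>R y)))"
      using r by (subst integral_lborel_affine[of r _ "\<sigma> v"]) auto
    also have "\<dots> = (LINT y|lborel. norm (\<kappa> v) * norm (\<omega> (\<sigma> v + r *\<^sub>R y) * N y))"
      unfolding shift Bochner_Integration.integral_mult_right_zero[symmetric] c_def norm_mult norm_of_real
      using r by (intro Bochner_Integration.integral_cong refl) simp
    also have "\<dots> \<le> (LINT y|lborel. norm (\<kappa> v) * (B v * h y))"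
      using iy[of v] h by (intro integral_mono integrable_mult_right mult_left_mono bound) auto
    finally show ?thesis by (simp add: mult_ac)
  qed
  have PI: "integrable (M \<Otimes>\<^sub>M lborel) (\<lambda>(v, z). P v z)"
  proof (rule Fubini_integrable)
    show "integrable M (\<lambda>v. LINT z|lborel. norm (case (v, z) of (v, z) \<Rightarrow> P v z))"
    proof (rule Bochner_Integration.integrable_bound[where f="\<lambda>v. (LINT y|lborel. h y) * (B v * norm (\<kappa> v))"])
      show "integrable M (\<lambda>v. (LINT y|lborel. h y) * (B v * norm (\<kappa> v)))" by (intro integrable_mult_right \<kappa>B)
      show "AE v in M. norm (LINT z|lborel. norm (case (v, z) of (v, z) \<Rightarrow> P v z)) \<le> norm ((LINT y|lborel. h y) * (B v * norm (\<kappa> v)))"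
        using nz by (intro AE_I2) (simp add: order_trans[OF nz abs_ge_self])
    qed measurable
    show "AE v in M. integrable lborel (\<lambda>z. case (v, z) of (v, z) \<Rightarrow> P v z)" using iz by simp
  qed measurable
  have \<Phi>: "\<Phi> z = (LINT v|M. P v z)" for z
    unfolding \<Phi>_def P_def Bochner_Integration.integral_mult_right_zero[symmetric] c_def
    by (intro Bochner_Integration.integral_cong refl) (simp only: mult_ac)
  show "integrable lborel \<Phi>"
    unfolding \<Phi>[abs_def] using integrable_snd[OF PI] by simp
  have PC: "integrable (M \<Otimes>\<^sub>M lborel) (\<lambda>(v, z). P v z * cis (- 2 * pi * (z \<bullet> \<eta>)))"
    using integrable_mult_cis[OF PI, of "\<lambda>(v, z). - 2 * pi * (z \<bullet> \<eta>)"] by (simp add: case_prod_unfold)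
  have "fourier \<Phi> \<eta> = (LINT z|lborel. (LINT v|M. P v z * cis (- 2 * pi * (z \<bullet> \<eta>))))"
    unfolding fourier_def \<Phi> by simp
  also have "\<dots> = (LINT v|M. (LINT z|lborel. P v z * cis (- 2 * pi * (z \<bullet> \<eta>))))"
    using Fubini_integral[OF PC] by simp
  also have "\<dots> = (LINT v|M. \<kappa> v * (cis (- 2 * pi * (\<sigma> v \<bullet> \<eta>)) * fourier (\<lambda>y. \<omega> (\<sigma> v + r *\<^sub>R y) * N y) (r *\<^sub>R \<eta>)))"
  proof (intro Bochner_Integration.integral_cong refl)
    fix v
    have cc: "r ^ DIM('a) *\<^sub>R (\<kappa> v * (c * x)) = \<kappa> v * x" for x
      using r by (simp add: c_def scaleR_conv_of_real)
    have "(LINT z|lborel. P v z * cis (- 2 * pi * (z \<bullet> \<eta>))) = \<bar>r\<bar> ^ DIM('a) *\<^sub>R (LINT y|lborel. P v (\<sigma> v + r *\<^sub>R y) * cis (- 2 * pi * ((\<sigma> v + r *\<^sub>R y) \<bullet> \<eta>)))"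
      using r by (intro integral_lborel_affine) auto
    also have "\<dots> = (LINT y|lborel. \<kappa> v * (cis (- 2 * pi * (\<sigma> v \<bullet> \<eta>)) * (\<omega> (\<sigma> v + r *\<^sub>R y) * N y * cis (- 2 * pi * (y \<bullet> (r *\<^sub>R \<eta>))))))"
      unfolding integral_scaleR_right[symmetric]
    proof (intro Bochner_Integration.integral_cong refl)
      fix y
      have "- 2 * pi * ((\<sigma> v + r *\<^sub>R y) \<bullet> \<eta>) = - 2 * pi * (\<sigma> v \<bullet> \<eta>) + - 2 * pi * (y \<bullet> (r *\<^sub>R \<eta>))"
        by (simp add: inner_add_left algebra_simps)
      then have "P v (\<sigma> v + r *\<^sub>R y) * cis (- 2 * pi * ((\<sigma> v + r *\<^sub>R y) \<bullet> \<eta>)) =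
          \<kappa> v * (c * (cis (- 2 * pi * (\<sigma> v \<bullet> \<eta>)) * (\<omega> (\<sigma> v + r *\<^sub>R y) * N y * cis (- 2 * pi * (y \<bullet> (r *\<^sub>R \<eta>))))))"
        by (simp only: shift cis_mult[symmetric] mult_ac)
      then show "\<bar>r\<bar> ^ DIM('a) *\<^sub>R (P v (\<sigma> v + r *\<^sub>R y) * cis (- 2 * pi * ((\<sigma> v + r *\<^sub>R y) \<bullet> \<eta>))) =
         \<kappa> v * (cis (- 2 * pi * (\<sigma> v \<bullet> \<eta>)) * (\<omega> (\<sigma> v + r *\<^sub>R y) * N y * cis (- 2 * pi * (y \<bullet> (r *\<^sub>R \<eta>)))))"
        using r by (simp only: abs_of_pos cc)
    qed
    also have "\<dots> = \<kappa> v * (cis (- 2 * pi * (\<sigma> v \<bullet> \<eta>)) * fourier (\<lambda>y. \<omega> (\<sigma> v + r *\<^sub>R y) * N y) (r *\<^sub>R \<eta>))"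
      unfolding fourier_def by (simp only: Bochner_Integration.integral_mult_right_zero)
    finally show "(LINT z|lborel. P v z * cis (- 2 * pi * (z \<bullet> \<eta>))) = \<kappa> v * (cis (- 2 * pi * (\<sigma> v \<bullet> \<eta>)) * fourier (\<lambda>y. \<omega> (\<sigma> v + r *\<^sub>R y) * N y) (r *\<^sub>R \<eta>))" .
  qed
  finally show "fourier \<Phi> \<eta> = (LINT v|M. \<kappa> v * (cis (- 2 * pi * (\<sigma> v \<bullet> \<eta>)) * fourier (\<lambda>y. \<omega> (\<sigma> v + r *\<^sub>R y) * N y) (r *\<^sub>R \<eta>)))" .
qed

section \<open>Size and regularity of the Bessel weight; the Sobolev norm of a superposition\<close>

lemma bessel_weight_nz: "s \<ge> 0 \<Longrightarrow> 1 \<le> norm (bessel_weight s \<xi>)" "bessel_weight s \<xi> \<noteq> 0"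
proof -
  show "1 \<le> norm (bessel_weight s \<xi>)" if "s \<ge> 0"
    using that by (auto simp: bessel_weight_def intro!: ge_one_powr_ge_zero)
  have "1 + 4 * pi\<^sup>2 * (norm \<xi>)\<^sup>2 > 0" by (intro add_pos_nonneg) auto
  then show "bessel_weight s \<xi> \<noteq> 0" by (simp add: bessel_weight_def)
qed

lemma continuous_on_bessel_weight: "continuous_on UNIV (bessel_weight s)"
proof -
  have "1 + 4 * pi\<^sup>2 * (norm \<xi>)\<^sup>2 \<noteq> 0" for \<xi> :: 'a
    by (metis add_pos_nonneg less_irrefl mult_nonneg_nonneg zero_le_numeral zero_le_power2 zero_less_one)
  then show ?thesis unfolding bessel_weight_def by (intro continuous_intros) auto
qed

lemma bessel_weight_measurable [measurable]: "bessel_weight s \<in> borel_measurable borel"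
  by (rule borel_measurable_continuous_onI[OF continuous_on_bessel_weight])

lemma bessel_weight_minus [simp]: "bessel_weight s (- \<xi>) = bessel_weight s \<xi>"
  by (simp add: bessel_weight_def)

lemma bessel_weight_le_powr:
  assumes "s \<ge> 0"
  shows "norm (bessel_weight s \<xi>) \<le> (2 * pi * (1 + norm \<xi>)) powr s"
proof -
  define t where "t = 2 * pi * (1 + norm \<xi>)"
  have t: "t \<ge> 1" using mult_mono[of 1 "2 * pi" 1 "1 + norm \<xi>"] pi_ge_two by (simp add: t_def)
  have p: "1 \<le> pi\<^sup>2" using pi_ge_two power_mono[of 1 pi 2] by simp
  have "1 + 4 * pi\<^sup>2 * (norm \<xi>)\<^sup>2 \<le> 4 * pi\<^sup>2 * 1 + 4 * pi\<^sup>2 * (norm \<xi>)\<^sup>2" using p by simp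
  also have "\<dots> \<le> 4 * pi\<^sup>2 * (1 + norm \<xi>)\<^sup>2"
    unfolding distrib_left[symmetric] by (intro mult_left_mono) (auto simp: power2_sum)
  also have "\<dots> = t\<^sup>2" by (simp add: t_def power_mult_distrib)
  finally have "1 + 4 * pi\<^sup>2 * (norm \<xi>)\<^sup>2 \<le> t\<^sup>2" .
  then have "norm (bessel_weight s \<xi>) \<le> (t\<^sup>2) powr (s / 2)"
    using assms unfolding bessel_weight_def by (auto intro!: powr_mono2)
  also have "\<dots> = t powr s" using t by (simp add: powr_powr flip: powr_numeral)
  finally show ?thesis by (simp add: t_def)
qed

lemma bessel_weight_le:
  assumes "s \<ge> 0"
  shows "norm (bessel_weight s \<xi>) \<le> (2 * pi) ^ nat \<lceil>s\<rceil> * (1 + norm \<xi>) ^ nat \<lceil>s\<rceil>"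
proof -
  define t where "t = 2 * pi * (1 + norm \<xi>)"
  have t: "t \<ge> 1" using mult_mono[of 1 "2 * pi" 1 "1 + norm \<xi>"] pi_ge_two by (simp add: t_def)
  have "norm (bessel_weight s \<xi>) \<le> t powr s" unfolding t_def by (rule bessel_weight_le_powr[OF assms])
  also have "\<dots> \<le> t powr (real (nat \<lceil>s\<rceil>))" using t assms by (intro powr_mono) auto
  also have "\<dots> = t ^ nat \<lceil>s\<rceil>" using t by (subst powr_realpow) auto
  finally show ?thesis by (simp add: t_def power_mult_distrib)
qed

lemma schwartz_bessel_integrable:
  assumes "schwartz \<phi>" "s \<ge> 0"
  shows "integrable lborel \<phi>" "integrable lborel (\<lambda>\<xi>. bessel_weight s \<xi> * \<phi> \<xi>)"
proof -
  note [measurable] = schwartz_measurable[OF assms(1)]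
  show "integrable lborel \<phi>" using schwartz_weight_integrable(2)[OF assms(1), of 0] by simp
  show "integrable lborel (\<lambda>\<xi>. bessel_weight s \<xi> * \<phi> \<xi>)"
  proof (rule Bochner_Integration.integrable_bound)
    show "integrable lborel (\<lambda>x. of_real ((2 * pi) ^ nat \<lceil>s\<rceil>) * (of_real ((1 + norm x) ^ nat \<lceil>s\<rceil>) * \<phi> x))"
      by (intro integrable_mult_right schwartz_weight_integrable(2) assms)
    show "AE x in lborel. norm (bessel_weight s x * \<phi> x) \<le> norm (of_real ((2 * pi) ^ nat \<lceil>s\<rceil>) * (of_real ((1 + norm x) ^ nat \<lceil>s\<rceil>) * \<phi> x))"
    proof (rule AE_I2)
      fix x
      show "norm (bessel_weight s x * \<phi> x) \<le> norm (of_real ((2 * pi) ^ nat \<lceil>s\<rceil>) * (of_real ((1 + norm x) ^ nat \<lceil>s\<rceil>) * \<phi> x))"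
        using mult_right_mono[OF bessel_weight_le[OF assms(2), of x] norm_ge_zero[of "\<phi> x"]]
        by (simp add: norm_mult norm_power mult.assoc abs_of_nonneg del: of_real_add of_real_power)
    qed
  qed measurable
qed


text \<open>The function \<open>F\<close> is the transform of a superposition \<open>\<Psi>\<close> of dilates and translates of \<open>H / w\<close>; the transform
  of \<open>w \<Psi>\<close> then represents the Bessel derivative of \<open>F\<close>, and it is an average of transforms of multiples of \<open>H\<close>.\<close>
lemma sobolev_norm_superposition_le:
  fixes \<kappa> :: "'b \<Rightarrow> complex" and \<sigma> :: "'b \<Rightarrow> 'a::euclidean_space" and H :: "'a \<Rightarrow> complex"
  assumes s: "s \<ge> 0" and u: "u \<ge> 1" and M: "sigma_finite_measure M"
    and [measurable]: "\<kappa> \<in> borel_measurable M" "B \<in> borel_measurable M" "\<sigma> \<in> borel_measurable M"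
    and \<kappa>B: "integrable M (\<lambda>v. B v * norm (\<kappa> v))" and B1: "\<And>v. B v \<ge> 1" and r: "r > 0"
    and fm: "\<And>v. fmult u (B v) (\<lambda>y. bessel_weight s (\<sigma> v + r *\<^sub>R y) / bessel_weight s y)"
    and fm1: "\<And>v. fmult 1 (B v) (\<lambda>y. bessel_weight s (\<sigma> v + r *\<^sub>R y) / bessel_weight s y)"
    and H: "integrable lborel H" "continuous_on UNIV H" "\<And>y. norm (H y) \<le> D" "integrable lborel (fourier H)"
    and F: "integrable lborel F"
      "\<And>\<xi>. F \<xi> = (LINT v|M. \<kappa> v * cis (- 2 * pi * (\<sigma> v \<bullet> \<xi>))) * fourier (\<lambda>y. H y / bessel_weight s y) (r *\<^sub>R \<xi>)"
    and S: "lp_mass u (fourier H) \<le> ennreal S" "S \<ge> 0"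
  shows "sobolev_norm u s F \<le> ennreal ((LINT v|M. B v * norm (\<kappa> v)) * (S / r ^ DIM('a)) powr (1 / u))"
proof -
  interpret M: sigma_finite_measure M by fact
  have [measurable]: "H \<in> borel_measurable borel" using H by auto
  define w where "w = (bessel_weight s :: 'a \<Rightarrow> complex)"
  have [measurable]: "w \<in> borel_measurable borel" unfolding w_def by measurable
  have w1: "1 \<le> norm (w z)" and w0: "w z \<noteq> 0" for z using bessel_weight_nz[of s z] s by (auto simp: w_def)
  define N where "N y = H y / w y" for y
  have [measurable]: "N \<in> borel_measurable borel" unfolding N_def by measurable
  have NH: "norm (N y) \<le> norm (H y)" for y
    using w1[of y] mult_left_mono[OF w1[of y] norm_ge_zero[of "H y"]] by (simp add: N_def norm_divide divide_le_eq)
  have D: "0 \<le> D" using order_trans[OF norm_ge_zero H(3)] .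
  have \<kappa>i: "integrable M \<kappa>"
  proof (rule Bochner_Integration.integrable_bound[OF \<kappa>B])
    show "AE v in M. norm (\<kappa> v) \<le> norm (B v * norm (\<kappa> v))"
    proof (rule AE_I2)
      fix v
      have "1 * norm (\<kappa> v) \<le> B v * norm (\<kappa> v)" using B1 by (intro mult_right_mono) auto
      then show "norm (\<kappa> v) \<le> norm (B v * norm (\<kappa> v))" by simp
    qed
  qed measurable
  have wN: "norm (w (\<sigma> v + r *\<^sub>R y) * N y) \<le> B v * norm (H y)" for v y
    using mult_right_mono[OF fmult_norm_le[OF fm[of v], of y] norm_ge_zero[of "H y"]]
    by (simp add: N_def w_def norm_mult norm_divide)
  define \<Psi> where "\<Psi> z = (LINT v|M. \<kappa> v * (of_real (1 / r ^ DIM('a)) * N ((1 / r) *\<^sub>R (z - \<sigma> v))))" for z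
  \<comment> \<open>With \<open>\<omega> = w\<close> the copies of \<open>N = H / w\<close> turn
    into \<open>H\<close> times the weight ratios, whose multiplier bounds are assumed.\<close>
  have A: "integrable lborel (\<lambda>z. w z * \<Psi> z)"
    and FA: "fourier (\<lambda>z. w z * \<Psi> z) \<eta> = (LINT v|M. \<kappa> v * (cis (- 2 * pi * (\<sigma> v \<bullet> \<eta>)) * fourier (\<lambda>y. w (\<sigma> v + r *\<^sub>R y) * N y) (r *\<^sub>R \<eta>)))" for \<eta>
    unfolding \<Psi>_def
    by (rule superposition_integrable[OF M, where B=B and h="\<lambda>y. norm (H y)"] superposition_fourier[OF M, where B=B and h="\<lambda>y. norm (H y)"];
        use \<kappa>B r H wN in \<open>auto\<close>)+
  \<comment> \<open>The same superposition with \<open>\<omega> = 1\<close> has transform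
    \<open>F\<close>; inversion later recovers \<open>\<Psi>\<close> from \<open>F\<close>.\<close>
  have C: "integrable lborel (\<lambda>z. 1 * \<Psi> z)"
    and FC: "fourier (\<lambda>z. 1 * \<Psi> z) \<eta> = (LINT v|M. \<kappa> v * (cis (- 2 * pi * (\<sigma> v \<bullet> \<eta>)) * fourier (\<lambda>y. 1 * N y) (r *\<^sub>R \<eta>)))" for \<eta>
    unfolding \<Psi>_def
    by (rule superposition_integrable[OF M, where B="\<lambda>_. 1" and h="\<lambda>y. norm (H y)" and \<omega>="\<lambda>_. 1"] superposition_fourier[OF M, where B="\<lambda>_. 1" and h="\<lambda>y. norm (H y)" and \<omega>="\<lambda>_. 1"];
        use \<kappa>i r H NH in \<open>auto\<close>)+
  have F\<Psi>: "fourier \<Psi> = F"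
  proof
    fix \<eta>
    have "fourier \<Psi> \<eta> = (LINT v|M. (\<kappa> v * cis (- 2 * pi * (\<sigma> v \<bullet> \<eta>))) * fourier N (r *\<^sub>R \<eta>))"
      using FC[of \<eta>] by (simp add: mult.assoc)
    also have "\<dots> = F \<eta>" unfolding F(2) by (simp add: N_def[abs_def] w_def)
    finally show "fourier \<Psi> \<eta> = F \<eta>" .
  qed
  have cN: "continuous_on UNIV N"
    unfolding N_def using w0 by (intro continuous_intros H) (auto simp: w_def continuous_on_bessel_weight)
  have ND: "norm (N y) \<le> D" for y using NH[of y] H(3)[of y] by simp
  have c\<Psi>: "continuous_on UNIV \<Psi>"
    unfolding \<Psi>_def
  proof (rule continuous_on_dominated_integral[OF \<kappa>i])
    show "norm (of_real (1 / r ^ DIM('a)) * N ((1 / r) *\<^sub>R (y - \<sigma> v))) \<le> 1 / r ^ DIM('a) * D" for v y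
      unfolding norm_mult norm_of_real using r ND by (intro mult_mono) auto
    show "continuous_on UNIV (\<lambda>y. of_real (1 / r ^ DIM('a)) * N ((1 / r) *\<^sub>R (y - \<sigma> v)))" for v
      by (intro continuous_intros continuous_on_compose2[OF cN]) auto
  qed measurable
  define Q where "Q = (LINT v|M. B v * norm (\<kappa> v))"
  have Q: "0 \<le> Q" unfolding Q_def using B1 order_trans[OF zero_le_one B1] by (intro integral_nonneg_AE AE_I2) auto
  have w\<Psi>D: "norm (w z * \<Psi> z) \<le> Q * (1 / r ^ DIM('a) * D)" for z
  proof -
    have "w z * \<Psi> z = (LINT v|M. \<kappa> v * (of_real (1 / r ^ DIM('a)) * (w z * N ((1 / r) *\<^sub>R (z - \<sigma> v)))))"
      unfolding \<Psi>_def Bochner_Integration.integral_mult_right_zero[symmetric]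
      by (intro Bochner_Integration.integral_cong refl) (simp only: mult_ac)
    also have "norm \<dots> \<le> (LINT v|M. (B v * norm (\<kappa> v)) * (1 / r ^ DIM('a) * D))"
    proof (rule order_trans[OF integral_norm_bound integral_mono'])
      fix v
      have "norm (w z * N ((1 / r) *\<^sub>R (z - \<sigma> v))) \<le> B v * D"
        using wN[of v "(1 / r) *\<^sub>R (z - \<sigma> v)"] mult_left_mono[OF H(3) order_trans[OF zero_le_one B1[of v]]] r
        by (simp add: order_trans)
      then have "norm (\<kappa> v) * (1 / r ^ DIM('a) * norm (w z * N ((1 / r) *\<^sub>R (z - \<sigma> v)))) \<le> norm (\<kappa> v) * (1 / r ^ DIM('a) * (B v * D))"
        using r by (intro mult_left_mono) auto
      then show "norm (\<kappa> v * (of_real (1 / r ^ DIM('a)) * (w z * N ((1 / r) *\<^sub>R (z - \<sigma> v))))) \<le> (B v * norm (\<kappa> v)) * (1 / r ^ DIM('a) * D)"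
        using r by (simp only: norm_mult norm_of_real) (simp add: mult_ac)
    next
      show "integrable M (\<lambda>v. (B v * norm (\<kappa> v)) * (1 / r ^ DIM('a) * D))" by (intro integrable_mult_left \<kappa>B)
      show "0 \<le> (B v * norm (\<kappa> v)) * (1 / r ^ DIM('a) * D)" for v
        using r D order_trans[OF zero_le_one B1[of v]] by auto
    qed
    also have "\<dots> = Q * (1 / r ^ DIM('a) * D)" by (simp only: Q_def Bochner_Integration.integral_mult_left_zero)
    finally show ?thesis .
  qed
  have \<Psi>D: "norm (\<Psi> z) \<le> Q * (1 / r ^ DIM('a) * D)" for z
    using w\<Psi>D[of z] mult_right_mono[OF w1[of z] norm_ge_zero[of "\<Psi> z"]] by (simp add: norm_mult)
  define G where "G = fourier (\<lambda>z. w z * \<Psi> z)"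
  have [measurable]: "G \<in> borel_measurable borel" unfolding G_def using A by (intro fourier_measurable) auto
  \<comment> \<open>Used for two exponents: \<open>q = u\<close> bounds the norm, and
    \<open>q = 1\<close> makes \<open>G\<close> integrable, so that the multiplication formula and
    inversion apply to it.\<close>
  have mass: "lp_mass q G \<le> ennreal (Q powr q) * (ennreal (1 / r ^ DIM('a)) * lp_mass q (fourier H))"
    if q: "q \<ge> 1" and fq: "\<And>v. fmult q (B v) (\<lambda>y. bessel_weight s (\<sigma> v + r *\<^sub>R y) / bessel_weight s y)" for q
  proof -
    \<comment> \<open>Dividing by \<open>B v\<close> gives the averaged functions a common mass
      bound; the weight becomes \<open>B v * \<kappa> v\<close>.\<close>
    define g where "g v \<eta> = of_real (1 / B v) * (cis (- 2 * pi * (\<sigma> v \<bullet> \<eta>)) * fourier (\<lambda>y. w (\<sigma> v + r *\<^sub>R y) * N y) (r *\<^sub>R \<eta>))" for v \<eta>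
    have B0: "B v > 0" for v using B1[of v] by simp
    have mu: "(\<lambda>y. w (\<sigma> v + r *\<^sub>R y) * N y) = (\<lambda>y. bessel_weight s (\<sigma> v + r *\<^sub>R y) / bessel_weight s y * H y)" for v
      by (simp add: N_def w_def)
    have "G = (\<lambda>\<eta>. LINT v|M. (of_real (B v) * \<kappa> v) * g v \<eta>)"
    proof
      fix \<eta>
      show "G \<eta> = (LINT v|M. (of_real (B v) * \<kappa> v) * g v \<eta>)"
        unfolding G_def FA g_def using less_imp_neq[OF B0] by (intro Bochner_Integration.integral_cong refl) simp
    qed
    then have "lp_mass q G = lp_mass q (\<lambda>\<eta>. LINT v|M. (of_real (B v) * \<kappa> v) * g v \<eta>)" by simp
    also have "\<dots> \<le> ennreal ((LINT v|M. norm (of_real (B v) * \<kappa> v)) powr q) * (ennreal (1 / r ^ DIM('a)) * lp_mass q (fourier H))"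
    proof (rule lp_mass_average[OF M _ _ _ q])
      have "integrable M (\<lambda>v. norm (of_real (B v) * \<kappa> v))"
        using \<kappa>B B0 by (simp add: norm_mult abs_of_pos)
      then show "integrable M (\<lambda>v. of_real (B v) * \<kappa> v)" by (simp add: integrable_norm_iff)
      show "(\<lambda>(v, \<eta>). g v \<eta>) \<in> borel_measurable (M \<Otimes>\<^sub>M borel)"
        unfolding g_def fourier_def by measurable
      show "norm (g v \<eta>) \<le> (LINT y|lborel. norm (H y))" for v \<eta>
      proof -
        have "norm (fourier (\<lambda>y. w (\<sigma> v + r *\<^sub>R y) * N y) (r *\<^sub>R \<eta>)) \<le> (LINT y|lborel. norm (w (\<sigma> v + r *\<^sub>R y) * N y))"
          by (rule norm_fourier_le)
        also have "\<dots> \<le> (LINT y|lborel. B v * norm (H y))"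
          by (rule integral_mono') (use H B0[of v] wN in \<open>auto intro: less_imp_le\<close>)
        finally have "norm (fourier (\<lambda>y. w (\<sigma> v + r *\<^sub>R y) * N y) (r *\<^sub>R \<eta>)) \<le> B v * (LINT y|lborel. norm (H y))" by simp
        then show ?thesis using B0[of v]
          by (simp only: g_def norm_mult norm_of_real norm_cis) (simp add: field_simps)
      qed
      show "lp_mass q (g v) \<le> ennreal (1 / r ^ DIM('a)) * lp_mass q (fourier H)" for v
      proof -
        have m [measurable]: "fourier (\<lambda>y. w (\<sigma> v + r *\<^sub>R y) * N y) \<in> borel_measurable borel" by measurable
        have "lp_mass q (g v) = lp_mass q (\<lambda>\<eta>. of_real (1 / B v) * fourier (\<lambda>y. w (\<sigma> v + r *\<^sub>R y) * N y) (0 + r *\<^sub>R \<eta>))"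
          unfolding lp_mass_def g_def by (simp only: norm_mult norm_cis mult_1_left add_0)
        also have "\<dots> = ennreal ((1 / B v) powr q) * (ennreal (1 / r ^ DIM('a)) * lp_mass q (fourier (\<lambda>y. w (\<sigma> v + r *\<^sub>R y) * N y)))"
          using r B0[of v] lp_mass_affine[OF m, of r q 0] by (subst lp_mass_cmult) (auto simp: abs_of_pos norm_divide)
        also have "\<dots> \<le> ennreal ((1 / B v) powr q) * (ennreal (1 / r ^ DIM('a)) * (ennreal (B v powr q) * lp_mass q (fourier H)))"
          unfolding mu by (intro mult_left_mono fmult_lp_mass[OF fq H(1)]) auto
        also have "\<dots> = (ennreal ((1 / B v) powr q) * ennreal (B v powr q)) * (ennreal (1 / r ^ DIM('a)) * lp_mass q (fourier H))"
          by (simp only: mult_ac)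
        also have "ennreal ((1 / B v) powr q) * ennreal (B v powr q) = 1"
          using B0[of v] by (simp add: ennreal_mult'[symmetric] powr_mult[symmetric])
        finally show ?thesis by simp
      qed
    qed
    also have "(LINT v|M. norm (of_real (B v) * \<kappa> v)) = Q"
      unfolding Q_def using B0 by (simp add: norm_mult abs_of_pos)
    finally show ?thesis .
  qed
  have mass_u: "lp_mass u G \<le> ennreal (Q powr u * (S / r ^ DIM('a)))"
  proof -
    have "lp_mass u G \<le> ennreal (Q powr u) * (ennreal (1 / r ^ DIM('a)) * ennreal S)"
      using mass[OF u fm] S(1) by (meson mult_left_mono order_trans zero_le)
    also have "\<dots> = ennreal (Q powr u * (S / r ^ DIM('a)))"
      using r S(2) by (simp add: ennreal_mult'[symmetric])
    finally show ?thesis .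
  qed
  have GI: "integrable lborel G"
  proof -
    have "lp_mass 1 (fourier H) = (\<integral>\<^sup>+x. norm (fourier H x) \<partial>lborel)" by (simp add: lp_mass_def)
    then have "lp_mass 1 (fourier H) < \<infinity>" using H(4) by (simp add: integrable_iff_bounded)
    then have "lp_mass 1 G < \<infinity>"
      using mass[OF _ fm1] by (auto simp: ennreal_mult_less_top intro: order_le_less_trans)
    then show ?thesis by (simp add: lp_mass_def integrable_iff_bounded)
  qed
  \<comment> \<open>The defining identity of the Sobolev norm: move the transform from
    \<open>\<phi>\<close> to \<open>G\<close>, invert to get \<open>w \<Psi>\<close> reflected, hand
    the even weight over to \<open>\<phi>\<close>, and read the reflected \<open>\<Psi>\<close> as
    the transform of \<open>F\<close>.\<close>
  have pair: "(LINT x|lborel. G x * fourier \<phi> x) = (LINT x|lborel. F x * fourier (\<lambda>\<xi>. bessel_weight s \<xi> * \<phi> \<xi>) x)"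
    if \<phi>: "schwartz \<phi>" for \<phi>
  proof -
    note I = schwartz_bessel_integrable[OF \<phi> s]
    have "(LINT x|lborel. G x * fourier \<phi> x) = (LINT x|lborel. fourier G x * \<phi> x)"
      by (rule fourier_multiplication[OF GI I(1), symmetric])
    also have "fourier G = (\<lambda>z. w (- z) * \<Psi> (- z))"
    proof
      fix z
      show "fourier G z = w (- z) * \<Psi> (- z)"
        unfolding G_def
        by (rule fourier_inversion[OF A GI[unfolded G_def] _ w\<Psi>D])
           (unfold w_def, intro continuous_intros continuous_on_bessel_weight c\<Psi>)
    qed
    also have "(LINT x|lborel. w (- x) * \<Psi> (- x) * \<phi> x) = (LINT x|lborel. \<Psi> (- x) * (bessel_weight s x * \<phi> x))"
      by (simp add: w_def mult_ac)
    also have "\<dots> = (LINT x|lborel. fourier F x * (bessel_weight s x * \<phi> x))"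
    proof -
      have "fourier F z = \<Psi> (- z)" for z
        unfolding F\<Psi>[symmetric]
        by (rule fourier_inversion[OF _ _ c\<Psi> \<Psi>D]) (use C F F\<Psi> in auto)
      then show ?thesis by simp
    qed
    also have "\<dots> = (LINT x|lborel. F x * fourier (\<lambda>\<xi>. bessel_weight s \<xi> * \<phi> \<xi>) x)"
      by (rule fourier_multiplication[OF F(1) I(2)])
    finally show ?thesis .
  qed
  have le: "lp_norm u G \<le> ennreal ((Q powr u * (S / r ^ DIM('a))) powr (1 / u))"
    by (rule lp_norm_le[OF mass_u]) (use u S r in auto)
  have "sobolev_norm u s F \<le> lp_norm u G"
    unfolding sobolev_norm_def
  proof (rule Inf_lower, intro CollectI exI[of _ G] conjI refl allI impI pair)
    show "lp_norm u G < \<infinity>" using le by (rule order_le_less_trans) simp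
  qed auto
  also note le
  also have "(Q powr u * (S / r ^ DIM('a))) powr (1 / u) = Q * (S / r ^ DIM('a)) powr (1 / u)"
    using u Q S r by (subst powr_mult) (auto simp: powr_powr)
  finally show ?thesis by (simp add: Q_def)
qed

text \<open>One constant and one degree for both exponents; the exponent 1 serves the integrability
  of the representing function in \<open>sobolev_norm_superposition_le\<close>.\<close>

lemma fmult_bessel_ratio_common:
  fixes s u :: real
  assumes u: "u \<ge> 1" and s: "s \<ge> 0"
  obtains C N where "C \<ge> 1"
    "\<And>r (v::'a::euclidean_space) q. 1/4 \<le> r \<Longrightarrow> r \<le> 4 \<Longrightarrow> q = 1 \<or> q = u \<Longrightarrow>
       fmult q (C * (1 + norm v) ^ N) (\<lambda>y. bessel_weight s (v + r *\<^sub>R y) / bessel_weight s y)"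
proof -
  obtain C N where C: "C \<ge> 0" and 1: "\<And>r (v::'a). 1/4 \<le> r \<Longrightarrow> r \<le> 4 \<Longrightarrow>
       fmult u (C * (1 + norm v) ^ N) (\<lambda>y. bessel_weight s (v + r *\<^sub>R y) / bessel_weight s y)"
    using fmult_bessel_ratio[OF u s] by blast
  obtain C' N' where C': "C' \<ge> 0" and 2: "\<And>r (v::'a). 1/4 \<le> r \<Longrightarrow> r \<le> 4 \<Longrightarrow>
       fmult 1 (C' * (1 + norm v) ^ N') (\<lambda>y. bessel_weight s (v + r *\<^sub>R y) / bessel_weight s y)"
    using fmult_bessel_ratio[OF order_refl s] by blast
  show thesis
  proof (rule that[of "C + C' + 1" "N + N'"])
    show "C + C' + 1 \<ge> 1" using C C' by simp
    fix r q :: real and v :: 'a assume r: "1/4 \<le> r" "r \<le> 4" and q: "q = 1 \<or> q = u"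
    have "C * (1 + norm v) ^ N \<le> (C + C' + 1) * (1 + norm v) ^ (N + N')"
      "C' * (1 + norm v) ^ N' \<le> (C + C' + 1) * (1 + norm v) ^ (N + N')"
      using C C' by (intro mult_mono power_increasing; simp)+
    then show "fmult q ((C + C' + 1) * (1 + norm v) ^ (N + N')) (\<lambda>y. bessel_weight s (v + r *\<^sub>R y) / bessel_weight s y)"
      using fmult_mono[OF 1[OF r, of v]] fmult_mono[OF 2[OF r, of v]] q u by auto
  qed
qed

lemma sobolev_norm_zero: "u > 0 \<Longrightarrow> sobolev_norm u s (\<lambda>\<xi>. 0) = 0"
proof -
  assume "u > 0"
  then have 0: "lp_norm u (\<lambda>x::'a. 0) = 0" by (simp add: lp_norm_def)
  have "sobolev_norm u s (\<lambda>\<xi>::'a. 0) \<le> lp_norm u (\<lambda>x::'a. 0)"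
    unfolding sobolev_norm_def
    by (rule Inf_lower, intro CollectI exI[of _ "\<lambda>x. 0"] conjI refl) (auto simp: 0)
  then show ?thesis by (simp add: 0)
qed

text \<open>At scale \<open>r = 2 powr k\<close> both the transform of the cutoff at
  \<open>r \<xi>\<close> and \<open>fourier \<Theta> \<xi>\<close> are superpositions of characters,
  so their product is one with shifts \<open>r x + v\<close> and weight
  \<open>XA x * \<Theta> v\<close>. The superposition lemma bounds the Sobolev norm by the mass of
  \<open>fourier H\<close>, uniformly over the scales that matter; at all others the product
  vanishes identically.\<close>

lemma A_norm_bound:
  fixes \<Theta> :: "'a::euclidean_space \<Rightarrow> complex"
  assumes \<Theta>: "schwartz \<Theta>" and supp: "\<And>\<xi>. fourier \<Theta> \<xi> \<noteq> 0 \<Longrightarrow> 1/2 \<le> norm \<xi> \<and> norm \<xi> \<le> 2"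
    and u: "u \<ge> 1" and s: "s \<ge> 0"
  obtains X :: "'a \<Rightarrow> real" and K where
    "\<And>y. 0 \<le> X y" "continuous_on UNIV X" "X 0 > 0" "integrable lborel X" "K \<ge> 0"
    "\<And>a H S D. norm a = 1 \<Longrightarrow> integrable lborel H \<Longrightarrow> continuous_on UNIV H \<Longrightarrow> (\<And>y. norm (H y) \<le> D) \<Longrightarrow>
      integrable lborel (fourier H) \<Longrightarrow> lp_mass u (fourier H) \<le> ennreal S \<Longrightarrow> S \<ge> 0 \<Longrightarrow>
      A_norm \<Theta> u s (\<lambda>\<xi>. fourier (\<lambda>x. of_real (X x) * cis (2 * pi * (a \<bullet> x))) \<xi> * fourier (\<lambda>y. H y / bessel_weight s y) \<xi>)
        \<le> ennreal (K * S powr (1 / u))"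
proof -
  obtain C N where C: "C \<ge> 1" and fm: "\<And>r (v::'a) q. 1/4 \<le> r \<Longrightarrow> r \<le> 4 \<Longrightarrow> q = 1 \<or> q = u \<Longrightarrow>
       fmult q (C * (1 + norm v) ^ N) (\<lambda>y. bessel_weight s (v + r *\<^sub>R y) / bessel_weight s y)"
    using fmult_bessel_ratio_common[OF u s] by blast
  obtain X :: "'a \<Rightarrow> real" where X: "\<And>y. 0 \<le> X y" "continuous_on UNIV X" "X 0 > 0" "integrable lborel X"
    "integrable lborel (\<lambda>y. (1 + norm y) ^ N * X y)"
    "\<And>\<xi>. fourier (\<lambda>y. of_real (X y)) \<xi> \<noteq> 0 \<Longrightarrow> norm \<xi> \<le> 1/2"
    using exists_cutoff[of N, where 'a='a] by blast
  have [measurable]: "X \<in> borel_measurable borel" "\<Theta> \<in> borel_measurable borel"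
    using X(4) schwartz_measurable[OF \<Theta>] by auto
  define W where "W v = (1 + norm v) ^ N * norm (\<Theta> v)" for v
  have W: "integrable lborel W"
    using integrable_norm[OF schwartz_weight_integrable(2)[OF \<Theta>, of N]] unfolding W_def[abs_def]
    by (simp only: norm_mult norm_of_real) (simp add: abs_of_nonneg)
  have W0: "0 \<le> W v" for v by (simp add: W_def)
  \<comment> \<open>The factor \<open>4 ^ N\<close> comes from
    \<open>1 + norm (r x + v) \<le> 4 * (1 + norm x) * (1 + norm v)\<close>, valid for
    \<open>0 < r \<le> 4\<close>.\<close>
  define Q where "Q = C * 4 ^ N * ((LINT x|lborel. (1 + norm x) ^ N * X x) * (LINT v|lborel. W v))"
  have Q: "Q \<ge> 0" unfolding Q_def using C X(1) W0
    by (intro mult_nonneg_nonneg integral_nonneg_AE AE_I2) auto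
  \<comment> \<open>A factor 4 per dimension covers \<open>1 / r\<close>, as
    \<open>r \<ge> 1/4\<close>.\<close>
  define K where "K = Q * (4 ^ DIM('a)) powr (1 / u)"
  have main: "A_norm \<Theta> u s (\<lambda>\<xi>. fourier (\<lambda>x. of_real (X x) * cis (2 * pi * (a \<bullet> x))) \<xi> * fourier (\<lambda>y. H y / bessel_weight s y) \<xi>)
        \<le> ennreal (K * S powr (1 / u))"
    if a: "norm a = 1" and H: "integrable lborel H" "continuous_on UNIV H" "\<And>y. norm (H y) \<le> D" "integrable lborel (fourier H)"
      and S: "lp_mass u (fourier H) \<le> ennreal S" "S \<ge> 0" for a H S D
    unfolding A_norm_def
  proof (rule SUP_least)
    fix k :: int
    define r where "r = 2 powr real_of_int k"
    have r0: "r > 0" by (simp add: r_def)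
    define XA where "XA x = of_real (X x) * cis (2 * pi * (a \<bullet> x))" for x
    have [measurable]: "XA \<in> borel_measurable borel" unfolding XA_def by measurable
    have XAi: "integrable lborel XA" unfolding XA_def using X(4) by (intro integrable_mult_cis) auto
    have \<Theta>i: "integrable lborel \<Theta>" using schwartz_bessel_integrable(1)[OF \<Theta> s] .
    define m where "m \<xi> = fourier XA \<xi> * fourier (\<lambda>y. H y / bessel_weight s y) \<xi>" for \<xi>
    define F where "F \<xi> = m (r *\<^sub>R \<xi>) * fourier \<Theta> \<xi>" for \<xi>
    have XAf: "fourier XA \<xi> = fourier (\<lambda>y. of_real (X y)) (\<xi> - a)" for \<xi>
      unfolding XA_def using fourier_modulated[of "\<lambda>y. of_real (X y)" "- a" \<xi>] by simp
    have "sobolev_norm u s F \<le> ennreal (K * S powr (1 / u))"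
    proof (cases "\<forall>\<xi>. F \<xi> = 0")
      case True
      then have "F = (\<lambda>\<xi>. 0)" by auto
      then show ?thesis using u by (simp add: sobolev_norm_zero)
    next
      case False
      then obtain \<xi> where \<xi>: "fourier XA (r *\<^sub>R \<xi>) \<noteq> 0" "fourier \<Theta> \<xi> \<noteq> 0" by (auto simp: F_def m_def)
      have n\<xi>: "1/2 \<le> norm \<xi>" "norm \<xi> \<le> 2" using supp[OF \<xi>(2)] by auto
      \<comment> \<open>A point where both factors are nonzero has
        \<open>1/2 \<le> r * norm \<xi> \<le> 3/2\<close> and
        \<open>1/2 \<le> norm \<xi> \<le> 2\<close>, which confines \<open>r\<close> to the interval
        from 1/4 to 3.\<close>
      have "norm (r *\<^sub>R \<xi> - a) \<le> 1/2" using X(6) \<xi>(1) unfolding XAf by blast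
      then have nr: "1/2 \<le> r * norm \<xi>" "r * norm \<xi> \<le> 3/2"
        using a r0 norm_triangle_ineq2[of "r *\<^sub>R \<xi>" a] norm_triangle_ineq2[of a "r *\<^sub>R \<xi>"]
        by (simp_all add: norm_minus_commute)
      have "r * norm \<xi> \<le> r * 2" "r * (1/2) \<le> r * norm \<xi>"
        using n\<xi> r0 by (intro mult_left_mono; simp)+
      then have r: "1/4 \<le> r" "r \<le> 4" using nr by linarith+
      define \<kappa> where "\<kappa> = (\<lambda>(x, v). XA x * \<Theta> v)"
      define \<sigma> where "\<sigma> = (\<lambda>(x::'a, v::'a). r *\<^sub>R x + v)"
      define B where "B = (\<lambda>p. C * (1 + norm (\<sigma> p)) ^ N)"
      have [measurable]: "\<kappa> \<in> borel_measurable (lborel \<Otimes>\<^sub>M lborel)" "\<sigma> \<in> borel_measurable (lborel \<Otimes>\<^sub>M lborel)"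
        "B \<in> borel_measurable (lborel \<Otimes>\<^sub>M lborel)"
        unfolding \<kappa>_def \<sigma>_def B_def by measurable
      have Bk: "(1 + norm (r *\<^sub>R x + v)) ^ N * norm (XA x * \<Theta> v) \<le> (4 ^ N * ((1 + norm x) ^ N * X x)) * W v" for x v
      proof -
        have "norm (r *\<^sub>R x + v) \<le> r * norm x + norm v" using norm_triangle_ineq[of "r *\<^sub>R x" v] r0 by simp
        also have "\<dots> \<le> 4 * norm x + norm v" using r by (simp add: mult_right_mono)
        also have "1 + \<dots> \<le> 4 * ((1 + norm x) * (1 + norm v))"
          using norm_ge_zero[of x] norm_ge_zero[of v] mult_nonneg_nonneg[OF norm_ge_zero[of x] norm_ge_zero[of v]]
          by (simp add: algebra_simps)
        finally have "(1 + norm (r *\<^sub>R x + v)) ^ N \<le> (4 * ((1 + norm x) * (1 + norm v))) ^ N"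
          by (intro power_mono) auto
        then have "(1 + norm (r *\<^sub>R x + v)) ^ N * (X x * norm (\<Theta> v)) \<le> (4 * ((1 + norm x) * (1 + norm v))) ^ N * (X x * norm (\<Theta> v))"
          using X(1) by (intro mult_right_mono) auto
        moreover have "norm (XA x * \<Theta> v) = X x * norm (\<Theta> v)" using X(1)[of x] by (simp add: XA_def norm_mult)
        ultimately show ?thesis unfolding W_def by (simp only: power_mult_distrib mult_ac)
      qed
      have i1: "integrable lborel (\<lambda>x. 4 ^ N * ((1 + norm x) ^ N * X x))" by (intro integrable_mult_right X)
      define Bk where "Bk x v = (1 + norm (r *\<^sub>R x + v)) ^ N * norm (XA x * \<Theta> v)" for x v
      have Bkm: "(\<lambda>(x, v). Bk x v) \<in> borel_measurable (lborel \<Otimes>\<^sub>M lborel)" unfolding Bk_def by measurable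
      have Bkb: "norm (Bk x v) \<le> (4 ^ N * ((1 + norm x) ^ N * X x)) * W v" for x v
        using Bk[of x v] unfolding Bk_def by (simp add: abs_mult)
      have Bki: "integrable (lborel \<Otimes>\<^sub>M lborel) (\<lambda>(x, v). Bk x v)"
        by (rule Fubini_dominated_pair[OF sigma_finite_lborel sigma_finite_lborel Bkm i1 W Bkb])
      have BkE: "B p * norm (\<kappa> p) = C * (case p of (x, v) \<Rightarrow> Bk x v)" for p
        by (simp add: B_def \<kappa>_def \<sigma>_def Bk_def case_prod_unfold mult_ac)
      have \<kappa>B: "integrable (lborel \<Otimes>\<^sub>M lborel) (\<lambda>p. B p * norm (\<kappa> p))"
        unfolding BkE by (intro integrable_mult_right Bki)
      have \<kappa>BQ: "(LINT p|(lborel \<Otimes>\<^sub>M lborel). B p * norm (\<kappa> p)) \<le> Q"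
      proof -
        have "(LINT p|(lborel \<Otimes>\<^sub>M lborel). (case p of (x, v) \<Rightarrow> Bk x v)) = (LINT x|lborel. (LINT v|lborel. Bk x v))"
          using lborel_pair.integral_fst'[OF Bki] by simp
        also have "\<dots> \<le> (LINT x|lborel. (4 ^ N * ((1 + norm x) ^ N * X x)) * (LINT v|lborel. W v))"
        proof (rule integral_mono)
          show "integrable lborel (\<lambda>x. LINT v|lborel. Bk x v)"
            by (rule Fubini_dominated_fst[OF sigma_finite_lborel sigma_finite_lborel Bkm i1 W Bkb])
          show "integrable lborel (\<lambda>x. (4 ^ N * ((1 + norm x) ^ N * X x)) * (LINT v|lborel. W v))"
            by (intro integrable_mult_left i1)
          fix x
          have "(LINT v|lborel. Bk x v) \<le> (LINT v|lborel. (4 ^ N * ((1 + norm x) ^ N * X x)) * W v)"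
            by (rule integral_mono') (use Bkb[of x] W W0 X(1)[of x] in \<open>auto intro: order_trans[OF abs_ge_self]\<close>)
          then show "(LINT v|lborel. Bk x v) \<le> (4 ^ N * ((1 + norm x) ^ N * X x)) * (LINT v|lborel. W v)" by simp
        qed
        also have "\<dots> = 4 ^ N * (LINT x|lborel. (1 + norm x) ^ N * X x) * (LINT v|lborel. W v)"
          by (simp only: Bochner_Integration.integral_mult_left_zero Bochner_Integration.integral_mult_right_zero)
        finally have "C * (LINT p|(lborel \<Otimes>\<^sub>M lborel). (case p of (x, v) \<Rightarrow> Bk x v)) \<le> Q"
          using C by (simp add: Q_def mult.assoc mult_left_mono)
        then show ?thesis unfolding BkE by simp
      qed
      have sob: "sobolev_norm u s F \<le> ennreal ((LINT p|(lborel \<Otimes>\<^sub>M lborel). B p * norm (\<kappa> p)) * (S / r ^ DIM('a)) powr (1 / u))"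
      proof (rule sobolev_norm_superposition_le[OF s u _ _ _ _ \<kappa>B _ r0 _ _ H _ _ S])
        show "sigma_finite_measure (lborel \<Otimes>\<^sub>M lborel :: ('a \<times> 'a) measure)"
          unfolding lborel_prod by (rule sigma_finite_lborel)
        show "1 \<le> B p" for p
          using mult_mono[of 1 C 1 "(1 + norm (\<sigma> p)) ^ N"] C by (simp add: B_def)
        show "fmult u (B p) (\<lambda>y. bessel_weight s (\<sigma> p + r *\<^sub>R y) / bessel_weight s y)"
          "fmult 1 (B p) (\<lambda>y. bessel_weight s (\<sigma> p + r *\<^sub>R y) / bessel_weight s y)" for p
          unfolding B_def by (rule fm[OF r], simp)+
        show Feq: "F \<xi> = (LINT p|(lborel \<Otimes>\<^sub>M lborel). \<kappa> p * cis (- 2 * pi * (\<sigma> p \<bullet> \<xi>))) * fourier (\<lambda>y. H y / bessel_weight s y) (r *\<^sub>R \<xi>)" for \<xi>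
        proof -
          have "integrable (lborel \<Otimes>\<^sub>M lborel) (\<lambda>(x, v). (XA x * \<Theta> v) * cis (- 2 * pi * ((r *\<^sub>R x + v) \<bullet> \<xi>)))"
            by (rule Fubini_dominated_pair[OF sigma_finite_lborel sigma_finite_lborel, where f="\<lambda>x. norm (XA x)" and g="\<lambda>v. norm (\<Theta> v)"])
               (use XAi \<Theta>i in \<open>auto simp: norm_mult\<close>)
          from lborel_pair.integral_fst'[OF this]
          have "(LINT p|(lborel \<Otimes>\<^sub>M lborel). \<kappa> p * cis (- 2 * pi * (\<sigma> p \<bullet> \<xi>))) = (LINT x|lborel. (LINT v|lborel. (XA x * \<Theta> v) * cis (- 2 * pi * ((r *\<^sub>R x + v) \<bullet> \<xi>))))"
            by (simp add: \<kappa>_def \<sigma>_def case_prod_unfold)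
          also have "\<dots> = (LINT x|lborel. (LINT v|lborel. (XA x * cis (- 2 * pi * (x \<bullet> (r *\<^sub>R \<xi>)))) * (\<Theta> v * cis (- 2 * pi * (v \<bullet> \<xi>)))))"
          proof (intro Bochner_Integration.integral_cong refl)
            fix x v
            have "- 2 * pi * ((r *\<^sub>R x + v) \<bullet> \<xi>) = - 2 * pi * (x \<bullet> (r *\<^sub>R \<xi>)) + - 2 * pi * (v \<bullet> \<xi>)"
              by (simp add: inner_add_left algebra_simps)
            then show "(XA x * \<Theta> v) * cis (- 2 * pi * ((r *\<^sub>R x + v) \<bullet> \<xi>)) = (XA x * cis (- 2 * pi * (x \<bullet> (r *\<^sub>R \<xi>)))) * (\<Theta> v * cis (- 2 * pi * (v \<bullet> \<xi>)))"
              by (simp only: cis_mult[symmetric] mult_ac)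
          qed
          also have "\<dots> = fourier XA (r *\<^sub>R \<xi>) * fourier \<Theta> \<xi>"
            unfolding fourier_def by (simp only: Bochner_Integration.integral_mult_right_zero Bochner_Integration.integral_mult_left_zero)
          finally show ?thesis by (simp add: F_def m_def mult_ac)
        qed
        show "integrable lborel F"
        proof -
          have [measurable]: "H \<in> borel_measurable borel" using H by auto
          define b where "b = (LINT x|lborel. norm (XA x)) * (LINT y|lborel. norm (H y / bessel_weight s y)) * (LINT v|lborel. norm (\<Theta> v))"
          have "integrable lborel (\<lambda>\<xi>::'a. b * indicator (cball 0 2) \<xi>)"
            by (intro integrable_mult_right integrable_real_indicator) (auto intro: emeasure_lborel_cball_finite[unfolded infinity_ennreal_def])
          then show ?thesis
          proof (rule Bochner_Integration.integrable_bound)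
            show "F \<in> borel_measurable lborel" unfolding F_def m_def by measurable
            show "AE \<xi> in lborel. norm (F \<xi>) \<le> norm (b * indicator (cball 0 2) \<xi>)"
            proof (rule AE_I2)
              fix \<xi>
              have "norm (F \<xi>) \<le> b"
                unfolding F_def m_def b_def norm_mult by (intro mult_mono norm_fourier_le mult_nonneg_nonneg) auto
              moreover have "F \<xi> = 0" if "\<xi> \<notin> cball 0 2" using supp[of \<xi>] that by (auto simp: F_def)
              ultimately show "norm (F \<xi>) \<le> norm (b * indicator (cball 0 2) \<xi>)"
                by (cases "\<xi> \<in> cball 0 2") auto
            qed
          qed
        qed
      qed measurable
      also have "\<dots> \<le> ennreal (K * S powr (1 / u))"
      proof (rule ennreal_leI)
        have "(1 / 4) ^ DIM('a) \<le> r ^ DIM('a)" using r by (intro power_mono) auto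
        then have "1 \<le> 4 ^ DIM('a) * r ^ DIM('a)" by (simp add: power_one_over field_simps)
        from mult_right_mono[OF this S(2)] have "S / r ^ DIM('a) \<le> 4 ^ DIM('a) * S"
          using r0 by (simp add: divide_le_eq mult_ac)
        then have "(S / r ^ DIM('a)) powr (1 / u) \<le> (4 ^ DIM('a) * S) powr (1 / u)"
          using u r0 S by (intro powr_mono2) auto
        also have "\<dots> = (4 ^ DIM('a)) powr (1 / u) * S powr (1 / u)" by (rule powr_mult)
        finally have "(S / r ^ DIM('a)) powr (1 / u) \<le> (4 ^ DIM('a)) powr (1 / u) * S powr (1 / u)" .
        then have "(LINT p|(lborel \<Otimes>\<^sub>M lborel). B p * norm (\<kappa> p)) * (S / r ^ DIM('a)) powr (1 / u) \<le> Q * ((4 ^ DIM('a)) powr (1 / u) * S powr (1 / u))"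
          using \<kappa>BQ Q by (intro mult_mono) auto
        then show "(LINT p|(lborel \<Otimes>\<^sub>M lborel). B p * norm (\<kappa> p)) * (S / r ^ DIM('a)) powr (1 / u) \<le> K * S powr (1 / u)"
          by (simp add: K_def mult_ac)
      qed
      finally show ?thesis .
    qed
    then show "sobolev_norm u s (\<lambda>\<xi>. fourier (\<lambda>x. of_real (X x) * cis (2 * pi * (a \<bullet> x))) ((2 powr real_of_int k) *\<^sub>R \<xi>) *
        fourier (\<lambda>y. H y / bessel_weight s y) ((2 powr real_of_int k) *\<^sub>R \<xi>) * fourier \<Theta> \<xi>) \<le> ennreal (K * S powr (1 / u))"
      unfolding F_def m_def XA_def r_def .
  qed
  show thesis
    by (rule that[of X K, OF X(1-4) _ main]) (use Q in \<open>simp add: K_def\<close>)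
qed

section \<open>Dyadic sums of Gaussians\<close>

lemma Gamma_nn_integral_scaled:
  fixes a q :: real
  assumes "a > 0" "q > 0"
  shows "(\<integral>\<^sup>+t. ennreal (indicator {0<..} t * (t powr (a - 1) * exp (- (q * t)))) \<partial>lborel) = ennreal (Gamma a * q powr (- a))"
proof -
  note h = Gamma_integral_scaled[OF assms]
  show ?thesis
    by (subst nn_integral_eq_integral[OF h[unfolded has_bochner_integral_iff, THEN conjunct1]])
       (auto simp: has_bochner_integral_integral_eq[OF h])
qed

text \<open>A Beta integral: \<open>(t + A) powr (- (a + b))\<close> is written as a Gamma integral
  in a second variable \<open>\<rho>\<close>; after Tonelli both the inner integral in
  \<open>t\<close> and the outer one in \<open>\<rho>\<close> are Gamma integrals.\<close>

lemma nn_integral_powr_beta: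
  fixes a b A :: real
  assumes a: "a > 0" and b: "b > 0" and A: "A > 0"
  shows "(\<integral>\<^sup>+t. ennreal (indicator {0<..} t * (t powr (b - 1) * (t + A) powr (- (a + b)))) \<partial>lborel)
    = ennreal (Gamma a * Gamma b / Gamma (a + b) * A powr (- a))"
proof -
  define G where "G = Gamma (a + b)"
  have G: "G > 0" unfolding G_def using a b by (intro Gamma_real_pos) auto
  have Gab: "Gamma a > 0" "Gamma b > 0" using a b by (auto intro: Gamma_real_pos)
  define f where "f t \<rho> = indicator {0<..} t * indicator {0<..} \<rho> * (t powr (b - 1) * \<rho> powr (a + b - 1) * exp (- ((t + A) * \<rho>)))" for t \<rho> :: real
  have [measurable]: "(\<lambda>(t, \<rho>). f t \<rho>) \<in> borel_measurable (borel \<Otimes>\<^sub>M borel)"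
    unfolding f_def by measurable
  have 1: "(\<integral>\<^sup>+\<rho>. ennreal (f t \<rho>) \<partial>lborel) = ennreal (G * (indicator {0<..} t * (t powr (b - 1) * (t + A) powr (- (a + b)))))" for t
  proof (cases "t > 0")
    case True
    have "(\<integral>\<^sup>+\<rho>. ennreal (f t \<rho>) \<partial>lborel) = (\<integral>\<^sup>+\<rho>. ennreal (t powr (b - 1)) * ennreal (indicator {0<..} \<rho> * (\<rho> powr (a + b - 1) * exp (- ((t + A) * \<rho>)))) \<partial>lborel)"
      using True by (intro nn_integral_cong) (simp add: f_def ennreal_mult'[symmetric] mult_ac)
    also have "\<dots> = ennreal (t powr (b - 1)) * ennreal (Gamma (a + b) * (t + A) powr (- (a + b)))"
      using True A a b by (subst nn_integral_cmult) (auto simp: Gamma_nn_integral_scaled simp del: minus_add_distrib)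
    also have "\<dots> = ennreal (G * (indicator {0<..} t * (t powr (b - 1) * (t + A) powr (- (a + b)))))"
      using True by (simp add: ennreal_mult'[symmetric] G_def mult_ac del: minus_add_distrib)
    finally show ?thesis .
  qed (simp add: f_def)
  have 2: "(\<integral>\<^sup>+t. ennreal (f t \<rho>) \<partial>lborel) = ennreal (Gamma b) * ennreal (indicator {0<..} \<rho> * (\<rho> powr (a - 1) * exp (- (A * \<rho>))))" for \<rho>
  proof (cases "\<rho> > 0")
    case True
    have "(\<integral>\<^sup>+t. ennreal (f t \<rho>) \<partial>lborel) = (\<integral>\<^sup>+t. ennreal (\<rho> powr (a + b - 1) * exp (- (A * \<rho>))) * ennreal (indicator {0<..} t * (t powr (b - 1) * exp (- (\<rho> * t)))) \<partial>lborel)"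
      using True by (intro nn_integral_cong) (simp add: f_def ennreal_mult'[symmetric] mult_ac exp_add distrib_right distrib_left exp_diff exp_minus field_simps)
    also have "\<dots> = ennreal (\<rho> powr (a + b - 1) * exp (- (A * \<rho>))) * ennreal (Gamma b * \<rho> powr (- b))"
      using True b by (subst nn_integral_cmult) (auto simp: Gamma_nn_integral_scaled)
    also have "\<dots> = ennreal (Gamma b * (\<rho> powr (a + b - 1) * \<rho> powr (- b) * exp (- (A * \<rho>))))"
      by (subst ennreal_mult'[symmetric]) (auto simp: mult_ac)
    also have "\<rho> powr (a + b - 1) * \<rho> powr (- b) = \<rho> powr (a - 1)" by (simp add: powr_add[symmetric])
    finally show ?thesis using True Gab by (subst ennreal_mult'[symmetric]) auto
  qed (simp add: f_def)
  have "ennreal G * (\<integral>\<^sup>+t. ennreal (indicator {0<..} t * (t powr (b - 1) * (t + A) powr (- (a + b)))) \<partial>lborel)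
     = (\<integral>\<^sup>+t. (\<integral>\<^sup>+\<rho>. ennreal (f t \<rho>) \<partial>lborel) \<partial>lborel)"
    unfolding 1 using G by (subst nn_integral_cmult[symmetric]) (auto simp: ennreal_mult' simp del: minus_add_distrib)
  also have "\<dots> = (\<integral>\<^sup>+\<rho>. (\<integral>\<^sup>+t. ennreal (f t \<rho>) \<partial>lborel) \<partial>lborel)"
    by (rule lborel_pair.Fubini'[symmetric]) measurable
  also have "\<dots> = ennreal (Gamma b) * ennreal (Gamma a * A powr (- a))"
    unfolding 2 using a A by (subst nn_integral_cmult) (auto simp: Gamma_nn_integral_scaled)
  also have "\<dots> = ennreal G * ennreal (Gamma a * Gamma b / G * A powr (- a))"
    using G Gab by (simp add: ennreal_mult'[symmetric] mult_ac)
  finally show ?thesis using G unfolding G_def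
    by (subst (asm) ennreal_mult_cancel_left) auto
qed

lemma four_power_eq_powr: "(4::real) ^ j = 2 powr (2 * real j)"
proof -
  have "2 powr (2 * real j) = (2::real) powr real (2 * j)" by simp
  also have "\<dots> = 2 ^ (2 * j)" by (rule powr_realpow) simp
  also have "\<dots> = 4 ^ j" by (simp add: power_mult)
  finally show ?thesis ..
qed

lemma powr_le_exp:
  fixes y a :: real
  assumes "a > 0" "y \<ge> 0"
  shows "y powr a \<le> a powr a * exp y"
proof (cases "y = 0")
  case False
  then have y: "y > 0" using assms by simp
  have "a * ln (y / a) \<le> a * (y / a - 1)" using y assms by (intro mult_left_mono ln_le_minus_one) auto
  also have "\<dots> \<le> y" using assms by (simp add: algebra_simps)
  finally have "exp (a * ln (y / a)) \<le> exp y" by simp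
  then have "(y / a) powr a \<le> exp y" using y assms by (simp add: powr_def)
  then show ?thesis using y assms by (simp add: powr_divide divide_le_eq mult.commute)
qed (use assms in simp)

text \<open>The terms telescope up to constants: they are dominated by the increments of \<open>p / (1 + p)\<close> at \<open>p = (4^j x)^(\<alpha>/2)\<close>.\<close>
lemma dyadic_exp_sum_bound:
  fixes \<alpha> :: real
  assumes \<alpha>: "\<alpha> > 0"
  obtains C where "C > 0" "\<And>x J. x > 0 \<Longrightarrow> (\<Sum>j<J. 2 powr (real j * \<alpha>) * exp (- (pi * 4 ^ j * x))) \<le> C * x powr (- \<alpha> / 2)"
proof -
  define A where "A = 2 powr \<alpha>"
  have A: "A > 1" unfolding A_def using \<alpha> by simp
  \<comment> \<open>Bounds \<open>(1 + p j)^2 * exp (- (pi * y))\<close> for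
    \<open>y = 4 ^ j * x\<close>: here \<open>(p j)^2 = y powr \<alpha>\<close>, which is at most
    \<open>\<alpha> powr \<alpha> * exp y\<close>.\<close>
  define K where "K = 2 + 2 * \<alpha> powr \<alpha>"
  have K: "K > 0" unfolding K_def by (intro add_pos_nonneg) auto
  define C where "C = K * A / (A - 1)"
  have "C > 0" using A K by (simp add: C_def)
  moreover have "(\<Sum>j<J. 2 powr (real j * \<alpha>) * exp (- (pi * 4 ^ j * x))) \<le> C * x powr (- \<alpha> / 2)" if x: "x > 0" for x J
  proof -
    define p where "p j = (4 ^ j * x) powr (\<alpha> / 2)" for j :: nat
    define \<Phi> where "\<Phi> j = p j / (1 + p j)" for j
    have p0: "p j > 0" for j using x by (simp add: p_def)
    have pS: "p (Suc j) = A * p j" for j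
    proof -
      have "p (Suc j) = 4 powr (\<alpha> / 2) * p j" using x by (simp add: p_def powr_mult mult.assoc)
      also have "4 powr (\<alpha> / 2) = A" using powr_powr[of 2 2 "\<alpha> / 2"] by (simp add: A_def)
      finally show ?thesis .
    qed
    have incr: "2 powr (real j * \<alpha>) * exp (- (pi * 4 ^ j * x)) \<le> C * x powr (- \<alpha> / 2) * (\<Phi> (Suc j) - \<Phi> j)" for j
    proof -
      define y where "y = 4 ^ j * x"
      have y: "y > 0" using x by (simp add: y_def)
      have "(1 + p j)\<^sup>2 \<le> 2 + 2 * (p j)\<^sup>2"
        using zero_le_power2[of "1 - p j"] by (simp add: power2_sum power2_diff)
      also have "(p j)\<^sup>2 = y powr \<alpha>" using y by (simp add: p_def y_def power2_eq_square powr_add[symmetric])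
      also have "2 + 2 * y powr \<alpha> \<le> 2 * exp y + 2 * (\<alpha> powr \<alpha> * exp y)"
        using powr_le_exp[OF \<alpha>, of y] y by (intro add_mono mult_left_mono) auto
      also have "\<dots> = K * exp y" by (simp add: K_def algebra_simps)
      also have "\<dots> \<le> K * exp (pi * y)" using K y pi_ge_two mult_right_mono[of 1 pi y] by simp
      finally have k: "(1 + p j)\<^sup>2 * exp (- (pi * y)) \<le> K"
        by (simp add: exp_minus field_simps)
      have "\<Phi> (Suc j) - \<Phi> j = (A - 1) * p j / ((1 + A * p j) * (1 + p j))"
      proof -
        have "1 + A * p j \<noteq> 0" "1 + p j \<noteq> 0" using p0[of j] A by (auto simp: add_pos_pos less_imp_neq[THEN not_sym])
        then show ?thesis unfolding \<Phi>_def pS by (simp add: diff_frac_eq) (simp add: algebra_simps)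
      qed
      also have "\<dots> \<ge> (A - 1) * p j / (A * (1 + p j)\<^sup>2)"
      proof (rule divide_left_mono)
        have "1 + A * p j \<le> A * (1 + p j)" using A by (simp add: algebra_simps)
        then show "(1 + A * p j) * (1 + p j) \<le> A * (1 + p j)\<^sup>2"
          using p0[of j] by (simp add: power2_eq_square mult.assoc[symmetric] mult_right_mono)
      qed (use p0[of j] A in \<open>auto intro!: mult_pos_pos add_pos_pos\<close>)
      finally have inc: "(A - 1) * p j / (A * (1 + p j)\<^sup>2) \<le> \<Phi> (Suc j) - \<Phi> j" .
      have "C * ((A - 1) * p j / (A * (1 + p j)\<^sup>2)) = K * p j / (1 + p j)\<^sup>2"
        using A by (simp add: C_def)
      moreover have "p j * exp (- (pi * y)) \<le> K * p j / (1 + p j)\<^sup>2"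
      proof -
        have "0 < (1 + p j)\<^sup>2" using p0[of j] by simp
        then show ?thesis using mult_left_mono[OF k less_imp_le[OF p0[of j]]] by (simp add: le_divide_eq mult_ac)
      qed
      ultimately have "p j * exp (- (pi * y)) \<le> C * (\<Phi> (Suc j) - \<Phi> j)"
        using mult_left_mono[OF inc less_imp_le[OF \<open>C > 0\<close>]] by linarith
      then have le: "x powr (- \<alpha> / 2) * (p j * exp (- (pi * y))) \<le> x powr (- \<alpha> / 2) * (C * (\<Phi> (Suc j) - \<Phi> j))"
        by (rule mult_left_mono) simp
      have e: "x powr (- \<alpha> / 2) * p j = 2 powr (real j * \<alpha>)"
      proof -
        have "p j = (4 ^ j) powr (\<alpha> / 2) * x powr (\<alpha> / 2)" using x by (simp add: p_def powr_mult)
        moreover have "((4::real) ^ j) powr (\<alpha> / 2) = 2 powr (real j * \<alpha>)"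
        proof -
          show ?thesis unfolding four_power_eq_powr by (simp add: powr_powr)
        qed
        moreover have "x powr (- \<alpha> / 2) * x powr (\<alpha> / 2) = 1" using x by (simp add: powr_add[symmetric])
        ultimately show ?thesis by (simp add: mult_ac)
      qed
      have "2 powr (real j * \<alpha>) * exp (- (pi * 4 ^ j * x)) = x powr (- \<alpha> / 2) * (p j * exp (- (pi * y)))"
        unfolding e[symmetric] by (simp add: y_def mult.assoc)
      also note le
      finally show ?thesis by (simp only: mult_ac)
    qed
    have "(\<Sum>j<J. 2 powr (real j * \<alpha>) * exp (- (pi * 4 ^ j * x))) \<le> (\<Sum>j<J. C * x powr (- \<alpha> / 2) * (\<Phi> (Suc j) - \<Phi> j))"
      by (intro sum_mono incr)
    also have "\<dots> = C * x powr (- \<alpha> / 2) * (\<Phi> J - \<Phi> 0)"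
      by (simp add: sum_distrib_left[symmetric] sum_lessThan_telescope)
    also have "\<dots> \<le> C * x powr (- \<alpha> / 2) * 1"
    proof (intro mult_left_mono)
      have "\<Phi> J \<le> 1" "0 \<le> \<Phi> 0" using p0[of J] p0[of 0] by (auto simp: \<Phi>_def)
      then show "\<Phi> J - \<Phi> 0 \<le> 1" by simp
    qed (use \<open>C > 0\<close> in auto)
    finally show ?thesis by simp
  qed
  ultimately show thesis by (rule that)
qed

text \<open>The decay in \<open>t\<close> is as if the integral ran over the target space alone.
  Writing \<open>gauss t\<close> as a transform on the target and exchanging integrals, the adjoint
  moves the phase to \<open>L' z\<close>, and the integral over \<open>\<eta>\<close> becomes
  \<open>gauss 1 (L' z)\<close>, at most \<open>gauss 1 z\<close> because \<open>L'\<close> does not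
  contract.\<close>

lemma gauss_pullback_le:
  fixes L :: "'a::euclidean_space \<Rightarrow> 'v::euclidean_space" and L' :: "'v \<Rightarrow> 'a"
  assumes [measurable]: "L \<in> borel_measurable borel" "L' \<in> borel_measurable borel"
    and adj: "\<And>\<eta> z. L \<eta> \<bullet> z = \<eta> \<bullet> L' z" and L'n: "\<And>z. norm z \<le> norm (L' z)" and t: "t > 0"
  shows "(LINT \<eta>|lborel. gauss t (L \<eta>) * gauss 1 \<eta>) \<le> t powr (- (DIM('v) / 2))"
proof -
  define c where "c = t powr (- (DIM('v) / 2))"
  have gt: "complex_of_real (gauss t w) = of_real c * fourier (\<lambda>z. of_real (gauss (1 / t) z)) w" for w :: 'v
  proof -
    have "c * ((1 / t) powr (- (DIM('v) / 2))) = 1"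
      using t by (simp add: c_def powr_mult[symmetric])
    then show ?thesis using t by (subst fourier_gauss) (simp_all flip: of_real_mult add: mult.assoc[symmetric])
  qed
  have gi: "integrable lborel (gauss (1 / t) :: 'v \<Rightarrow> real)" using t by (intro integrable_gauss) simp
  have "complex_of_real (LINT \<eta>|lborel. gauss t (L \<eta>) * gauss 1 \<eta>) = (LINT \<eta>|lborel. complex_of_real (gauss t (L \<eta>)) * of_real (gauss 1 \<eta>))"
    by (simp flip: of_real_mult)
  also have "\<dots> = (LINT \<eta>|lborel. (LINT z|lborel. of_real c * (of_real (gauss 1 \<eta>) * of_real (gauss (1 / t) z) * cis (- 2 * pi * (\<eta> \<bullet> L' z)))))"
    unfolding gt fourier_def Bochner_Integration.integral_mult_right_zero[symmetric] Bochner_Integration.integral_mult_left_zero[symmetric]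
    by (intro Bochner_Integration.integral_cong refl) (simp only: adj[symmetric] inner_commute[of _ "L _"] mult_ac)
  also have "\<dots> = (LINT z|lborel. (LINT \<eta>|lborel. of_real c * (of_real (gauss 1 \<eta>) * of_real (gauss (1 / t) z) * cis (- 2 * pi * (\<eta> \<bullet> L' z)))))"
    by (rule Fubini_dominated_eq[where f="\<lambda>\<eta>. c * gauss 1 \<eta>" and g="gauss (1 / t)"])
       (use gi integrable_gauss_unit in \<open>auto simp: norm_mult sigma_finite_lborel c_def\<close>)
  also have "\<dots> = (LINT z|lborel. of_real c * (of_real (gauss (1 / t) z) * fourier (\<lambda>\<eta>. of_real (gauss 1 \<eta>)) (L' z)))"
    unfolding fourier_def Bochner_Integration.integral_mult_right_zero[symmetric]
    by (intro Bochner_Integration.integral_cong refl) (simp only: mult_ac)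
  also have "\<dots> = complex_of_real (LINT z|lborel. c * (gauss (1 / t) z * gauss 1 (L' z)))"
    unfolding fourier_gauss_unit(2) by (simp flip: of_real_mult)
  finally have "(LINT \<eta>|lborel. gauss t (L \<eta>) * gauss 1 \<eta>) = (LINT z|lborel. c * (gauss (1 / t) z * gauss 1 (L' z)))"
    by (simp only: of_real_eq_iff)
  also have "\<dots> \<le> (LINT z|lborel. c * gauss 1 (z::'v))"
  proof (rule integral_mono')
    fix z :: 'v
    have "gauss 1 (L' z) \<le> gauss 1 z" using power_mono[OF L'n[of z] norm_ge_zero, of 2] by (simp add: gauss_def)
    then have "gauss (1 / t) z * gauss 1 (L' z) \<le> 1 * gauss 1 z"
      using t by (intro mult_mono gauss_le_1) auto
    then show "c * (gauss (1 / t) z * gauss 1 (L' z)) \<le> c * gauss 1 z"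
      by (intro mult_left_mono) (auto simp: c_def)
  qed (use integrable_gauss_unit[where 'a='v] in \<open>auto simp: c_def\<close>)
  also have "\<dots> = c"
  proof -
    have "complex_of_real (LINT z|lborel. gauss 1 (z::'v)) = 1"
      using fourier_gauss_unit(2)[of "0::'v"] by (simp add: fourier_def gauss_def)
    then show ?thesis by simp
  qed
  finally show ?thesis by (simp add: c_def)
qed

lemma gauss_mult: "gauss a x * gauss b x = gauss (a + b) x"
  by (simp add: gauss_def exp_add[symmetric] algebra_simps)

text \<open>The triangle inequality would give \<open>J\<close> to the power \<open>u\<close>.
  Instead one factor of \<open>E powr u\<close> stays a sum, and the remaining
  \<open>E powr (u - 1)\<close> is bounded by an inverse power of \<open>|L \<eta>|\<close>,
  suitably regularised, which is a superposition of Gaussians. Each summand reduces to a pulled back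
  Gaussian and a Beta integral in the subordination variable, and contributes at most a constant
  independent of \<open>j\<close>.\<close>

lemma dyadic_gauss_mass_le:
  fixes L :: "'a::euclidean_space \<Rightarrow> 'v::euclidean_space" and L' :: "'v \<Rightarrow> 'a"
  assumes [measurable]: "L \<in> borel_measurable borel" "L' \<in> borel_measurable borel"
    and adj: "\<And>\<eta> z. L \<eta> \<bullet> z = \<eta> \<bullet> L' z" and L'n: "\<And>z. norm z \<le> norm (L' z)" and u: "u > 1"
  obtains C where "C \<ge> 0" "\<And>J. lp_mass u (\<lambda>\<eta>. of_real ((\<Sum>j<J. 2 powr (real j * (DIM('v) / u)) * gauss (4 ^ j) (L \<eta>)) * gauss 1 \<eta>)) \<le> ennreal (C * real J)"
proof -
  define \<alpha> where "\<alpha> = DIM('v) / u"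
  \<comment> \<open>The exponent that \<open>E powr (u - 1)\<close> acquires is
    \<open>\<alpha> * (u - 1)\<close>; that it equals the dimension minus \<open>\<alpha>\<close> is
    what makes all scales contribute equally.\<close>
  define \<beta> where "\<beta> = DIM('v) - \<alpha>"
  have \<alpha>: "\<alpha> > 0" using u by (simp add: \<alpha>_def)
  have \<beta>eq: "\<beta> = \<alpha> * (u - 1)" using u by (simp add: \<beta>_def \<alpha>_def field_simps)
  have \<beta>: "\<beta> > 0" using \<alpha> u by (simp add: \<beta>eq)
  obtain C1 where C1: "C1 > 0" "\<And>x J. x > 0 \<Longrightarrow> (\<Sum>j<J. 2 powr (real j * \<alpha>) * exp (- (pi * 4 ^ j * x))) \<le> C1 * x powr (- \<alpha> / 2)"
    using dyadic_exp_sum_bound[OF \<alpha>] by blast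
  define g where "g = Gamma (\<beta> / 2) * pi powr (- \<beta> / 2)"
  have g: "g > 0" unfolding g_def using \<beta> by (intro mult_pos_pos Gamma_real_pos) auto
  have Gnz: "Gamma (\<beta> / 2) \<noteq> 0" using Gamma_real_pos[of "\<beta> / 2"] \<beta> by linarith
  define C2 where "C2 = (exp pi * C1) powr (u - 1) / g"
  have C2: "C2 > 0" using C1 g by (simp add: C2_def)
  define G3 where "G3 = Gamma (\<alpha> / 2) * Gamma (\<beta> / 2) / Gamma (\<alpha> / 2 + \<beta> / 2)"
  have G3: "G3 > 0" unfolding G3_def using \<alpha> \<beta> by (intro divide_pos_pos mult_pos_pos Gamma_real_pos) auto
  have main: "lp_mass u (\<lambda>\<eta>. of_real ((\<Sum>j<J. 2 powr (real j * \<alpha>) * gauss (4 ^ j) (L \<eta>)) * gauss 1 \<eta>)) \<le> ennreal (C2 * G3 * real J)" for J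
  proof -
    \<comment> \<open>Keeps the base of the power positive where \<open>L \<eta> = 0\<close>. Since
      \<open>4 ^ j * \<delta> \<le> 1\<close> for all \<open>j < J\<close>, replacing
      \<open>|L \<eta>|^2\<close> by \<open>|L \<eta>|^2 + \<delta>\<close> costs only a factor
      \<open>exp pi\<close>.\<close>
    define \<delta> where "\<delta> = 1 / (4::real) ^ J"
    have \<delta>: "\<delta> > 0" by (simp add: \<delta>_def)
    define E where "E \<eta> = (\<Sum>j<J. 2 powr (real j * \<alpha>) * gauss (4 ^ j) (L \<eta>))" for \<eta>
    have E0: "0 \<le> E \<eta>" for \<eta> unfolding E_def by (intro sum_nonneg) auto
    have [measurable]: "E \<in> borel_measurable borel" unfolding E_def by measurable
    have Eb: "E \<eta> \<le> exp pi * C1 * ((norm (L \<eta>))\<^sup>2 + \<delta>) powr (- \<alpha> / 2)" for \<eta>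
    proof -
      define x where "x = (norm (L \<eta>))\<^sup>2 + \<delta>"
      have x: "x > 0" using \<delta> by (simp add: x_def add_nonneg_pos)
      have "E \<eta> \<le> (\<Sum>j<J. exp pi * (2 powr (real j * \<alpha>) * exp (- (pi * 4 ^ j * x))))"
        unfolding E_def
      proof (rule sum_mono)
        fix j assume j: "j \<in> {..<J}"
        have "(4::real) ^ j * \<delta> \<le> 1" using j by (simp add: \<delta>_def power_increasing)
        then have "pi * (4 ^ j * \<delta>) \<le> pi" by simp
        then have "- (pi * 4 ^ j * (norm (L \<eta>))\<^sup>2) \<le> pi + - (pi * 4 ^ j * x)" by (simp add: x_def algebra_simps)
        then have "gauss (4 ^ j) (L \<eta>) \<le> exp pi * exp (- (pi * 4 ^ j * x))"
          unfolding gauss_def exp_add[symmetric] by simp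
        then have "2 powr (real j * \<alpha>) * gauss (4 ^ j) (L \<eta>) \<le> 2 powr (real j * \<alpha>) * (exp pi * exp (- (pi * 4 ^ j * x)))"
          by (intro mult_left_mono) auto
        then show "2 powr (real j * \<alpha>) * gauss (4 ^ j) (L \<eta>) \<le> exp pi * (2 powr (real j * \<alpha>) * exp (- (pi * 4 ^ j * x)))"
          by (simp add: mult_ac)
      qed
      also have "\<dots> \<le> exp pi * (C1 * x powr (- \<alpha> / 2))"
        unfolding sum_distrib_left[symmetric] by (intro mult_left_mono C1 x) auto
      finally show ?thesis by (simp add: x_def mult.assoc)
    qed
    have pt: "ennreal (norm (complex_of_real (E \<eta> * gauss 1 \<eta>)) powr u) \<le>
       (\<integral>\<^sup>+t. (\<Sum>j<J. ennreal (C2 * 2 powr (real j * \<alpha>)) * ennreal (indicator {0<..} t * t powr (\<beta> / 2 - 1) * (gauss (t + 4 ^ j) (L \<eta>) * gauss 1 \<eta>))) \<partial>lborel)" for \<eta>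
    proof -
      define x where "x = (norm (L \<eta>))\<^sup>2 + \<delta>"
      have x: "x > 0" using \<delta> by (simp add: x_def add_nonneg_pos)
      have "E \<eta> powr (u - 1) \<le> (exp pi * C1 * x powr (- \<alpha> / 2)) powr (u - 1)"
        using Eb[of \<eta>] E0[of \<eta>] u by (intro powr_mono2) (auto simp: x_def)
      also have "\<dots> = (exp pi * C1) powr (u - 1) * x powr (- \<beta> / 2)"
        using C1(1) by (subst powr_mult) (auto simp: powr_powr \<beta>eq)
      also have "\<dots> = C2 * (Gamma (\<beta> / 2) * (pi * x) powr (- (\<beta> / 2)))"
        using x by (simp add: C2_def g_def powr_mult Gnz)
      finally have P1: "E \<eta> powr (u - 1) \<le> C2 * (Gamma (\<beta> / 2) * (pi * x) powr (- (\<beta> / 2)))" .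
      have "norm (complex_of_real (E \<eta> * gauss 1 \<eta>)) powr u = E \<eta> powr u * gauss 1 \<eta> powr u"
        using E0[of \<eta>] by (simp add: norm_mult powr_mult)
      \<comment> \<open>As \<open>gauss 1 \<eta> \<le> 1\<close> and \<open>u > 1\<close>; one
        factor of the Gaussian is what \<open>gauss_pullback_le\<close> consumes.\<close>
      also have "\<dots> \<le> E \<eta> powr u * gauss 1 \<eta>"
        using powr_le1[of 1] u gauss_le_1[of 1 \<eta>] powr_mono'[of 1 u "gauss 1 \<eta>"] gauss_pos[of 1 \<eta>]
        by (intro mult_left_mono) auto
      also have "\<dots> = E \<eta> powr (u - 1) * (E \<eta> * gauss 1 \<eta>)"
        using E0[of \<eta>] by (cases "E \<eta> = 0") (auto simp: powr_diff)
      also have "\<dots> \<le> (C2 * (Gamma (\<beta> / 2) * (pi * x) powr (- (\<beta> / 2)))) * (E \<eta> * gauss 1 \<eta>)"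
        using P1 E0[of \<eta>] by (intro mult_right_mono) auto
      finally have "ennreal (norm (complex_of_real (E \<eta> * gauss 1 \<eta>)) powr u) \<le> ennreal (C2 * (E \<eta> * gauss 1 \<eta>)) * ennreal (Gamma (\<beta> / 2) * (pi * x) powr (- (\<beta> / 2)))"
        using C2 E0[of \<eta>] by (simp add: ennreal_mult'[symmetric] mult_ac ennreal_leI)
      also have "\<dots> = ennreal (C2 * (E \<eta> * gauss 1 \<eta>)) * (\<integral>\<^sup>+t. ennreal (indicator {0<..} t * (t powr (\<beta> / 2 - 1) * exp (- (pi * x * t)))) \<partial>lborel)"
        using \<beta> x by (subst Gamma_nn_integral_scaled) auto
      also have "\<dots> = (\<integral>\<^sup>+t. ennreal (C2 * (E \<eta> * gauss 1 \<eta>)) * ennreal (indicator {0<..} t * (t powr (\<beta> / 2 - 1) * exp (- (pi * x * t)))) \<partial>lborel)"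
        by (subst nn_integral_cmult) auto
      also have "\<dots> \<le> (\<integral>\<^sup>+t. (\<Sum>j<J. ennreal (C2 * 2 powr (real j * \<alpha>)) * ennreal (indicator {0<..} t * t powr (\<beta> / 2 - 1) * (gauss (t + 4 ^ j) (L \<eta>) * gauss 1 \<eta>))) \<partial>lborel)"
      proof (rule nn_integral_mono)
        fix t :: real
        have s: "(\<Sum>j<J. ennreal (C2 * 2 powr (real j * \<alpha>)) * ennreal (indicator {0<..} t * t powr (\<beta> / 2 - 1) * (gauss (t + 4 ^ j) (L \<eta>) * gauss 1 \<eta>)))
          = ennreal (\<Sum>j<J. (C2 * 2 powr (real j * \<alpha>)) * (indicator {0<..} t * t powr (\<beta> / 2 - 1) * (gauss (t + 4 ^ j) (L \<eta>) * gauss 1 \<eta>)))"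
          using C2 by (subst sum_ennreal[symmetric]) (auto simp: ennreal_mult'[symmetric] intro!: mult_nonneg_nonneg sum.cong)
        show "ennreal (C2 * (E \<eta> * gauss 1 \<eta>)) * ennreal (indicator {0<..} t * (t powr (\<beta> / 2 - 1) * exp (- (pi * x * t)))) \<le>
            (\<Sum>j<J. ennreal (C2 * 2 powr (real j * \<alpha>)) * ennreal (indicator {0<..} t * t powr (\<beta> / 2 - 1) * (gauss (t + 4 ^ j) (L \<eta>) * gauss 1 \<eta>)))"
        proof (cases "t > 0")
          case True
          \<comment> \<open>Discarding \<open>\<delta>\<close> again is free, since it enters a
            decreasing exponential.\<close>
          have "exp (- (pi * x * t)) \<le> gauss t (L \<eta>)"
            using True \<delta> by (simp add: gauss_def x_def algebra_simps)
          then have "(C2 * (E \<eta> * gauss 1 \<eta>)) * (t powr (\<beta> / 2 - 1) * exp (- (pi * x * t))) \<le> (C2 * (E \<eta> * gauss 1 \<eta>)) * (t powr (\<beta> / 2 - 1) * gauss t (L \<eta>))"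
            using C2 E0[of \<eta>] by (intro mult_left_mono) auto
          also have "\<dots> = (\<Sum>j<J. (C2 * 2 powr (real j * \<alpha>)) * (t powr (\<beta> / 2 - 1) * (gauss (t + 4 ^ j) (L \<eta>) * gauss 1 \<eta>)))"
            unfolding E_def gauss_mult[symmetric] sum_distrib_left sum_distrib_right by (intro sum.cong refl) (simp only: mult_ac)
          finally show ?thesis unfolding s using True C2 E0[of \<eta>]
            by (simp add: ennreal_mult'[symmetric] ennreal_leI)
        qed simp
      qed
      finally show ?thesis .
    qed
    have "lp_mass u (\<lambda>\<eta>. of_real (E \<eta> * gauss 1 \<eta>)) \<le> (\<integral>\<^sup>+\<eta>. (\<integral>\<^sup>+t. (\<Sum>j<J. ennreal (C2 * 2 powr (real j * \<alpha>)) * ennreal (indicator {0<..} t * t powr (\<beta> / 2 - 1) * (gauss (t + 4 ^ j) (L \<eta>) * gauss 1 \<eta>))) \<partial>lborel) \<partial>lborel)"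
      unfolding lp_mass_def by (intro nn_integral_mono pt)
    also have "\<dots> = (\<integral>\<^sup>+t. (\<integral>\<^sup>+\<eta>. (\<Sum>j<J. ennreal (C2 * 2 powr (real j * \<alpha>)) * ennreal (indicator {0<..} t * t powr (\<beta> / 2 - 1) * (gauss (t + 4 ^ j) (L \<eta>) * gauss 1 \<eta>))) \<partial>lborel) \<partial>lborel)"
      by (rule lborel_pair.Fubini'[symmetric]) (unfold gauss_def, measurable)
    also have "\<dots> = (\<integral>\<^sup>+t. (\<Sum>j<J. ennreal (C2 * 2 powr (real j * \<alpha>)) * (\<integral>\<^sup>+\<eta>. ennreal (indicator {0<..} t * t powr (\<beta> / 2 - 1) * (gauss (t + 4 ^ j) (L \<eta>) * gauss 1 \<eta>)) \<partial>lborel)) \<partial>lborel)"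
      by (intro nn_integral_cong) (simp add: nn_integral_sum nn_integral_cmult)
    also have "\<dots> \<le> (\<integral>\<^sup>+t. (\<Sum>j<J. ennreal (C2 * 2 powr (real j * \<alpha>)) * ennreal (indicator {0<..} t * (t powr (\<beta> / 2 - 1) * (t + 4 ^ j) powr (- (\<alpha> / 2 + \<beta> / 2))))) \<partial>lborel)"
    proof (intro nn_integral_mono sum_mono mult_left_mono)
      fix t :: real and j :: nat
      show "(\<integral>\<^sup>+\<eta>. ennreal (indicator {0<..} t * t powr (\<beta> / 2 - 1) * (gauss (t + 4 ^ j) (L \<eta>) * gauss 1 \<eta>)) \<partial>lborel) \<le> ennreal (indicator {0<..} t * (t powr (\<beta> / 2 - 1) * (t + 4 ^ j) powr (- (\<alpha> / 2 + \<beta> / 2))))"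
      proof (cases "t > 0")
        case True
        have t4: "t + 4 ^ j > 0" using True by (simp add: add_pos_pos)
        have i: "integrable lborel (\<lambda>\<eta>. gauss (t + 4 ^ j) (L \<eta>) * gauss 1 \<eta>)"
          by (rule Bochner_Integration.integrable_bound[OF integrable_gauss_unit]) (use t4 in \<open>auto simp: gauss_le_1 mult_le_cancel_right1 gauss_pos intro!: AE_I2\<close>)
        have "(\<integral>\<^sup>+\<eta>. ennreal (indicator {0<..} t * t powr (\<beta> / 2 - 1) * (gauss (t + 4 ^ j) (L \<eta>) * gauss 1 \<eta>)) \<partial>lborel) = ennreal (t powr (\<beta> / 2 - 1)) * (\<integral>\<^sup>+\<eta>. ennreal (gauss (t + 4 ^ j) (L \<eta>) * gauss 1 \<eta>) \<partial>lborel)"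
          using True by (subst nn_integral_cmult[symmetric]) (auto simp: ennreal_mult'[symmetric])
        also have "(\<integral>\<^sup>+\<eta>. ennreal (gauss (t + 4 ^ j) (L \<eta>) * gauss 1 \<eta>) \<partial>lborel) = ennreal (LINT \<eta>|lborel. gauss (t + 4 ^ j) (L \<eta>) * gauss 1 \<eta>)"
          by (rule nn_integral_eq_integral[OF i]) auto
        also have "ennreal (t powr (\<beta> / 2 - 1)) * \<dots> \<le> ennreal (t powr (\<beta> / 2 - 1)) * ennreal ((t + 4 ^ j) powr (- (DIM('v) / 2)))"
          by (intro mult_left_mono ennreal_leI gauss_pullback_le[OF assms(1,2) adj L'n t4]) auto
        also have "\<dots> = ennreal (indicator {0<..} t * (t powr (\<beta> / 2 - 1) * (t + 4 ^ j) powr (- (\<alpha> / 2 + \<beta> / 2))))"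
          using True by (simp add: ennreal_mult'[symmetric] \<beta>_def add_divide_distrib[symmetric])
        finally show ?thesis .
      qed simp
    qed auto
    \<comment> \<open>The Beta integral at \<open>A = 4 ^ j\<close> yields
      \<open>2 powr (- (j * \<alpha>))\<close>, which cancels the coefficient of the
      \<open>j\<close>-th Gaussian.\<close>
    also have "\<dots> = (\<Sum>j<J. ennreal (C2 * 2 powr (real j * \<alpha>)) * ennreal (G3 * (4 ^ j) powr (- (\<alpha> / 2))))"
      using \<alpha> \<beta> by (subst nn_integral_sum) (auto simp: nn_integral_cmult nn_integral_powr_beta G3_def simp del: minus_add_distrib intro!: sum.cong)
    also have "\<dots> = (\<Sum>j<J. ennreal (C2 * G3))"
    proof (rule sum.cong[OF refl])
      fix j
      have "2 powr (real j * \<alpha>) * (4 ^ j) powr (- (\<alpha> / 2)) = 1"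
        unfolding four_power_eq_powr by (simp add: powr_powr powr_add[symmetric])
      then have "(C2 * 2 powr (real j * \<alpha>)) * (G3 * (4 ^ j) powr (- (\<alpha> / 2))) = C2 * G3"
        by (simp add: mult_ac)
      then show "ennreal (C2 * 2 powr (real j * \<alpha>)) * ennreal (G3 * (4 ^ j) powr (- (\<alpha> / 2))) = ennreal (C2 * G3)"
        using C2 G3 by (simp add: ennreal_mult'[symmetric])
    qed
    also have "\<dots> = ennreal (C2 * G3 * real J)"
      using C2 G3 by (simp add: ennreal_mult'' ennreal_of_nat_eq_real_of_nat mult.commute)
    finally show ?thesis by (simp add: E_def)
  qed
  show thesis
    by (rule that[of "C2 * G3"]) (use C2 G3 main in \<open>auto simp: \<alpha>_def\<close>)
qed

text \<open>The frequency integral, in which form \<open>T_mult\<close> is defined, becomes a double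
  convolution on the space side, where positivity can be exploited.\<close>

lemma fourier_triple:
  fixes g A N :: "'a::euclidean_space \<Rightarrow> complex"
  assumes g: "integrable lborel g" "integrable lborel (fourier g)" "continuous_on UNIV g" "\<And>x. norm (g x) \<le> D"
    and A: "integrable lborel A" and N: "integrable lborel N"
  shows "(LINT \<xi>|lborel. fourier g \<xi> * (fourier A \<xi> * fourier N \<xi>) * cis (2 * pi * (\<xi> \<bullet> p))) =
    (LINT y|lborel. N y * (LINT x|lborel. A x * g (p - y - x)))"
proof -
  have [measurable]: "g \<in> borel_measurable borel" "A \<in> borel_measurable borel" "N \<in> borel_measurable borel" using g A N by auto
  define k where "k \<xi> = fourier g \<xi> * cis (- 2 * pi * ((- p) \<bullet> \<xi>)) * fourier A \<xi>" for \<xi>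
  have k: "integrable lborel k"
    unfolding k_def
    by (rule integrable_mult_bounded[OF integrable_mult_cis[OF g(2)] _ norm_fourier_le]) measurable
  have fk: "fourier k y = (LINT x|lborel. A x * g (p - y - x))" for y
  proof -
    have "fourier k y = (LINT \<xi>|lborel. (fourier g \<xi> * cis (- 2 * pi * ((y - p) \<bullet> \<xi>))) * fourier A \<xi>)"
      unfolding fourier_def[of k]
    proof (intro Bochner_Integration.integral_cong refl)
      fix \<xi>
      have "- 2 * pi * ((- p) \<bullet> \<xi>) + - 2 * pi * (\<xi> \<bullet> y) = - 2 * pi * ((y - p) \<bullet> \<xi>)"
        by (simp add: inner_diff_left inner_commute[of \<xi>] algebra_simps)
      then have c: "cis (- 2 * pi * ((- p) \<bullet> \<xi>)) * cis (- 2 * pi * (\<xi> \<bullet> y)) = cis (- 2 * pi * ((y - p) \<bullet> \<xi>))"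
        by (simp only: cis_mult)
      show "k \<xi> * cis (- 2 * pi * (\<xi> \<bullet> y)) = (fourier g \<xi> * cis (- 2 * pi * ((y - p) \<bullet> \<xi>))) * fourier A \<xi>"
        unfolding k_def c[symmetric] by (simp only: mult_ac)
    qed
    also have "\<dots> = (LINT x|lborel. fourier (\<lambda>\<xi>. fourier g \<xi> * cis (- 2 * pi * ((y - p) \<bullet> \<xi>))) x * A x)"
      by (rule fourier_multiplication[symmetric]) (auto intro!: integrable_mult_cis g A)
    also have "\<dots> = (LINT x|lborel. A x * g (p - y - x))"
      unfolding fourier_modulated fourier_inversion[OF g] by (simp add: algebra_simps)
    finally show ?thesis .
  qed
  have "(LINT \<xi>|lborel. fourier g \<xi> * (fourier A \<xi> * fourier N \<xi>) * cis (2 * pi * (\<xi> \<bullet> p))) = (LINT \<xi>|lborel. fourier N \<xi> * k \<xi>)"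
    by (intro Bochner_Integration.integral_cong refl) (simp add: k_def inner_commute mult_ac)
  also have "\<dots> = (LINT y|lborel. N y * fourier k y)" by (rule fourier_multiplication[OF N k])
  finally show ?thesis unfolding fk .
qed

text \<open>From \<open>|q - x|^2 \<le> 2 |q|^2 + 2\<close>: moving the centre by at most one unit
  costs a constant and a doubling of the parameter. Two such moves, one for the cutoff and one for
  the smearing, produce the \<open>4 * c\<close> of the final tests.\<close>

lemma gauss_shift_ge:
  assumes "0 \<le> c" "norm x \<le> 1"
  shows "exp (- (2 * pi * c)) * gauss (2 * c) q \<le> gauss c (q - x)"
proof -
  have "(norm (q - x))\<^sup>2 \<le> (norm q + 1)\<^sup>2"
    using norm_triangle_ineq4[of q x] assms(2) by (intro power_mono) auto
  also have "\<dots> \<le> 2 * (norm q)\<^sup>2 + 2"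
    using zero_le_power2[of "norm q - 1"] by (simp add: power2_sum power2_diff)
  finally have "pi * c * (norm (q - x))\<^sup>2 \<le> pi * c * (2 * (norm q)\<^sup>2 + 2)"
    using assms(1) by (intro mult_left_mono) auto
  then show ?thesis by (simp add: gauss_def exp_add[symmetric] algebra_simps)
qed

text \<open>\<open>X\<close> is nonnegative and at least \<open>X 0 / 2\<close> on a small ball,
  where the shift lemma applies. The restriction \<open>c \<le> 1\<close> makes the constant uniform
  in \<open>c\<close>.\<close>

lemma cutoff_gauss_ge:
  fixes X :: "'a::euclidean_space \<Rightarrow> real"
  assumes X: "\<And>y. 0 \<le> X y" "continuous_on UNIV X" "X 0 > 0" "integrable lborel X"
  obtains \<kappa> where "\<kappa> > 0" "\<And>c q. 0 \<le> c \<Longrightarrow> c \<le> 1 \<Longrightarrow> \<kappa> * gauss (2 * c) q \<le> (LINT x|lborel. X x * gauss c (q - x))"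
proof -
  have [measurable]: "X \<in> borel_measurable borel" using X by auto
  have "isCont X 0" using X(2) by (simp add: continuous_on_eq_continuous_at)
  then obtain d where d: "d > 0" "\<And>x. dist x 0 < d \<Longrightarrow> dist (X x) (X 0) < X 0 / 2"
    unfolding continuous_at_eps_delta using X(3) by (metis half_gt_zero)
  define e where "e = min (d / 2) 1"
  have e: "e > 0" "e \<le> 1" "e < d" using d by (auto simp: e_def)
  have Xe: "X 0 / 2 \<le> X x" if "norm x \<le> e" for x
  proof -
    have "dist (X x) (X 0) < X 0 / 2" using d(2)[of x] that e by simp
    then show ?thesis by (simp add: dist_real_def abs_if split: if_splits)
  qed
  define \<kappa> where "\<kappa> = X 0 / 2 * exp (- (2 * pi)) * measure lborel (cball (0::'a) e)"
  have "\<kappa> > 0" unfolding \<kappa>_def using X(3) e content_cball_pos[of e "0::'a"] by simp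
  moreover have "\<kappa> * gauss (2 * c) q \<le> (LINT x|lborel. X x * gauss c (q - x))" if c: "0 \<le> c" "c \<le> 1" for c q
  proof -
    have "\<kappa> * gauss (2 * c) q = (LINT x|lborel. (X 0 / 2 * exp (- (2 * pi)) * gauss (2 * c) q) * indicator (cball (0::'a) e) x)"
      by (simp add: \<kappa>_def)
    also have "\<dots> \<le> (LINT x|lborel. X x * gauss c (q - x))"
    proof (rule integral_mono')
      show "integrable lborel (\<lambda>x. X x * gauss c (q - x))"
        by (rule integrable_mult_bounded[OF X(4), where B=1]) (use c in \<open>auto simp: gauss_le_1\<close>)
      show "0 \<le> X x * gauss c (q - x)" for x using X by simp
      show "(X 0 / 2 * exp (- (2 * pi)) * gauss (2 * c) q) * indicator (cball 0 e) x \<le> X x * gauss c (q - x)" for x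
      proof (cases "norm x \<le> e")
        case True
        have "exp (- (2 * pi)) * gauss (2 * c) q \<le> exp (- (2 * pi * c)) * gauss (2 * c) q"
          using c by (intro mult_right_mono) auto
        also have "\<dots> \<le> gauss c (q - x)" using True e c by (intro gauss_shift_ge) auto
        finally have "X 0 / 2 * (exp (- (2 * pi)) * gauss (2 * c) q) \<le> X x * gauss c (q - x)"
          using Xe[OF True] X(1,3) by (intro mult_mono) auto
        then show ?thesis using True by (simp add: mult_ac)
      qed (use X in auto)
    qed
    finally show ?thesis .
  qed
  ultimately show thesis by (rule that)
qed

text \<open>The image of the density \<open>h\<close> under \<open>L'\<close>, convolved with
  \<open>gauss 1\<close>. Its transform is that of \<open>h\<close>, pulled back by the adjoint of
  \<open>L'\<close>, times a Gaussian. The extra Gaussian keeps it an integrable function even when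
  \<open>L'\<close> has a proper subspace as its range.\<close>

definition smear :: "('v::euclidean_space \<Rightarrow> 'a::euclidean_space) \<Rightarrow> ('v \<Rightarrow> real) \<Rightarrow> 'a \<Rightarrow> real" where
  "smear L' h y = (LINT z|lborel. h z * gauss 1 (y - L' z))"

lemma smear_facts:
  fixes L' :: "'v::euclidean_space \<Rightarrow> 'a::euclidean_space"
  assumes L' [measurable]: "L' \<in> borel_measurable borel" and h: "integrable lborel h" "\<And>z. 0 \<le> h z"
  shows smear_nonneg: "0 \<le> smear L' h y"
    and smear_le: "smear L' h y \<le> (LINT z|lborel. h z)"
    and continuous_on_smear: "continuous_on UNIV (smear L' h)"
    and integrable_smear: "integrable lborel (smear L' h)"
    and fourier_smear: "\<And>L. (\<And>\<eta> z. L \<eta> \<bullet> z = \<eta> \<bullet> L' z) \<Longrightarrow>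
      fourier (\<lambda>y. of_real (smear L' h y)) \<eta> = fourier (\<lambda>z. of_real (h z)) (L \<eta>) * of_real (gauss 1 \<eta>)"
proof -
  have [measurable]: "h \<in> borel_measurable borel" using h by auto
  have hc: "integrable lborel (\<lambda>z. complex_of_real (h z))" using h by simp
  show "0 \<le> smear L' h y" unfolding smear_def using h by (intro integral_nonneg_AE AE_I2) auto
  have "integrable lborel (\<lambda>z. h z * gauss 1 (y - L' z))" for y
    by (rule integrable_mult_bounded[OF h(1), where B=1]) (auto simp: gauss_le_1)
  then show "smear L' h y \<le> (LINT z|lborel. h z)"
    unfolding smear_def using h by (intro integral_mono) (auto simp: gauss_le_1 mult_left_le)
  have eq: "complex_of_real (smear L' h y) = (LINT z|lborel. of_real (h z) * of_real (gauss 1 (y - L' z)))" for y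
    by (simp add: smear_def flip: of_real_mult)
  have "continuous_on UNIV (\<lambda>y. LINT z|lborel. complex_of_real (h z) * of_real (gauss 1 (y - L' z)))"
    by (rule continuous_on_dominated_integral[OF hc, where D=1]) (auto intro!: continuous_intros simp: gauss_le_1)
  then have "continuous_on UNIV (\<lambda>y. Re (complex_of_real (smear L' h y)))" unfolding eq by (rule continuous_on_Re)
  then show "continuous_on UNIV (smear L' h)" by simp
  define \<Phi> where "\<Phi> = (\<lambda>y::'a. (1::complex) * (LINT z|lborel. complex_of_real (h z) * (of_real (1 / 1 ^ DIM('a)) * of_real (gauss 1 ((1 / 1) *\<^sub>R (y - L' z))))))"
  have \<Phi>: "\<Phi> = (\<lambda>y. of_real (smear L' h y))" unfolding \<Phi>_def eq by simp
  have gi: "integrable lborel (gauss 1 :: 'a \<Rightarrow> real)" by (rule integrable_gauss_unit)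
  have "integrable lborel \<Phi>"
    unfolding \<Phi>_def
    by (rule superposition_integrable[OF sigma_finite_lborel, where B="\<lambda>_. 1" and h="gauss 1" and \<omega>="\<lambda>_. 1" and N="\<lambda>y. of_real (gauss 1 y)" and r=1])
       (use h gi in auto)
  then show "integrable lborel (smear L' h)" unfolding \<Phi> complex_of_real_integrable_eq .
  fix L :: "'a \<Rightarrow> 'v" assume adj: "\<And>\<eta> z. L \<eta> \<bullet> z = \<eta> \<bullet> L' z"
  have "fourier \<Phi> \<eta> = (LINT z|lborel. of_real (h z) * (cis (- 2 * pi * (L' z \<bullet> \<eta>)) * fourier (\<lambda>y. 1 * of_real (gauss 1 y)) (1 *\<^sub>R \<eta>)))"
    unfolding \<Phi>_def
    by (rule superposition_fourier[OF sigma_finite_lborel, where B="\<lambda>_. 1" and h="gauss 1" and \<omega>="\<lambda>_. 1" and N="\<lambda>y. of_real (gauss 1 y)" and r=1])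
       (use h gi in auto)
  also have "\<dots> = (LINT z|lborel. (of_real (h z) * cis (- 2 * pi * (z \<bullet> L \<eta>))) * of_real (gauss 1 \<eta>))"
  proof (intro Bochner_Integration.integral_cong refl)
    fix z
    have "L' z \<bullet> \<eta> = z \<bullet> L \<eta>" using adj[of \<eta> z] by (simp add: inner_commute)
    then show "of_real (h z) * (cis (- 2 * pi * (L' z \<bullet> \<eta>)) * fourier (\<lambda>y. 1 * of_real (gauss 1 y)) (1 *\<^sub>R \<eta>)) = (of_real (h z) * cis (- 2 * pi * (z \<bullet> L \<eta>))) * of_real (gauss 1 \<eta>)"
      by (simp add: fourier_gauss_unit(2))
  qed
  finally show "fourier (\<lambda>y. of_real (smear L' h y)) \<eta> = fourier (\<lambda>z. of_real (h z)) (L \<eta>) * of_real (gauss 1 \<eta>)"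
    unfolding \<Phi> by (simp add: fourier_def)
qed

text \<open>Undoes the smearing from below by restricting \<open>y\<close> to the unit ball about
  \<open>L' z\<close>. There the Gaussian of the smear is at least \<open>exp (- pi)\<close>, the
  weight at most \<open>(4 * pi * (1 + norm (L' z))) powr s\<close>, and the outer Gaussian is
  controlled by the shift lemma; \<open>\<kappa>\<close> multiplies these losses with the volume of
  the ball.\<close>

lemma smear_weighted_ge:
  fixes L' :: "'v::euclidean_space \<Rightarrow> 'a::euclidean_space"
  assumes L' [measurable]: "L' \<in> borel_measurable borel" and s: "s \<ge> 0"
  obtains \<kappa> where "\<kappa> > 0"
    "\<And>h c p. integrable lborel h \<Longrightarrow> (\<And>z. 0 \<le> h z) \<Longrightarrow> 0 < c \<Longrightarrow> c \<le> 1 \<Longrightarrow>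
      \<kappa> * (LINT z|lborel. h z * ((1 + norm (L' z)) powr (- s) * gauss (4 * c) (p - L' z))) \<le>
      (LINT y|lborel. smear L' h y / norm (bessel_weight s y) * gauss (2 * c) (p - y))"
proof -
  define \<kappa> where "\<kappa> = exp (- pi) * (4 * pi) powr (- s) * exp (- (4 * pi)) * measure lborel (cball (0::'a) 1)"
  have "\<kappa> > 0" unfolding \<kappa>_def using content_cball_pos[of 1 "0::'a"] by simp
  moreover have "\<kappa> * (LINT z|lborel. h z * ((1 + norm (L' z)) powr (- s) * gauss (4 * c) (p - L' z))) \<le>
      (LINT y|lborel. smear L' h y / norm (bessel_weight s y) * gauss (2 * c) (p - y))"
    if h: "integrable lborel h" "\<And>z. 0 \<le> h z" and c: "0 < c" "c \<le> 1" for h c p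
  proof -
    have [measurable]: "h \<in> borel_measurable borel" using h by auto
    define b where "b y = norm (bessel_weight s y)" for y :: 'a
    have [measurable]: "b \<in> borel_measurable borel" unfolding b_def by measurable
    have b1: "1 \<le> b y" for y unfolding b_def using bessel_weight_nz(1)[OF s] .
    have b0: "0 < b y" for y using b1[of y] by simp
    define F where "F z y = h z * (gauss 1 (y - L' z) / b y * gauss (2 * c) (p - y))" for z y
    have gi: "integrable lborel (\<lambda>y. gauss (2 * c) (p - y))"
      using integrable_lborel_affine_iff[of "-1" "gauss (2 * c) :: 'a \<Rightarrow> real" p] integrable_gauss[of "2 * c", where 'a='a] c by simp
    have Fm [measurable]: "(\<lambda>(z, y). F z y) \<in> borel_measurable (lborel \<Otimes>\<^sub>M lborel)"
      unfolding F_def gauss_def by measurable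
    have Fb: "norm (F z y) \<le> h z * gauss (2 * c) (p - y)" for z y
    proof -
      have "gauss 1 (y - L' z) / b y \<le> 1"
        using gauss_le_1[of 1 "y - L' z"] b1[of y] b0[of y] by (simp add: divide_le_eq)
      then have "gauss 1 (y - L' z) / b y * gauss (2 * c) (p - y) \<le> 1 * gauss (2 * c) (p - y)" by (intro mult_right_mono) auto
      then have "h z * (gauss 1 (y - L' z) / b y * gauss (2 * c) (p - y)) \<le> h z * gauss (2 * c) (p - y)"
        using h(2) by (intro mult_left_mono) auto
      then show ?thesis unfolding F_def using h(2)[of z] b0[of y] by (simp add: abs_mult less_imp_le)
    qed
    have "(LINT y|lborel. smear L' h y / b y * gauss (2 * c) (p - y)) = (LINT y|lborel. (LINT z|lborel. F z y))"
    proof (intro Bochner_Integration.integral_cong refl)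
      fix y
      have "(LINT z|lborel. F z y) = (LINT z|lborel. h z * gauss 1 (y - L' z) * (gauss (2 * c) (p - y) / b y))"
        by (intro Bochner_Integration.integral_cong refl) (simp add: F_def)
      then show "smear L' h y / b y * gauss (2 * c) (p - y) = (LINT z|lborel. F z y)" by (simp add: smear_def)
    qed
    also have "\<dots> = (LINT z|lborel. (LINT y|lborel. F z y))"
      by (rule Fubini_dominated_eq[OF sigma_finite_lborel sigma_finite_lborel Fm h(1) gi Fb, symmetric])
    also have "\<dots> \<ge> (LINT z|lborel. h z * (\<kappa> * ((1 + norm (L' z)) powr (- s) * gauss (4 * c) (p - L' z))))"
    proof (rule integral_mono)
      show "integrable lborel (\<lambda>z. LINT y|lborel. F z y)"
        by (rule Fubini_dominated_fst[OF sigma_finite_lborel sigma_finite_lborel Fm h(1) gi Fb])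
      show "integrable lborel (\<lambda>z. h z * (\<kappa> * ((1 + norm (L' z)) powr (- s) * gauss (4 * c) (p - L' z))))"
      proof (rule integrable_mult_bounded[OF h(1), where B="\<kappa>"])
        fix z
        have "(1 + norm (L' z)) powr (- s) \<le> 1" using s by (simp add: powr_minus inverse_le_1_iff ge_one_powr_ge_zero)
        then have "(1 + norm (L' z)) powr (- s) * gauss (4 * c) (p - L' z) \<le> 1 * 1"
          using c by (intro mult_mono gauss_le_1) auto
        then show "norm (\<kappa> * ((1 + norm (L' z)) powr (- s) * gauss (4 * c) (p - L' z))) \<le> \<kappa>"
          using \<open>\<kappa> > 0\<close> by (simp add: abs_mult mult_left_le)
      qed measurable
      fix z
      define w where "w = L' z"
      have "h z * (\<kappa> * ((1 + norm w) powr (- s) * gauss (4 * c) (p - w))) =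
        (LINT y|lborel. h z * (exp (- pi) * ((4 * pi) powr (- s) * (1 + norm w) powr (- s)) * (exp (- (4 * pi)) * gauss (4 * c) (p - w))) * indicator (cball w 1) y)"
      proof -
        have "measure lborel (cball w 1) = measure lborel (cball (0::'a) 1)" by (simp add: content_cball)
        then show ?thesis by (simp add: \<kappa>_def)
      qed
      also have "\<dots> \<le> (LINT y|lborel. F z y)"
      proof (rule integral_mono')
        show "integrable lborel (F z)"
          by (rule Bochner_Integration.integrable_bound[OF integrable_mult_right[OF gi, of "h z"]])
             (use Fb[of z] h(2)[of z] in \<open>auto simp: F_def abs_mult intro!: AE_I2\<close>)
        show "0 \<le> F z y" for y unfolding F_def using h(2)[of z] b0[of y] by (simp add: less_imp_le)
        show "h z * (exp (- pi) * ((4 * pi) powr (- s) * (1 + norm w) powr (- s)) * (exp (- (4 * pi)) * gauss (4 * c) (p - w))) * indicator (cball w 1) y \<le> F z y" for y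
        proof (cases "y \<in> cball w 1")
          case True
          then have n: "norm (y - w) \<le> 1" by (simp add: dist_norm norm_minus_commute)
          have g1: "exp (- pi) \<le> gauss 1 (y - w)"
            using power_mono[OF n norm_ge_zero, of 2] by (simp add: gauss_def mult_left_le)
          have "norm y \<le> 1 + norm w" using norm_triangle_ineq2[of y w] n by linarith
          then have "1 + norm y \<le> 2 + norm w" by simp
          also have "\<dots> \<le> 2 * (1 + norm w)" by simp
          finally have "2 * pi * (1 + norm y) \<le> 2 * pi * (2 * (1 + norm w))" by (intro mult_left_mono) auto
          then have "2 * pi * (1 + norm y) \<le> 4 * pi * (1 + norm w)" by simp
          then have "(2 * pi * (1 + norm y)) powr s \<le> (4 * pi * (1 + norm w)) powr s" using s by (intro powr_mono2) auto
          with bessel_weight_le_powr[OF s, of y] have "b y \<le> (4 * pi * (1 + norm w)) powr s" unfolding b_def by simp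
          then have "inverse ((4 * pi * (1 + norm w)) powr s) \<le> inverse (b y)" using b0[of y] by (intro le_imp_inverse_le) auto
          then have g2: "(4 * pi) powr (- s) * (1 + norm w) powr (- s) \<le> 1 / b y"
            by (simp add: powr_mult powr_minus inverse_eq_divide)
          have "exp (- (4 * pi)) * gauss (4 * c) (p - w) \<le> exp (- (2 * pi * (2 * c))) * gauss (2 * (2 * c)) (p - w)"
            using c by (intro mult_mono) auto
          also have "\<dots> \<le> gauss (2 * c) ((p - w) - (y - w))" using c n by (intro gauss_shift_ge) auto
          finally have g3: "exp (- (4 * pi)) * gauss (4 * c) (p - w) \<le> gauss (2 * c) (p - y)" by simp
          have "exp (- pi) * ((4 * pi) powr (- s) * (1 + norm w) powr (- s)) * (exp (- (4 * pi)) * gauss (4 * c) (p - w)) \<le> gauss 1 (y - w) * (1 / b y) * gauss (2 * c) (p - y)"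
            using b0[of y] by (intro mult_mono g1 g2 g3) auto
          from mult_left_mono[OF this h(2)[of z]] show ?thesis using True by (simp add: F_def w_def)
        next
          case False
          then show ?thesis unfolding F_def using h(2)[of z] b0[of y] by (simp add: less_imp_le)
        qed
      qed
      finally show "h z * (\<kappa> * ((1 + norm (L' z)) powr (- s) * gauss (4 * c) (p - L' z))) \<le> (LINT y|lborel. F z y)"
        by (simp add: w_def)
    qed
    finally have "(LINT z|lborel. h z * (\<kappa> * ((1 + norm (L' z)) powr (- s) * gauss (4 * c) (p - L' z)))) \<le> (LINT y|lborel. smear L' h y / b y * gauss (2 * c) (p - y))" .
    moreover have "(LINT z|lborel. h z * (\<kappa> * ((1 + norm (L' z)) powr (- s) * gauss (4 * c) (p - L' z)))) = \<kappa> * (LINT z|lborel. h z * ((1 + norm (L' z)) powr (- s) * gauss (4 * c) (p - L' z)))"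
      unfolding Bochner_Integration.integral_mult_right_zero[symmetric]
      by (intro Bochner_Integration.integral_cong refl) (simp only: mult_ac)
    ultimately show ?thesis by (simp add: b_def)
  qed
  ultimately show thesis by (rule that)
qed

text \<open>The coefficients make the transform a sum of
  \<open>2 powr (j k / u) * gauss (4 ^ j)\<close> with \<open>k\<close> the dimension: Gaussians of
  width \<open>2^-j\<close>, each with \<open>L^u\<close> norm independent of
  \<open>j\<close>.\<close>

definition dyadic :: "real \<Rightarrow> nat \<Rightarrow> 'v::euclidean_space \<Rightarrow> real" where
  "dyadic u J z = (\<Sum>j<J. 2 powr (real j * (DIM('v) / u - DIM('v))) * gauss (1 / 4 ^ j) z)"

lemma dyadic_facts:
  shows dyadic_nonneg: "0 \<le> dyadic u J (z :: 'v::euclidean_space)"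
    and integrable_dyadic: "integrable lborel (dyadic u J :: 'v \<Rightarrow> real)"
    and fourier_dyadic: "fourier (\<lambda>z. of_real (dyadic u J z)) w = of_real (\<Sum>j<J. 2 powr (real j * (DIM('v) / u)) * gauss (4 ^ j) (w::'v))"
proof -
  show "0 \<le> dyadic u J z" unfolding dyadic_def by (intro sum_nonneg) auto
  show "integrable lborel (dyadic u J :: 'v \<Rightarrow> real)"
    unfolding dyadic_def[abs_def] by (intro Bochner_Integration.integrable_sum integrable_mult_right integrable_gauss) auto
  let ?c = "\<lambda>j. 2 powr (real j * (DIM('v) / u - DIM('v)))"
  have gi: "integrable lborel (\<lambda>z::'v. complex_of_real (gauss (1 / 4 ^ j) z))" for j
    using integrable_gauss[of "1 / 4 ^ j", where 'a='v] by simp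
  have "fourier (\<lambda>z. of_real (dyadic u J z)) w = (LINT z|lborel. (\<Sum>j<J. of_real (?c j) * (of_real (gauss (1 / 4 ^ j) z) * cis (- 2 * pi * (z \<bullet> w)))))"
    unfolding fourier_def dyadic_def of_real_sum of_real_mult sum_distrib_right
    by (intro Bochner_Integration.integral_cong refl sum.cong) (simp only: mult.assoc)
  also have "\<dots> = (\<Sum>j<J. of_real (?c j) * fourier (\<lambda>z. of_real (gauss (1 / 4 ^ j) z)) w)"
    unfolding fourier_def
    by (subst Bochner_Integration.integral_sum)
       (auto intro!: integrable_mult_right integrable_mult_cis gi simp del: of_real_power of_real_divide)
  also have "\<dots> = of_real (\<Sum>j<J. 2 powr (real j * (DIM('v) / u)) * gauss (4 ^ j) w)"
    unfolding of_real_sum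
  proof (rule sum.cong[OF refl])
    fix j
    have "(1 / 4 ^ j) powr (- (real DIM('v) / 2)) = 2 powr (real j * DIM('v))"
      using four_power_eq_powr[of j] by (simp add: powr_minus powr_divide powr_powr inverse_eq_divide)
    then have "?c j * (1 / 4 ^ j) powr (- (real DIM('v) / 2)) = 2 powr (real j * (DIM('v) / u))"
      by (simp add: powr_add[symmetric] algebra_simps)
    moreover have "fourier (\<lambda>z. of_real (gauss (1 / 4 ^ j) z)) w = of_real ((1 / 4 ^ j) powr (- (real DIM('v) / 2)) * gauss (4 ^ j) w)"
      by (subst fourier_gauss) auto
    ultimately show "of_real (?c j) * fourier (\<lambda>z. of_real (gauss (1 / 4 ^ j) z)) w = complex_of_real (2 powr (real j * (DIM('v) / u)) * gauss (4 ^ j) w)"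
      by (simp only: of_real_mult[symmetric] mult.assoc[symmetric])
  qed
  finally show "fourier (\<lambda>z. of_real (dyadic u J z)) w = of_real (\<Sum>j<J. 2 powr (real j * (DIM('v) / u)) * gauss (4 ^ j) w)" .
qed

section \<open>Testing the multilinear operator\<close>

text \<open>Adjoint to summing the blocks, which is why the phase of \<open>T_mult\<close> reads
  \<open>\<xi> \<bullet> diag x\<close>.\<close>

definition diag :: "'a \<Rightarrow> 'a^'l" where
  "diag x = (\<chi> i. x)"

lemma diag_nth [simp]: "diag x $ i = x"
  by (simp add: diag_def)

lemma inner_diag: "\<xi> \<bullet> diag x = (\<Sum>i\<in>UNIV. \<xi> $ i) \<bullet> x"
  for \<xi> :: "('a::real_inner)^'l"
  by (simp add: inner_vec_def inner_sum_left)

lemma norm_vec_power2: "(norm x)\<^sup>2 = (\<Sum>i\<in>UNIV. (norm (x $ i))\<^sup>2)"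
  by (simp add: norm_vec_def L2_set_def sum_nonneg)

lemma norm_diag: "norm (diag x :: 'a::real_normed_vector^'l) = sqrt CARD('l) * norm x"
  by (simp add: norm_vec_def L2_set_def real_sqrt_mult)

lemma diag_diff: "diag x - diag y = (diag (x - y) :: 'a::group_add^'l)"
  by (simp add: vec_eq_iff)

lemma diag_measurable [measurable]: "diag \<in> borel_measurable borel"
  unfolding diag_def by (intro borel_measurable_continuous_onI continuous_intros)

lemma gauss_vec_eq_prod: "gauss c (x :: real^'n^'l) = (\<Prod>i\<in>UNIV. gauss c (x $ i))"
  by (simp add: gauss_def exp_sum[symmetric] norm_vec_power2 sum_distrib_left sum_negf)

text \<open>Gaussians factor over the blocks of \<open>\<xi>\<close>, so the separate inputs merge
  into a single Gaussian on the product space.\<close>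

lemma prod_fourier_mgauss:
  fixes a \<xi> :: "real^'n^'l"
  assumes "c > 0"
  shows "(\<Prod>i\<in>UNIV. fourier (mgauss (a $ i) c) (\<xi> $ i)) = fourier (mgauss a c) \<xi>"
proof -
  have "(\<Prod>i\<in>(UNIV::'l set). c powr (- (DIM(real^'n) / 2))) = c powr (- (DIM(real^'n^'l) / 2))"
    using assms by (simp add: powr_power)
  then have "(\<Prod>i\<in>(UNIV::'l set). c powr (- (DIM(real^'n) / 2)) * gauss (1 / c) (\<xi> $ i - a $ i)) = c powr (- (DIM(real^'n^'l) / 2)) * gauss (1 / c) (\<xi> - a)"
    unfolding prod.distrib gauss_vec_eq_prod[of _ "\<xi> - a"] vector_minus_component by (simp only:)
  then show ?thesis unfolding fourier_mgauss[OF assms] of_real_prod[symmetric] by (simp only:)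
qed

lemma mgauss_facts:
  fixes a :: "'a::euclidean_space"
  assumes c: "c > 0"
  shows integrable_mgauss: "integrable lborel (mgauss a c)"
    and integrable_fourier_mgauss: "integrable lborel (fourier (mgauss a c))"
    and continuous_on_mgauss: "continuous_on UNIV (mgauss a c)"
    and norm_mgauss: "norm (mgauss a c x) = gauss c x"
proof -
  show "integrable lborel (mgauss a c)"
    unfolding mgauss_def[abs_def] using integrable_gauss[OF c, where 'a='a] by (intro integrable_mult_cis) auto
  have "integrable lborel (\<lambda>\<xi>::'a. gauss (1 / c) (- a + 1 *\<^sub>R \<xi>))"
    using integrable_gauss[of "1 / c", where 'a='a] c by (subst integrable_lborel_affine_iff) auto
  then have "integrable lborel (\<lambda>\<xi>. c powr (- (DIM('a) / 2)) * gauss (1 / c) (\<xi> - a))"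
    by (intro integrable_mult_right) simp
  then have "integrable lborel (\<lambda>\<xi>. complex_of_real (c powr (- (DIM('a) / 2)) * gauss (1 / c) (\<xi> - a)))"
    unfolding complex_of_real_integrable_eq .
  moreover have "fourier (mgauss a c) = (\<lambda>\<xi>. of_real (c powr (- (DIM('a) / 2)) * gauss (1 / c) (\<xi> - a)))"
    by (rule ext) (rule fourier_mgauss[OF c])
  ultimately show "integrable lborel (fourier (mgauss a c))" by simp
  show "continuous_on UNIV (mgauss a c)" unfolding mgauss_def by (intro continuous_intros)
  show "norm (mgauss a c x) = gauss c x" by (simp add: mgauss_def norm_mult)
qed

lemma lp_norm_mgauss:
  fixes a :: "'a::euclidean_space"
  assumes c: "c > 0" and q: "q > 0"
  shows "lp_norm q (mgauss a c) = ennreal ((c * q) powr (- (DIM('a) / 2) / q))"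
proof -
  have "norm (mgauss a c x) powr q = gauss (c * q) x" for x
    by (simp add: norm_mgauss[OF c] gauss_def powr_def mult_ac)
  then have "lp_mass q (mgauss a c) = (\<integral>\<^sup>+x. ennreal (gauss (c * q) (x::'a)) \<partial>lborel)"
    by (simp add: lp_mass_def)
  also have "\<dots> = ennreal (LINT x|lborel. gauss (c * q) (x::'a))"
    using c q by (intro nn_integral_eq_integral integrable_gauss) auto
  also have "(LINT x|lborel. gauss (c * q) (x::'a)) = (c * q) powr (- (DIM('a) / 2))"
  proof -
    have "complex_of_real (LINT x|lborel. gauss (c * q) (x::'a)) = of_real ((c * q) powr (- (DIM('a) / 2)))"
      using fourier_gauss[of "c * q" "0::'a"] c q by (simp add: fourier_def gauss_def)
    then show ?thesis by (simp only: of_real_eq_iff)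
  qed
  finally show ?thesis using c q by (simp add: lp_norm_eq_lp_mass powr_powr)
qed

lemma lp_mass_le_of_lp_norm_le:
  assumes "lp_norm p g \<le> ennreal B" "B \<ge> 0" "p > 0"
  shows "lp_mass p g \<le> ennreal (B powr p)"
proof -
  have fin: "lp_mass p g \<noteq> \<infinity>" using assms(1) by (auto simp: lp_norm_eq_lp_mass top_unique split: if_splits)
  then have "enn2real (lp_mass p g) powr (1 / p) \<le> B"
    using assms(1,2) by (simp add: lp_norm_eq_lp_mass)
  then have "(enn2real (lp_mass p g) powr (1 / p)) powr p \<le> B powr p"
    using assms by (intro powr_mono2) auto
  then have "enn2real (lp_mass p g) \<le> B powr p" using assms(3) by (simp add: powr_powr)
  then have "ennreal (enn2real (lp_mass p g)) \<le> ennreal (B powr p)" by (rule ennreal_leI)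
  moreover have "ennreal (enn2real (lp_mass p g)) = lp_mass p g"
    by (rule ennreal_enn2real) (use fin in \<open>simp add: less_top\<close>)
  ultimately show ?thesis by (simp only:)
qed

text \<open>Input, cutoff and the Bessel factor carry the same character, so the phases in the
  convolution add up to that of \<open>a \<bullet> diag x\<close>, independently of the integration
  variables. What is left under the integral is real and, for nonnegative \<open>X\<close> and
  \<open>S\<close>, nonnegative.\<close>

lemma T_mult_mgauss:
  fixes a :: "real^'n^'l" and X S :: "real^'n^'l \<Rightarrow> real"
  assumes c: "c > 0" and s: "s \<ge> 0" and X: "integrable lborel X" and S: "integrable lborel S"
  shows "T_mult (\<lambda>\<xi>. fourier (\<lambda>x. of_real (X x) * cis (2 * pi * (a \<bullet> x))) \<xi> *
      fourier (\<lambda>y. of_real (S y) * cis (2 * pi * (a \<bullet> y)) / bessel_weight s y) \<xi>) (\<lambda>i. mgauss (a $ i) c) x =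
    cis (2 * pi * (a \<bullet> diag x)) * of_real (LINT y|lborel. S y / norm (bessel_weight s y) * (LINT x'|lborel. X x' * gauss c (diag x - y - x')))"
proof -
  have [measurable]: "X \<in> borel_measurable borel" "S \<in> borel_measurable borel" using X S by auto
  let ?A = "\<lambda>x. complex_of_real (X x) * cis (2 * pi * (a \<bullet> x))"
  let ?N = "\<lambda>y. of_real (S y) * cis (2 * pi * (a \<bullet> y)) / bessel_weight s y"
  have A: "integrable lborel ?A" using X by (intro integrable_mult_cis) auto
  have N: "integrable lborel ?N"
  proof (rule Bochner_Integration.integrable_bound[OF S])
    show "AE y in lborel. norm (?N y) \<le> norm (S y)"
    proof (rule AE_I2)
      fix y :: "real^'n^'l"
      have "\<bar>S y\<bar> * 1 \<le> \<bar>S y\<bar> * norm (bessel_weight s y)"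
        by (intro mult_left_mono bessel_weight_nz(1) s) auto
      moreover have "0 < norm (bessel_weight s y)" using bessel_weight_nz(2)[of s y] by simp
      ultimately show "norm (?N y) \<le> norm (S y)"
        by (simp only: norm_divide norm_mult norm_of_real norm_cis) (simp add: divide_le_eq)
    qed
  qed measurable
  have b: "bessel_weight s y = of_real (norm (bessel_weight s y))" for y :: "real^'n^'l"
    by (simp add: bessel_weight_def)
  have "T_mult (\<lambda>\<xi>. fourier ?A \<xi> * fourier ?N \<xi>) (\<lambda>i. mgauss (a $ i) c) x =
      (LINT \<xi>|lborel. fourier (mgauss a c) \<xi> * (fourier ?A \<xi> * fourier ?N \<xi>) * cis (2 * pi * (\<xi> \<bullet> diag x)))"
    unfolding T_mult_def prod_fourier_mgauss[OF c] inner_diag by (simp only: inner_commute[of x])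
  also have "\<dots> = (LINT y|lborel. ?N y * (LINT x'|lborel. ?A x' * mgauss a c (diag x - y - x')))"
    using c by (intro fourier_triple[where D=1] integrable_mgauss integrable_fourier_mgauss continuous_on_mgauss A N)
      (auto simp: norm_mgauss gauss_le_1)
  also have "\<dots> = (LINT y|lborel. cis (2 * pi * (a \<bullet> diag x)) * of_real (S y / norm (bessel_weight s y) * (LINT x'|lborel. X x' * gauss c (diag x - y - x'))))"
  proof (intro Bochner_Integration.integral_cong refl)
    fix y :: "real^'n^'l"
    have "(LINT x'|lborel. ?A x' * mgauss a c (diag x - y - x')) = (LINT x'|lborel. cis (2 * pi * (a \<bullet> (diag x - y))) * of_real (X x' * gauss c (diag x - y - x')))"
    proof (intro Bochner_Integration.integral_cong refl)
      fix x' :: "real^'n^'l"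
      have "2 * pi * (a \<bullet> x') + 2 * pi * (a \<bullet> (diag x - y - x')) = 2 * pi * (a \<bullet> (diag x - y))"
        by (simp add: inner_diff_right algebra_simps)
      then have cc: "cis (2 * pi * (a \<bullet> x')) * cis (2 * pi * (a \<bullet> (diag x - y - x'))) = cis (2 * pi * (a \<bullet> (diag x - y)))"
        by (simp only: cis_mult)
      show "?A x' * mgauss a c (diag x - y - x') = cis (2 * pi * (a \<bullet> (diag x - y))) * of_real (X x' * gauss c (diag x - y - x'))"
        unfolding mgauss_def cc[symmetric] of_real_mult by (simp only: mult_ac)
    qed
    also have "\<dots> = cis (2 * pi * (a \<bullet> (diag x - y))) * of_real (LINT x'|lborel. X x' * gauss c (diag x - y - x'))"
      by (simp only: Bochner_Integration.integral_mult_right_zero integral_complex_of_real)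
    finally have i: "(LINT x'|lborel. ?A x' * mgauss a c (diag x - y - x')) = cis (2 * pi * (a \<bullet> (diag x - y))) * of_real (LINT x'|lborel. X x' * gauss c (diag x - y - x'))" .
    have "2 * pi * (a \<bullet> y) + 2 * pi * (a \<bullet> (diag x - y)) = 2 * pi * (a \<bullet> diag x)"
      by (simp add: inner_diff_right algebra_simps)
    then have cc: "cis (2 * pi * (a \<bullet> y)) * cis (2 * pi * (a \<bullet> (diag x - y))) = cis (2 * pi * (a \<bullet> diag x))"
      by (simp only: cis_mult)
    show "?N y * (LINT x'|lborel. ?A x' * mgauss a c (diag x - y - x')) = cis (2 * pi * (a \<bullet> diag x)) * of_real (S y / norm (bessel_weight s y) * (LINT x'|lborel. X x' * gauss c (diag x - y - x')))"
      unfolding i cc[symmetric] of_real_mult of_real_divide b[symmetric] by (simp only: divide_inverse mult_ac)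
  qed
  also have "\<dots> = cis (2 * pi * (a \<bullet> diag x)) * of_real (LINT y|lborel. S y / norm (bessel_weight s y) * (LINT x'|lborel. X x' * gauss c (diag x - y - x')))"
    by (simp only: Bochner_Integration.integral_mult_right_zero integral_complex_of_real)
  finally show ?thesis .
qed

text \<open>Reduces the hypothesis to an inequality between nonnegative functions. The multiplier
  carries \<open>dyadic u J\<close> transported by \<open>L'\<close>; the inputs are modulated
  Gaussians of parameter \<open>c\<close>, whose norms multiply to a constant times
  \<open>c powr (- (n / 2) / p)\<close>. Leaving \<open>J\<close>, \<open>c\<close> and
  \<open>L\<close> free lets both necessary conditions come from one computation;
  \<open>\<kappa>\<close> and \<open>D\<close> must not depend on \<open>J\<close> and
  \<open>c\<close>.\<close>

lemma test_bound:
  fixes \<Theta> :: "real^'n^'l \<Rightarrow> complex" and pp :: "'l \<Rightarrow> real" and p u s :: real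
    and L :: "real^'n^'l \<Rightarrow> 'v::euclidean_space" and L' :: "'v \<Rightarrow> real^'n^'l"
  assumes \<Theta>: "schwartz \<Theta>" and supp: "\<And>\<xi>. fourier \<Theta> \<xi> \<noteq> 0 \<Longrightarrow> 1/2 \<le> norm \<xi> \<and> norm \<xi> \<le> 2"
    and pp: "\<And>i. 0 < pp i" and p_def: "1 / p = (\<Sum>i\<in>UNIV. 1 / pp i)" and p: "p > 0"
    and u: "1 < u" and s: "0 < s"
    and bound: "\<And>m f. m \<in> borel_measurable lborel \<Longrightarrow> bounded (range m) \<Longrightarrow> A_norm \<Theta> u s m < \<infinity> \<Longrightarrow> (\<forall>i. schwartz (f i)) \<Longrightarrow>
        lp_norm p (T_mult m f) \<le> ennreal C * A_norm \<Theta> u s m * (\<Prod>i\<in>UNIV. lp_norm (pp i) (f i))"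
    and Lm [measurable]: "L \<in> borel_measurable borel" "L' \<in> borel_measurable borel"
    and adj: "\<And>\<eta> z. L \<eta> \<bullet> z = \<eta> \<bullet> L' z" and L'n: "\<And>z. norm z \<le> norm (L' z)"
  obtains \<kappa> D where "\<kappa> > 0" "D \<ge> 0"
    "\<And>J c. 0 < c \<Longrightarrow> c \<le> 1 \<Longrightarrow>
      (\<integral>\<^sup>+x. ennreal ((\<kappa> * (LINT z|lborel. dyadic u J z * ((1 + norm (L' z)) powr (- s) * gauss (4 * c) (diag x - L' z)))) powr p) \<partial>lborel)
        \<le> ennreal ((D * real J powr (1 / u) * c powr (- (CARD('n) / 2) / p)) powr p)"
proof -
  have s0: "s \<ge> 0" and u1: "u \<ge> 1" using s u by auto
  obtain X :: "real^'n^'l \<Rightarrow> real" and K where X: "\<And>y. 0 \<le> X y" "continuous_on UNIV X" "X 0 > 0" "integrable lborel X" and K: "K \<ge> 0"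
    and AK: "\<And>a H S D. norm a = 1 \<Longrightarrow> integrable lborel H \<Longrightarrow> continuous_on UNIV H \<Longrightarrow> (\<And>y. norm (H y) \<le> D) \<Longrightarrow>
      integrable lborel (fourier H) \<Longrightarrow> lp_mass u (fourier H) \<le> ennreal S \<Longrightarrow> S \<ge> 0 \<Longrightarrow>
      A_norm \<Theta> u s (\<lambda>\<xi>. fourier (\<lambda>x. of_real (X x) * cis (2 * pi * (a \<bullet> x))) \<xi> * fourier (\<lambda>y. H y / bessel_weight s y) \<xi>)
        \<le> ennreal (K * S powr (1 / u))"
    using A_norm_bound[OF \<Theta> supp u1 s0] by blast
  obtain C1 where C1: "C1 \<ge> 0" "\<And>J. lp_mass u (\<lambda>\<eta>. of_real ((\<Sum>j<J. 2 powr (real j * (DIM('v) / u)) * gauss (4 ^ j) (L \<eta>)) * gauss 1 \<eta>)) \<le> ennreal (C1 * real J)"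
    using dyadic_gauss_mass_le[of L L' u] adj L'n u by auto
  obtain \<kappa>1 where \<kappa>1: "\<kappa>1 > 0" "\<And>c q. 0 \<le> c \<Longrightarrow> c \<le> 1 \<Longrightarrow> \<kappa>1 * gauss (2 * c) q \<le> (LINT x|lborel. X x * gauss c (q - x))"
    using cutoff_gauss_ge[OF X] by blast
  obtain \<kappa>2 where \<kappa>2: "\<kappa>2 > 0" "\<And>h c p. integrable lborel h \<Longrightarrow> (\<And>z. 0 \<le> h z) \<Longrightarrow> 0 < c \<Longrightarrow> c \<le> 1 \<Longrightarrow>
      \<kappa>2 * (LINT z|lborel. h z * ((1 + norm (L' z)) powr (- s) * gauss (4 * c) (p - L' z))) \<le>
      (LINT y|lborel. smear L' h y / norm (bessel_weight s y) * gauss (2 * c) (p - y))"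
    using smear_weighted_ge[of L' s] s0 by auto
  \<comment> \<open>Any unit vector serves; the cutoff sits in the ball of radius 1/2 around
    it.\<close>
  obtain a :: "real^'n^'l" where "a \<in> Basis" using nonempty_Basis by blast
  then have a: "norm a = 1" by simp
  define P where "P = (\<Prod>i\<in>UNIV. pp i powr (- (CARD('n) / 2) / pp i))"
  \<comment> \<open>The constant in the hypothesis is an arbitrary real that \<open>ennreal\<close>
    truncates at 0, hence its modulus.\<close>
  define D where "D = \<bar>C\<bar> * K * C1 powr (1 / u) * P"
  have P0: "P \<ge> 0" unfolding P_def by (intro prod_nonneg) auto
  have D0: "D \<ge> 0" unfolding D_def using K P0 by simp
  show thesis
  proof (rule that[of "\<kappa>1 * \<kappa>2" D])
    show "\<kappa>1 * \<kappa>2 > 0" using \<kappa>1 \<kappa>2 by simp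
    show "D \<ge> 0" by fact
    fix J :: nat and c :: real assume c: "0 < c" "c \<le> 1"
    define h where "h = (dyadic u J :: 'v \<Rightarrow> real)"
    have h: "integrable lborel h" "\<And>z. 0 \<le> h z" unfolding h_def by (auto simp: integrable_dyadic dyadic_nonneg)
    define S where "S = smear L' h"
    have S: "integrable lborel S" "continuous_on UNIV S" "\<And>y. 0 \<le> S y" "\<And>y. S y \<le> (LINT z|lborel. h z)"
      unfolding S_def by (intro integrable_smear continuous_on_smear smear_nonneg smear_le Lm h)+
    have [measurable]: "X \<in> borel_measurable borel" "S \<in> borel_measurable borel" using X S by auto
    define H where "H y = complex_of_real (S y) * cis (2 * pi * (a \<bullet> y))" for y
    have [measurable]: "H \<in> borel_measurable borel" unfolding H_def by measurable
    define E where "E \<eta> = (\<Sum>j<J. 2 powr (real j * (DIM('v) / u)) * gauss (4 ^ j) (L \<eta>)) * gauss 1 \<eta>" for \<eta>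
    have [measurable]: "E \<in> borel_measurable borel" unfolding E_def by measurable
    \<comment> \<open>The modulation merely translates the transform, so the mass bound for the
      unmodulated sum applies.\<close>
    have fH: "fourier H = (\<lambda>\<eta>. of_real (E (- a + 1 *\<^sub>R \<eta>)))"
    proof
      fix \<eta>
      have "fourier H \<eta> = fourier (\<lambda>y. of_real (S y)) (\<eta> - a)"
        unfolding H_def using fourier_modulated[of "\<lambda>y. of_real (S y)" "- a" \<eta>] by simp
      also have "\<dots> = fourier (\<lambda>z. of_real (h z)) (L (\<eta> - a)) * of_real (gauss 1 (\<eta> - a))"
        unfolding S_def by (rule fourier_smear[OF Lm(2) h adj])
      also have "\<dots> = of_real (E (\<eta> - a))" unfolding h_def fourier_dyadic E_def by simp
      finally show "fourier H \<eta> = of_real (E (- a + 1 *\<^sub>R \<eta>))" by simp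
    qed
    have Ei: "integrable lborel E"
    proof -
      have "integrable lborel (\<lambda>\<eta>. gauss 1 \<eta> * (\<Sum>j<J. 2 powr (real j * (DIM('v) / u)) * gauss (4 ^ j) (L \<eta>)))"
      proof (rule integrable_mult_bounded[OF integrable_gauss_unit])
        fix \<eta>
        have "norm (\<Sum>j<J. 2 powr (real j * (DIM('v) / u)) * gauss (4 ^ j) (L \<eta>)) = (\<Sum>j<J. 2 powr (real j * (DIM('v) / u)) * gauss (4 ^ j) (L \<eta>))"
          by (simp add: sum_nonneg)
        also have "\<dots> \<le> (\<Sum>j<J. 2 powr (real j * (DIM('v) / u)))"
          by (intro sum_mono) (auto simp: gauss_le_1 mult_left_le)
        finally show "norm (\<Sum>j<J. 2 powr (real j * (DIM('v) / u)) * gauss (4 ^ j) (L \<eta>)) \<le> (\<Sum>j<J. 2 powr (real j * (DIM('v) / u)))" .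
      qed measurable
      then show ?thesis by (simp add: E_def[abs_def] mult.commute)
    qed
    have H: "integrable lborel H" "continuous_on UNIV H" "\<And>y. norm (H y) \<le> (LINT z|lborel. h z)" "integrable lborel (fourier H)"
    proof -
      show "integrable lborel H" unfolding H_def using S(1) by (intro integrable_mult_cis) auto
      show "continuous_on UNIV H" unfolding H_def by (intro continuous_intros S)
      show "norm (H y) \<le> (LINT z|lborel. h z)" for y using S(3,4)[of y] by (simp add: H_def norm_mult)
      have "integrable lborel (\<lambda>\<eta>. E (- a + 1 *\<^sub>R \<eta>))" using Ei by (subst integrable_lborel_affine_iff) auto
      then show "integrable lborel (fourier H)" unfolding fH complex_of_real_integrable_eq .
    qed
    have mass: "lp_mass u (fourier H) \<le> ennreal (C1 * real J)"
    proof -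
      have "lp_mass u (fourier H) = lp_mass u (\<lambda>\<eta>. of_real (E \<eta>))"
        unfolding fH using lp_mass_affine[of "\<lambda>\<eta>. complex_of_real (E \<eta>)" 1 u "- a"] by simp
      also have "\<dots> \<le> ennreal (C1 * real J)" unfolding E_def by (rule C1(2))
      finally show ?thesis .
    qed
    define m where "m \<xi> = fourier (\<lambda>x. of_real (X x) * cis (2 * pi * (a \<bullet> x))) \<xi> * fourier (\<lambda>y. H y / bessel_weight s y) \<xi>" for \<xi>
    have Am: "A_norm \<Theta> u s m \<le> ennreal (K * (C1 * real J) powr (1 / u))"
      unfolding m_def by (rule AK[OF a H mass]) (use C1 in auto)
    define f where "f i = mgauss (a $ i) c" for i
    have prod: "(\<Prod>i\<in>UNIV. lp_norm (pp i) (f i)) = ennreal (c powr (- (CARD('n) / 2) / p) * P)"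
    proof -
      have "(\<Prod>i\<in>UNIV. lp_norm (pp i) (f i)) = (\<Prod>i\<in>UNIV. ennreal ((c * pp i) powr (- (CARD('n) / 2) / pp i)))"
        unfolding f_def using c pp by (intro prod.cong refl) (simp add: lp_norm_mgauss)
      also have "\<dots> = ennreal (\<Prod>i\<in>UNIV. (c * pp i) powr (- (CARD('n) / 2) / pp i))" by (rule prod_ennreal) simp
      also have "(\<Prod>i\<in>UNIV. (c * pp i) powr (- (CARD('n) / 2) / pp i)) = (\<Prod>i\<in>UNIV. c powr (- (CARD('n) / 2) / pp i)) * P"
        unfolding P_def prod.distrib[symmetric] by (simp only: powr_mult)
      also have "(\<Prod>i\<in>UNIV. c powr (- (CARD('n) / 2) / pp i)) = c powr (\<Sum>i\<in>UNIV. - (CARD('n) / 2) / pp i)"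
        using c by (simp add: powr_sum)
      also have "(\<Sum>i\<in>UNIV. - (CARD('n) / 2) / pp i) = - (CARD('n) / 2) / p"
      proof -
        have "(\<Sum>i\<in>UNIV. - (CARD('n) / 2) / pp i) = - (CARD('n) / 2) * (\<Sum>i\<in>UNIV. 1 / pp i)"
          by (simp add: sum_distrib_left)
        then show ?thesis unfolding p_def[symmetric] by simp
      qed
      finally show ?thesis .
    qed
    have "lp_norm p (T_mult m f) \<le> ennreal C * A_norm \<Theta> u s m * (\<Prod>i\<in>UNIV. lp_norm (pp i) (f i))"
    proof (rule bound)
      show "m \<in> borel_measurable lborel" unfolding m_def by measurable
      have "norm (m \<xi>) \<le> (LINT x|lborel. norm (of_real (X x) * cis (2 * pi * (a \<bullet> x)))) * (LINT y|lborel. norm (H y / bessel_weight s y))" for \<xi>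
        unfolding m_def norm_mult[of "fourier _ _"] by (intro mult_mono norm_fourier_le) auto
      then show "bounded (range m)" by (auto intro!: boundedI)
      show "A_norm \<Theta> u s m < \<infinity>" by (rule order_le_less_trans[OF Am]) simp
      show "\<forall>i. schwartz (f i)" unfolding f_def using schwartz_mgauss[OF c(1)] by blast
    qed
    also have "\<dots> \<le> ennreal \<bar>C\<bar> * ennreal (K * (C1 * real J) powr (1 / u)) * ennreal (c powr (- (CARD('n) / 2) / p) * P)"
      unfolding prod by (intro mult_mono Am ennreal_leI) (auto simp: P0)
    also have "\<dots> = ennreal (D * real J powr (1 / u) * c powr (- (CARD('n) / 2) / p))"
      using K P0 C1(1) by (simp add: ennreal_mult'[symmetric] D_def powr_mult mult_ac)
    finally have Tm: "lp_mass p (T_mult m f) \<le> ennreal ((D * real J powr (1 / u) * c powr (- (CARD('n) / 2) / p)) powr p)"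
      by (rule lp_mass_le_of_lp_norm_le) (use D0 p in auto)
    \<comment> \<open>With the common phase factored out, the modulus of \<open>T_mult m f x\<close>
      is an integral of nonnegative functions, from which the cutoff and the smearing are stripped
      off one after the other.\<close>
    have low: "0 \<le> \<kappa>1 * \<kappa>2 * (LINT z|lborel. h z * ((1 + norm (L' z)) powr (- s) * gauss (4 * c) (diag x - L' z)))"
      "\<kappa>1 * \<kappa>2 * (LINT z|lborel. h z * ((1 + norm (L' z)) powr (- s) * gauss (4 * c) (diag x - L' z))) \<le> norm (T_mult m f x)" for x
    proof -
      show "0 \<le> \<kappa>1 * \<kappa>2 * (LINT z|lborel. h z * ((1 + norm (L' z)) powr (- s) * gauss (4 * c) (diag x - L' z)))"
        using \<kappa>1 \<kappa>2 h(2) by (intro mult_nonneg_nonneg integral_nonneg_AE AE_I2) auto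
      define b where "b y = norm (bessel_weight s y)" for y :: "real^'n^'l"
      have [measurable]: "b \<in> borel_measurable borel" unfolding b_def by measurable
      have b1: "1 \<le> b y" for y unfolding b_def using bessel_weight_nz(1)[OF s0] .
      define R where "R y = (LINT x'|lborel. X x' * gauss c (diag x - y - x'))" for y
      have [measurable]: "R \<in> borel_measurable borel" unfolding R_def gauss_def by measurable
      have R0: "0 \<le> R y" for y unfolding R_def using X by (intro integral_nonneg_AE AE_I2) auto
      have RX: "R y \<le> (LINT x'|lborel. X x')" for y
        unfolding R_def by (rule integral_mono') (use X c in \<open>auto simp: gauss_le_1 mult_left_le\<close>)
      have Sb: "integrable lborel (\<lambda>y. S y / b y)"
      proof (rule Bochner_Integration.integrable_bound[OF S(1)])
        show "AE y in lborel. norm (S y / b y) \<le> norm (S y)"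
        proof (rule AE_I2)
          fix y
          have "\<bar>S y\<bar> * 1 \<le> \<bar>S y\<bar> * b y" by (intro mult_left_mono b1) auto
          then show "norm (S y / b y) \<le> norm (S y)" using b1[of y] by (simp add: abs_div divide_le_eq)
        qed
      qed measurable
      have "\<kappa>1 * (\<kappa>2 * (LINT z|lborel. h z * ((1 + norm (L' z)) powr (- s) * gauss (4 * c) (diag x - L' z)))) \<le> \<kappa>1 * (LINT y|lborel. S y / b y * gauss (2 * c) (diag x - y))"
        unfolding S_def b_def using \<kappa>1 c h by (intro mult_left_mono \<kappa>2(2)) auto
      also have "\<dots> = (LINT y|lborel. S y / b y * (\<kappa>1 * gauss (2 * c) (diag x - y)))"
        unfolding Bochner_Integration.integral_mult_right_zero[symmetric]
        by (intro Bochner_Integration.integral_cong refl) (simp only: mult_ac)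
      also have "\<dots> \<le> (LINT y|lborel. S y / b y * R y)"
      proof (rule integral_mono')
        show "integrable lborel (\<lambda>y. S y / b y * R y)"
          by (rule integrable_mult_bounded[OF Sb]) (use R0 RX in auto)
        have Sb0: "0 \<le> S y / b y" for y using S(3)[of y] b1[of y] by simp
        show "0 \<le> S y / b y * R y" for y using Sb0 R0 by (intro mult_nonneg_nonneg)
        show "S y / b y * (\<kappa>1 * gauss (2 * c) (diag x - y)) \<le> S y / b y * R y" for y
          unfolding R_def using c by (intro mult_left_mono \<kappa>1(2) Sb0) auto
      qed
      also have "\<dots> = norm (T_mult m f x)"
      proof -
        have "T_mult m f x = cis (2 * pi * (a \<bullet> diag x)) * of_real (LINT y|lborel. S y / b y * R y)"
          unfolding m_def[abs_def] f_def[abs_def] H_def[abs_def] b_def R_def by (rule T_mult_mgauss[OF c(1) s0 X(4) S(1)])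
        moreover have "0 \<le> (LINT y|lborel. S y / b y * R y)"
          using S(3) b1 R0 order_trans[OF zero_le_one b1] by (intro integral_nonneg_AE AE_I2) auto
        ultimately show ?thesis by (simp add: norm_mult)
      qed
      finally show "\<kappa>1 * \<kappa>2 * (LINT z|lborel. h z * ((1 + norm (L' z)) powr (- s) * gauss (4 * c) (diag x - L' z))) \<le> norm (T_mult m f x)"
        by (simp only: mult.assoc)
    qed
    have "(\<integral>\<^sup>+x. ennreal ((\<kappa>1 * \<kappa>2 * (LINT z|lborel. h z * ((1 + norm (L' z)) powr (- s) * gauss (4 * c) (diag x - L' z)))) powr p) \<partial>lborel) \<le> lp_mass p (T_mult m f)"
      unfolding lp_mass_def using p low by (intro nn_integral_mono ennreal_leI powr_mono2) auto
    also note Tm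
    finally show "(\<integral>\<^sup>+x. ennreal ((\<kappa>1 * \<kappa>2 * (LINT z|lborel. dyadic u J z * ((1 + norm (L' z)) powr (- s) * gauss (4 * c) (diag x - L' z)))) powr p) \<partial>lborel)
        \<le> ennreal ((D * real J powr (1 / u) * c powr (- (CARD('n) / 2) / p)) powr p)"
      unfolding h_def .
  qed
qed

section \<open>Lower bounds and the two necessary conditions\<close>

lemma powr_growth_contradiction:
  fixes A B \<alpha> \<beta> :: real
  assumes A: "A > 0" and "\<beta> < \<alpha>" and le: "\<And>J::nat. J \<ge> 1 \<Longrightarrow> A * real J powr \<alpha> \<le> B * real J powr \<beta>"
  shows False
proof -
  define e where "e = \<alpha> - \<beta>"
  have e: "e > 0" using assms by (simp add: e_def)
  define M where "M = \<bar>B / A\<bar> + 1"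
  have M: "M \<ge> 1" by (simp add: M_def)
  define J where "J = nat \<lceil>M powr (1 / e)\<rceil>"
  have J: "M powr (1 / e) \<le> real J" unfolding J_def by linarith
  moreover have "1 \<le> M powr (1 / e)" using M e by (intro ge_one_powr_ge_zero) auto
  ultimately have J1: "J \<ge> 1" by linarith
  have "A * real J powr \<alpha> \<le> B * real J powr \<beta>" by (rule le[OF J1])
  then have "real J powr e \<le> B / A"
    using A J1 by (simp add: e_def powr_diff field_simps)
  moreover have "M \<le> real J powr e"
  proof -
    have "M = (M powr (1 / e)) powr e" using M e by (simp add: powr_powr)
    also have "\<dots> \<le> real J powr e" using J e by (intro powr_mono2) auto
    finally show ?thesis .
  qed
  ultimately show False by (simp add: M_def abs_if split: if_splits)
qed

lemma gauss_ge:
  assumes "0 \<le> c" "norm x \<le> R" "c * R\<^sup>2 \<le> K"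
  shows "exp (- (pi * K)) \<le> gauss c x"
proof -
  have "c * (norm x)\<^sup>2 \<le> c * R\<^sup>2" using assms by (intro mult_left_mono power_mono) auto
  then have "pi * (c * (norm x)\<^sup>2) \<le> pi * K" using assms by (intro mult_left_mono) auto
  then show ?thesis by (simp add: gauss_def mult.assoc)
qed

lemma two_power_square: "((2::real) ^ j)\<^sup>2 = 4 ^ j"
  by (simp add: power2_eq_square power_mult_distrib[symmetric])

lemma two_powr_real: "2 powr (real j * t) = (2 ^ j) powr t"
  by (simp add: powr_powr[symmetric] powr_realpow)

lemma integral_ge_const_cball:
  fixes F :: "'a::euclidean_space \<Rightarrow> real"
  assumes "integrable lborel F" "\<And>z. 0 \<le> F z" "\<And>z. z \<in> cball w r \<Longrightarrow> K \<le> F z" "r \<ge> 0"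
  shows "K * (unit_ball_vol DIM('a) * r ^ DIM('a)) \<le> (LINT z|lborel. F z)"
proof -
  have "K * (unit_ball_vol DIM('a) * r ^ DIM('a)) = (LINT z|lborel. K * indicator (cball w r) z)"
    using assms(4) by (simp add: content_cball)
  also have "\<dots> \<le> (LINT z|lborel. F z)"
    by (rule integral_mono') (use assms in \<open>auto simp: indicator_def\<close>)
  finally show ?thesis .
qed

lemma integrable_dyadic_weight:
  fixes L' :: "'v::euclidean_space \<Rightarrow> 'a::euclidean_space"
  assumes [measurable]: "L' \<in> borel_measurable borel" and s: "s \<ge> 0" and c: "c \<ge> 0" and h: "integrable lborel h"
  shows "integrable lborel (\<lambda>z. h z * ((1 + norm (L' z)) powr (- s) * gauss c (q - L' z)))"
proof (rule integrable_mult_bounded[OF h, where B=1])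
  fix z
  have "(1 + norm (L' z)) powr (- s) \<le> 1" using s by (simp add: powr_minus inverse_le_1_iff ge_one_powr_ge_zero)
  then have "(1 + norm (L' z)) powr (- s) * gauss c (q - L' z) \<le> 1 * 1"
    using c by (intro mult_mono gauss_le_1) auto
  then show "norm ((1 + norm (L' z)) powr (- s) * gauss c (q - L' z)) \<le> 1" by (simp add: abs_mult)
qed measurable

text \<open>At every dyadic scale \<open>2^j\<close> the \<open>j\<close>-th summand contributes a fixed amount, so the integral grows linearly in \<open>J\<close>.\<close>
lemma dyadic_isotropic_ge:
  fixes q :: "'a::euclidean_space"
  assumes s: "s \<ge> 0" "s \<le> DIM('a) / u" and q: "norm q \<le> B * 2 ^ J" and B: "B \<ge> 0"
  shows "exp (- pi) * 2 powr (- s) * exp (- (pi * (4 * (B + 1)\<^sup>2))) * unit_ball_vol DIM('a) * real J \<le>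
    (LINT z|lborel. dyadic u J z * ((1 + norm z) powr (- s) * gauss (4 * (1 / 4 ^ J)) (q - z)))"
proof -
  let ?d = "real DIM('a)"
  define W where "W z = (1 + norm z) powr (- s) * gauss (4 * (1 / 4 ^ J)) (q - z)" for z :: 'a
  define K where "K = exp (- pi) * 2 powr (- s) * exp (- (pi * (4 * (B + 1)\<^sup>2)))"
  have K: "K \<ge> 0" by (simp add: K_def)
  have gW: "integrable lborel (\<lambda>z. gauss (1 / 4 ^ j) z * W z)" for j
    unfolding W_def by (rule integrable_dyadic_weight[where L'="\<lambda>z. z"]) (use s in \<open>auto intro: integrable_gauss\<close>)
  have "(\<Sum>j<J. K * unit_ball_vol ?d) \<le> (\<Sum>j<J. 2 powr (real j * (?d / u - ?d)) * (LINT z|lborel. gauss (1 / 4 ^ j) z * W z))"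
  proof (rule sum_mono)
    fix j assume j: "j \<in> {..<J}"
    define R where "R = (2::real) ^ j"
    have R: "R \<ge> 1" by (simp add: R_def)
    have RJ: "R \<le> 2 ^ J" using j by (simp add: R_def power_increasing)
    have R2: "R\<^sup>2 = 4 ^ j" by (simp add: R_def two_power_square)
    have "(exp (- pi) * ((2 * R) powr (- s) * exp (- (pi * (4 * (B + 1)\<^sup>2))))) * (unit_ball_vol ?d * R ^ DIM('a)) \<le> (LINT z|lborel. gauss (1 / 4 ^ j) z * W z)"
    proof (rule integral_ge_const_cball[OF gW])
      show "0 \<le> gauss (1 / 4 ^ j) z * W z" for z by (simp add: W_def)
      fix z :: 'a assume "z \<in> cball 0 R"
      then have z: "norm z \<le> R" by simp
      have 1: "exp (- pi) \<le> gauss (1 / 4 ^ j) z"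
        using gauss_ge[of "1 / 4 ^ j" z R 1] z R2 by simp
      have 2: "(2 * R) powr (- s) \<le> (1 + norm z) powr (- s)"
        using z R s by (intro powr_mono2') (auto intro: add_pos_nonneg)
      have "norm (q - z) \<le> B * 2 ^ J + 2 ^ J" using norm_triangle_ineq4[of q z] q z RJ by linarith
      then have "norm (q - z) \<le> (B + 1) * 2 ^ J" by (simp add: distrib_right)
      then have 3: "exp (- (pi * (4 * (B + 1)\<^sup>2))) \<le> gauss (4 * (1 / 4 ^ J)) (q - z)"
        by (rule gauss_ge[rotated]) (auto simp: power_mult_distrib two_power_square)
      show "exp (- pi) * ((2 * R) powr (- s) * exp (- (pi * (4 * (B + 1)\<^sup>2)))) \<le> gauss (1 / 4 ^ j) z * W z"
        unfolding W_def by (intro mult_mono 1 2 3) auto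
    qed (use R in simp)
    then have "2 powr (real j * (?d / u - ?d)) * ((exp (- pi) * ((2 * R) powr (- s) * exp (- (pi * (4 * (B + 1)\<^sup>2))))) * (unit_ball_vol ?d * R ^ DIM('a))) \<le> 2 powr (real j * (?d / u - ?d)) * (LINT z|lborel. gauss (1 / 4 ^ j) z * W z)"
      by (intro mult_left_mono) auto
    \<comment> \<open>Exponents of \<open>R = 2^j\<close>: \<open>d/u - d\<close> from the
      coefficient, \<open>- s\<close> from the weight, \<open>d\<close> from the volume of the ball.
      Their sum \<open>d/u - s\<close> is nonnegative by assumption.\<close>
    moreover have "2 powr (real j * (?d / u - ?d)) * ((exp (- pi) * ((2 * R) powr (- s) * exp (- (pi * (4 * (B + 1)\<^sup>2))))) * (unit_ball_vol ?d * R ^ DIM('a))) = K * unit_ball_vol ?d * R powr (?d / u - s)"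
    proof -
      have e1: "R ^ DIM('a) = R powr ?d" using R by (simp add: powr_realpow)
      have e2: "R powr (?d / u - ?d) * (R powr (- s) * R powr ?d) = R powr (?d / u - s)"
        by (simp add: powr_add[symmetric])
      show ?thesis unfolding two_powr_real R_def[symmetric] powr_mult K_def e1 e2[symmetric]
        by (simp only: mult_ac)
    qed
    moreover have "K * unit_ball_vol ?d * 1 \<le> K * unit_ball_vol ?d * R powr (?d / u - s)"
      using s R K by (intro mult_left_mono ge_one_powr_ge_zero) auto
    ultimately show "K * unit_ball_vol ?d \<le> 2 powr (real j * (?d / u - ?d)) * (LINT z|lborel. gauss (1 / 4 ^ j) z * W z)"
      by simp
  qed
  also have "\<dots> = (LINT z|lborel. (\<Sum>j<J. 2 powr (real j * (?d / u - ?d)) * (gauss (1 / 4 ^ j) z * W z)))"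
    by (subst Bochner_Integration.integral_sum) (auto intro!: integrable_mult_right gW)
  also have "\<dots> = (LINT z|lborel. dyadic u J z * W z)"
    unfolding dyadic_def sum_distrib_right by (simp only: mult.assoc)
  finally show ?thesis by (simp add: W_def K_def mult_ac)
qed

text \<open>For \<open>norm x\<close> of size \<open>2^i\<close> only the summand
  \<open>j = i\<close> is kept, and only \<open>z\<close> in the unit ball around \<open>x\<close>,
  because the input now has unit width. Hence there is no volume factor \<open>2^(i n)\<close>, in
  contrast to the isotropic estimate; the different scales act on different ranges of
  \<open>x\<close>.\<close>

lemma dyadic_diagonal_ge:
  fixes x :: "real^'n"
  assumes s: "s \<ge> 0" and i: "i < J" and x: "2 ^ i \<le> norm x" "norm x \<le> 2 ^ Suc i"
  shows "exp (- (pi * 9)) * (1 + 3 * sqrt CARD('l)) powr (- s) * exp (- (pi * (4 * CARD('l)))) * unit_ball_vol CARD('n) * (2 ^ i) powr (CARD('n) / u - CARD('n) - s) \<le>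
    (LINT z|lborel. dyadic u J z * ((1 + norm (diag z :: real^'n^'l)) powr (- s) * gauss (4 * 1) (diag x - diag z :: real^'n^'l)))"
proof -
  define l where "l = sqrt CARD('l)"
  have l: "l \<ge> 1" by (simp add: l_def)
  define R where "R = (2::real) ^ i"
  have R: "R \<ge> 1" by (simp add: R_def)
  have R2: "R\<^sup>2 = 4 ^ i" by (simp add: R_def two_power_square)
  let ?n = "real CARD('n)"
  have main: "(R powr (?n / u - ?n) * exp (- (pi * 9)) * (((1 + 3 * l) * R) powr (- s) * exp (- (pi * (4 * l\<^sup>2))))) * (unit_ball_vol DIM(real^'n) * 1 ^ DIM(real^'n)) \<le>
    (LINT z|lborel. dyadic u J z * ((1 + norm (diag z :: real^'n^'l)) powr (- s) * gauss (4 * 1) (diag x - diag z :: real^'n^'l)))"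
  proof (rule integral_ge_const_cball)
    show "integrable lborel (\<lambda>z. dyadic u J z * ((1 + norm (diag z :: real^'n^'l)) powr (- s) * gauss (4 * 1) (diag x - diag z :: real^'n^'l)))"
      by (rule integrable_dyadic_weight) (use s in \<open>auto simp: integrable_dyadic\<close>)
    show "0 \<le> dyadic u J z * ((1 + norm (diag z :: real^'n^'l)) powr (- s) * gauss (4 * 1) (diag x - diag z :: real^'n^'l))" for z
      by (simp add: dyadic_nonneg)
    fix z assume "z \<in> cball x 1"
    then have zx: "norm (x - z) \<le> 1" by (simp add: dist_norm)
    have "norm z \<le> norm x + norm (x - z)" using norm_triangle_ineq4[of x "x - z"] by simp
    moreover have "norm x \<le> 2 * R" using x(2) by (simp add: R_def)
    ultimately have z: "norm z \<le> 3 * R" using zx R by linarith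
    have "(2 powr (real i * (?n / u - ?n)) * gauss (1 / 4 ^ i) z) \<le> dyadic u J z"
      unfolding dyadic_def using i
      by (intro order_trans[OF _ member_le_sum[of i "{..<J}"]]) auto
    \<comment> \<open>The 9 is the square of the 3 in
      \<open>norm z \<le> norm x + 1 \<le> 3 * R\<close>.\<close>
    moreover have "exp (- (pi * 9)) \<le> gauss (1 / 4 ^ i) z"
      by (rule gauss_ge[OF _ z]) (auto simp: power_mult_distrib R2)
    ultimately have 1: "R powr (?n / u - ?n) * exp (- (pi * 9)) \<le> dyadic u J z"
      unfolding two_powr_real R_def[symmetric] by (meson mult_left_mono order_trans powr_ge_zero)
    have "1 + l * norm z \<le> R + l * (3 * R)" using z l R by (intro add_mono mult_left_mono) auto
    then have "1 + l * norm z \<le> (1 + 3 * l) * R" by (simp add: algebra_simps)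
    moreover have "0 < 1 + l * norm z" using l by (intro add_pos_nonneg) auto
    ultimately have 2: "((1 + 3 * l) * R) powr (- s) \<le> (1 + norm (diag z :: real^'n^'l)) powr (- s)"
      using s unfolding norm_diag l_def[symmetric] by (intro powr_mono2') auto
    have "norm (diag (x - z) :: real^'n^'l) \<le> l * 1"
      unfolding norm_diag l_def[symmetric] using zx l by (intro mult_left_mono) auto
    then have 3: "exp (- (pi * (4 * l\<^sup>2))) \<le> gauss (4 * 1) (diag x - diag z :: real^'n^'l)"
      unfolding diag_diff by (rule gauss_ge[rotated]) auto
    show "R powr (?n / u - ?n) * exp (- (pi * 9)) * (((1 + 3 * l) * R) powr (- s) * exp (- (pi * (4 * l\<^sup>2)))) \<le> dyadic u J z * ((1 + norm (diag z :: real^'n^'l)) powr (- s) * gauss (4 * 1) (diag x - diag z :: real^'n^'l))"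
      by (intro mult_mono 1 2 3) (auto simp: dyadic_nonneg)
  qed simp
  have e: "R powr (?n / u - ?n) * R powr (- s) = R powr (?n / u - ?n - s)"
    by (simp add: powr_add[symmetric])
  have l2: "l\<^sup>2 = CARD('l)" by (simp add: l_def)
  show ?thesis using main unfolding l_def[symmetric] R_def[symmetric] e[symmetric] powr_mult by (simp add: l2 mult_ac)
qed


text \<open>Tested with \<open>L\<close> the identity and \<open>c = 1 / 4 ^ J\<close>. On the ball
  of radius \<open>2^J\<close> all \<open>J\<close> scales contribute at every point, so the
  \<open>p\<close>-th power of the left-hand side is at least of order
  \<open>J powr p * 2^(J n)\<close>; the right-hand side is of order
  \<open>J powr (p / u) * 2^(J n)\<close>, which contradicts \<open>u > 1\<close>.\<close>

lemma smoothness_gt_isotropic: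
  fixes \<Theta> :: "real^'n^'l \<Rightarrow> complex" and pp :: "'l \<Rightarrow> real" and p u s :: real
  assumes \<Theta>: "schwartz \<Theta>" and supp: "\<And>\<xi>. fourier \<Theta> \<xi> \<noteq> 0 \<Longrightarrow> 1/2 \<le> norm \<xi> \<and> norm \<xi> \<le> 2"
    and pp: "\<And>i. 0 < pp i" and p_def: "1 / p = (\<Sum>i\<in>UNIV. 1 / pp i)" and p: "p > 0"
    and u: "1 < u" and s: "0 < s"
    and bound: "\<And>m f. m \<in> borel_measurable lborel \<Longrightarrow> bounded (range m) \<Longrightarrow> A_norm \<Theta> u s m < \<infinity> \<Longrightarrow> (\<forall>i. schwartz (f i)) \<Longrightarrow>
        lp_norm p (T_mult m f) \<le> ennreal C * A_norm \<Theta> u s m * (\<Prod>i\<in>UNIV. lp_norm (pp i) (f i))"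
  shows "real (CARD('l) * CARD('n)) / u < s"
proof (rule ccontr)
  assume "\<not> ?thesis"
  then have su: "s \<le> DIM(real^'n^'l) / u" by simp
  obtain \<kappa> D where \<kappa>: "\<kappa> > 0" and D: "D \<ge> 0" and
    test: "\<And>J c. 0 < c \<Longrightarrow> c \<le> 1 \<Longrightarrow>
      (\<integral>\<^sup>+x. ennreal ((\<kappa> * (LINT z|lborel. dyadic u J (z::real^'n^'l) * ((1 + norm z) powr (- s) * gauss (4 * c) (diag x - z)))) powr p) \<partial>lborel)
        \<le> ennreal ((D * real J powr (1 / u) * c powr (- (CARD('n) / 2) / p)) powr p)"
    by (rule test_bound[where L="\<lambda>z. z" and L'="\<lambda>z. z", OF \<Theta> supp pp p_def p u s bound]) auto
  define l where "l = sqrt CARD('l)"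
  define c0 where "c0 = exp (- pi) * 2 powr (- s) * exp (- (pi * (4 * (l + 1)\<^sup>2))) * unit_ball_vol DIM(real^'n^'l)"
  have c0: "c0 > 0" by (simp add: c0_def)
  define v where "v = unit_ball_vol (real CARD('n))"
  have v: "v > 0" by (simp add: v_def)
  show False
  proof (rule powr_growth_contradiction)
    show "(\<kappa> * c0) powr p * v > 0" using \<kappa> c0 v by simp
    show "p / u < p" using p u by (simp add: divide_less_eq)
    fix J :: nat assume J: "J \<ge> 1"
    define N where "N = ((2::real) ^ J) ^ CARD('n)"
    have N: "N > 0" by (simp add: N_def)
    have "ennreal ((\<kappa> * (c0 * real J)) powr p * (v * N)) = (\<integral>\<^sup>+x. ennreal ((\<kappa> * (c0 * real J)) powr p) * indicator (cball (0::real^'n) (2 ^ J)) x \<partial>lborel)"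
      by (simp add: nn_integral_cmult_indicator emeasure_cball ennreal_mult' v_def N_def)
    also have "\<dots> \<le> (\<integral>\<^sup>+x. ennreal ((\<kappa> * (LINT z|lborel. dyadic u J (z::real^'n^'l) * ((1 + norm z) powr (- s) * gauss (4 * (1 / 4 ^ J)) (diag x - z)))) powr p) \<partial>lborel)"
    proof (rule nn_integral_mono)
      fix x :: "real^'n"
      show "ennreal ((\<kappa> * (c0 * real J)) powr p) * indicator (cball 0 (2 ^ J)) x \<le>
        ennreal ((\<kappa> * (LINT z|lborel. dyadic u J (z::real^'n^'l) * ((1 + norm z) powr (- s) * gauss (4 * (1 / 4 ^ J)) (diag x - z)))) powr p)"
      proof (cases "x \<in> cball 0 (2 ^ J)")
        case True
        have "norm (diag x :: real^'n^'l) \<le> l * 2 ^ J"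
          using True unfolding norm_diag l_def by (intro mult_left_mono) auto
        from dyadic_isotropic_ge[OF _ su this] s
        have "c0 * real J \<le> (LINT z|lborel. dyadic u J (z::real^'n^'l) * ((1 + norm z) powr (- s) * gauss (4 * (1 / 4 ^ J)) (diag x - z)))"
          by (simp add: c0_def l_def)
        then have "(\<kappa> * (c0 * real J)) powr p \<le> (\<kappa> * (LINT z|lborel. dyadic u J (z::real^'n^'l) * ((1 + norm z) powr (- s) * gauss (4 * (1 / 4 ^ J)) (diag x - z)))) powr p"
          using \<kappa> c0 p by (intro powr_mono2 mult_left_mono) auto
        then show ?thesis using True by (simp add: ennreal_leI)
      qed simp
    qed
    also have "\<dots> \<le> ennreal ((D * real J powr (1 / u) * (1 / 4 ^ J) powr (- (CARD('n) / 2) / p)) powr p)"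
      by (rule test) (auto simp: field_simps)
    \<comment> \<open>The input norms contribute exactly the volume factor
      \<open>N = 2^(J n)\<close> of the ball, which cancels.\<close>
    also have "(D * real J powr (1 / u) * (1 / 4 ^ J) powr (- (CARD('n) / 2) / p)) powr p = D powr p * real J powr (p / u) * N"
    proof -
      have "((1 / 4 ^ J) powr (- (CARD('n) / 2) / p)) powr p = (1 / 4 ^ J) powr (- (CARD('n) / 2))"
        using p by (simp add: powr_powr)
      also have "\<dots> = (4 ^ J) powr (CARD('n) / 2)" by (simp add: powr_minus powr_divide inverse_eq_divide)
      also have "\<dots> = (2 ^ J) powr CARD('n)" unfolding two_power_square[symmetric] by (simp add: powr_powr flip: powr_numeral)
      also have "\<dots> = N" unfolding N_def by (rule powr_realpow) simp
      finally show ?thesis using p by (simp add: powr_mult powr_powr)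
    qed
    finally have "(\<kappa> * (c0 * real J)) powr p * (v * N) \<le> D powr p * real J powr (p / u) * N"
      using N by (subst (asm) ennreal_le_iff) auto
    then have "(\<kappa> * (c0 * real J)) powr p * v \<le> D powr p * real J powr (p / u)" using N by (simp add: mult.assoc[symmetric])
    then show "(\<kappa> * c0) powr p * v * real J powr p \<le> D powr p * real J powr (p / u)"
      by (simp add: powr_mult mult_ac)
  qed
qed

text \<open>Tested with \<open>L\<close> the sum of the blocks, \<open>L'\<close> the diagonal and
  \<open>c = 1\<close>. If the conclusion fails, each of the \<open>J\<close> disjoint dyadic annuli
  carries at least a fixed mass \<open>t\<close>, so \<open>t * J\<close> is bounded by a multiple
  of \<open>J powr (p / u)\<close>; this is where \<open>p < u\<close> enters.\<close>

lemma smoothness_gt_diagonal: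
  fixes \<Theta> :: "real^'n^'l \<Rightarrow> complex" and pp :: "'l \<Rightarrow> real" and p u s :: real
  assumes \<Theta>: "schwartz \<Theta>" and supp: "\<And>\<xi>. fourier \<Theta> \<xi> \<noteq> 0 \<Longrightarrow> 1/2 \<le> norm \<xi> \<and> norm \<xi> \<le> 2"
    and pp: "\<And>i. 0 < pp i" and p_def: "1 / p = (\<Sum>i\<in>UNIV. 1 / pp i)" and p: "p > 0" and pu: "p < u"
    and u: "1 < u" and s: "0 < s"
    and bound: "\<And>m f. m \<in> borel_measurable lborel \<Longrightarrow> bounded (range m) \<Longrightarrow> A_norm \<Theta> u s m < \<infinity> \<Longrightarrow> (\<forall>i. schwartz (f i)) \<Longrightarrow>
        lp_norm p (T_mult m f) \<le> ennreal C * A_norm \<Theta> u s m * (\<Prod>i\<in>UNIV. lp_norm (pp i) (f i))"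
  shows "CARD('n) / p - CARD('n) + CARD('n) / u < s"
proof (rule ccontr)
  assume "\<not> ?thesis"
  then have sn: "s \<le> CARD('n) / p - CARD('n) + CARD('n) / u" by simp
  let ?n = "real CARD('n)"
  have adj: "(\<Sum>i\<in>UNIV. \<eta> $ i) \<bullet> z = \<eta> \<bullet> diag z" for \<eta> :: "real^'n^'l" and z :: "real^'n"
    by (rule inner_diag[symmetric])
  have dn: "norm z \<le> norm (diag z :: real^'n^'l)" for z :: "real^'n"
    unfolding norm_diag by (simp add: mult_le_cancel_right1)
  have Lm: "(\<lambda>\<eta>::real^'n^'l. \<Sum>i\<in>UNIV. \<eta> $ i) \<in> borel_measurable borel"
    by (intro borel_measurable_continuous_onI continuous_intros)
  obtain \<kappa> D where \<kappa>: "\<kappa> > 0" and D: "D \<ge> 0" and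
    test: "\<And>J c. 0 < c \<Longrightarrow> c \<le> 1 \<Longrightarrow>
      (\<integral>\<^sup>+x. ennreal ((\<kappa> * (LINT z|lborel. dyadic u J z * ((1 + norm (diag z :: real^'n^'l)) powr (- s) * gauss (4 * c) (diag x - diag z :: real^'n^'l)))) powr p) \<partial>lborel)
        \<le> ennreal ((D * real J powr (1 / u) * c powr (- (CARD('n) / 2) / p)) powr p)"
    using test_bound[where L="\<lambda>\<eta>::real^'n^'l. \<Sum>i\<in>UNIV. \<eta> $ i" and L'=diag, OF \<Theta> supp pp p_def p u s bound Lm diag_measurable adj dn] by blast
  define c0 where "c0 = exp (- (pi * 9)) * (1 + 3 * sqrt CARD('l)) powr (- s) * exp (- (pi * (4 * CARD('l)))) * unit_ball_vol CARD('n)"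
  have c0: "c0 > 0" by (simp add: c0_def add_pos_nonneg less_imp_neq[THEN not_sym])
  define v where "v = unit_ball_vol ?n"
  have v: "v > 0" by (simp add: v_def)
  define t where "t = (\<kappa> * c0) powr p * v"
  have t: "t > 0" using \<kappa> c0 v by (simp add: t_def)
  show False
  proof (rule powr_growth_contradiction)
    show "t > 0" by fact
    show "p / u < 1" using p pu u by (simp add: divide_less_eq)
    fix J :: nat assume J: "J \<ge> 1"
    define F where "F x = ennreal ((\<kappa> * (LINT z|lborel. dyadic u J z * ((1 + norm (diag z :: real^'n^'l)) powr (- s) * gauss (4 * 1) (diag x - diag z :: real^'n^'l)))) powr p)" for x :: "real^'n"
    have Fm [measurable]: "F \<in> borel_measurable borel" unfolding F_def dyadic_def gauss_def by measurable
    have mi: "(\<lambda>x. F x * indicator A x) \<in> borel_measurable lborel" if "A \<in> sets borel" for A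
    proof -
      note [measurable] = that
      show ?thesis by measurable
    qed
    have step: "ennreal t \<le> (\<integral>\<^sup>+x. F x * indicator (cball 0 (2 ^ Suc i) - cball 0 (2 ^ i)) x \<partial>lborel)" if i: "i < J" for i
    proof -
      define R where "R = (2::real) ^ i"
      have R: "R \<ge> 1" by (simp add: R_def)
      let ?A = "cball (0::real^'n) (2 ^ Suc i) - cball 0 (2 ^ i)"
      define k where "k = (\<kappa> * (c0 * R powr (?n / u - ?n - s))) powr p"
      have "emeasure lborel ?A = emeasure lborel (cball (0::real^'n) (2 ^ Suc i)) - emeasure lborel (cball (0::real^'n) (2 ^ i))"
      proof (rule emeasure_Diff)
        show "cball (0::real^'n) (2 ^ i) \<subseteq> cball 0 (2 ^ Suc i)" by (intro subset_cball) simp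
      qed (auto simp: emeasure_cball)
      also have "\<dots> = ennreal (v * (2 * R) ^ CARD('n) - v * R ^ CARD('n))"
        using R v by (simp add: emeasure_cball v_def R_def ennreal_minus)
      also have "\<dots> \<ge> ennreal (v * R powr ?n)"
      proof (rule ennreal_leI)
        have "(2::real) ^ 1 \<le> 2 ^ CARD('n)" by (intro power_increasing) (auto simp: Suc_le_eq)
        then have "2 * (v * R ^ CARD('n)) \<le> 2 ^ CARD('n) * (v * R ^ CARD('n))"
          using v R by (intro mult_right_mono) auto
        then show "v * R powr ?n \<le> v * (2 * R) ^ CARD('n) - v * R ^ CARD('n)"
          using R by (simp add: powr_realpow power_mult_distrib mult_ac)
      qed
      finally have em: "ennreal (v * R powr ?n) \<le> emeasure lborel ?A" .
      have "t \<le> k * (v * R powr ?n)"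
      proof -
        \<comment> \<open>The exponent collects \<open>n\<close> from the volume of the annulus and
          \<open>p\<close> times the exponent of the pointwise bound; the negated conclusion says
          precisely that it is nonnegative.\<close>
        have "1 \<le> R powr (?n - p * (s + ?n - ?n / u))"
        proof (rule ge_one_powr_ge_zero[OF R])
          have "p * (s + ?n - ?n / u) \<le> p * (?n / p)" using sn p by (intro mult_left_mono) auto
          then show "0 \<le> ?n - p * (s + ?n - ?n / u)" using p by simp
        qed
        also have "R powr (?n - p * (s + ?n - ?n / u)) = (R powr (?n / u - ?n - s)) powr p * R powr ?n"
          by (simp add: powr_powr powr_add[symmetric] algebra_simps)
        finally have "t * 1 \<le> t * ((R powr (?n / u - ?n - s)) powr p * R powr ?n)"
          using t by (intro mult_left_mono) auto
        then show ?thesis by (simp add: t_def k_def powr_mult mult_ac)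
      qed
      then have "ennreal t \<le> ennreal k * ennreal (v * R powr ?n)"
        by (simp add: ennreal_mult'[symmetric] ennreal_leI k_def)
      also have "\<dots> \<le> ennreal k * emeasure lborel ?A" by (intro mult_left_mono em) auto
      also have "\<dots> = (\<integral>\<^sup>+x. ennreal k * indicator ?A x \<partial>lborel)" by (simp add: nn_integral_cmult_indicator)
      also have "\<dots> \<le> (\<integral>\<^sup>+x. F x * indicator ?A x \<partial>lborel)"
      proof (rule nn_integral_mono)
        fix x :: "real^'n"
        show "ennreal k * indicator ?A x \<le> F x * indicator ?A x"
        proof (cases "x \<in> ?A")
          case True
          then have x: "2 ^ i \<le> norm x" "norm x \<le> 2 ^ Suc i" by auto
          have "c0 * R powr (?n / u - ?n - s) \<le> (LINT z|lborel. dyadic u J z * ((1 + norm (diag z :: real^'n^'l)) powr (- s) * gauss (4 * 1) (diag x - diag z :: real^'n^'l)))"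
            unfolding c0_def R_def by (rule dyadic_diagonal_ge[OF _ i x]) (use s in simp)
          then have "k \<le> (\<kappa> * (LINT z|lborel. dyadic u J z * ((1 + norm (diag z :: real^'n^'l)) powr (- s) * gauss (4 * 1) (diag x - diag z :: real^'n^'l)))) powr p"
            unfolding k_def using \<kappa> c0 p by (intro powr_mono2 mult_left_mono) auto
          then show ?thesis using True unfolding F_def by (simp add: ennreal_leI)
        qed simp
      qed
      finally show ?thesis .
    qed
    \<comment> \<open>The annuli of index below \<open>k\<close> fill the ball of radius
      \<open>2^k\<close> up to the unit ball, whose mass is discarded at
      \<open>k = 0\<close>.\<close>
    have "ennreal (t * real k) \<le> (\<integral>\<^sup>+x. F x * indicator (cball 0 (2 ^ k)) x \<partial>lborel)" if "k \<le> J" for k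
      using that
    proof (induction k)
      case (Suc k)
      have sub: "cball (0::real^'n) (2 ^ k) \<subseteq> cball 0 (2 ^ Suc k)" by (intro subset_cball) simp
      have "ennreal (t * real (Suc k)) = ennreal (t * real k) + ennreal t"
        using t by (simp add: ennreal_plus[symmetric] distrib_left add.commute del: ennreal_plus)
      also have "\<dots> \<le> (\<integral>\<^sup>+x. F x * indicator (cball 0 (2 ^ k)) x \<partial>lborel) + (\<integral>\<^sup>+x. F x * indicator (cball 0 (2 ^ Suc k) - cball 0 (2 ^ k)) x \<partial>lborel)"
        using Suc by (intro add_mono step) auto
      also have "\<dots> = (\<integral>\<^sup>+x. F x * indicator (cball 0 (2 ^ k)) x + F x * indicator (cball 0 (2 ^ Suc k) - cball 0 (2 ^ k)) x \<partial>lborel)"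
        by (intro nn_integral_add[symmetric] mi) auto
      also have "\<dots> = (\<integral>\<^sup>+x. F x * indicator (cball 0 (2 ^ Suc k)) x \<partial>lborel)"
        using sub by (intro nn_integral_cong) (auto simp: indicator_def)
      finally show ?case .
    qed simp
    from this[of J] have "ennreal (t * real J) \<le> (\<integral>\<^sup>+x. F x * indicator (cball 0 (2 ^ J)) x \<partial>lborel)" by simp
    also have "\<dots> \<le> (\<integral>\<^sup>+x. F x \<partial>lborel)" by (intro nn_integral_mono) (auto simp: indicator_def)
    also have "\<dots> \<le> ennreal ((D * real J powr (1 / u) * 1 powr (- (CARD('n) / 2) / p)) powr p)"
      unfolding F_def by (rule test) auto
    also have "(D * real J powr (1 / u) * 1 powr (- (CARD('n) / 2) / p)) powr p = D powr p * real J powr (p / u)"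
      by (simp add: powr_mult powr_powr)
    finally have "t * real J \<le> D powr p * real J powr (p / u)" by (subst (asm) ennreal_le_iff) auto
    then show "t * real J powr 1 \<le> D powr p * real J powr (p / u)" by simp
  qed
qed

theorem theorem6p3:
  fixes \<Theta> :: "real^'n^'l \<Rightarrow> complex"
    and pp :: "'l \<Rightarrow> real"
    and p u u' s :: real
  assumes Theta_schwartz: "schwartz \<Theta>"
    and Theta_supp: "\<And>\<xi>. fourier \<Theta> \<xi> \<noteq> 0 \<Longrightarrow> 1/2 \<le> norm \<xi> \<and> norm \<xi> \<le> 2"
    and pp_pos: "\<And>i. 0 < pp i"
    and p_def: "1 / p = (\<Sum>i\<in>UNIV. 1 / pp i)"
    and u_gt: "1 < u"
    and u'_def: "1 / u + 1 / u' = 1"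
    and s_pos: "0 < s"
    and bound: "\<exists>C. \<forall>m :: real^'n^'l \<Rightarrow> complex.
                   m \<in> borel_measurable lborel \<and> bounded (range m) \<and> A_norm \<Theta> u s m < \<infinity> \<longrightarrow>
                   (\<forall>f :: 'l \<Rightarrow> real^'n \<Rightarrow> complex. (\<forall>i. schwartz (f i)) \<longrightarrow>
                      lp_norm p (T_mult m f) \<le> ennreal C * A_norm \<Theta> u s m * (\<Prod>i\<in>UNIV. lp_norm (pp i) (f i)))"
  shows "s / real CARD('n) > max (real CARD('l) / u) (1 / p - 1 / u')"
proof -
  let ?n = "real CARD('n)"
  have "0 < (\<Sum>i\<in>UNIV. 1 / pp i)" using pp_pos by (intro sum_pos) auto
  then have p: "p > 0" unfolding p_def[symmetric] by simp
  obtain C where C: "\<And>m f. m \<in> borel_measurable lborel \<Longrightarrow> bounded (range m) \<Longrightarrow> A_norm \<Theta> u s m < \<infinity> \<Longrightarrow> (\<forall>i. schwartz (f i)) \<Longrightarrow>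
        lp_norm p (T_mult m f) \<le> ennreal C * A_norm \<Theta> u s m * (\<Prod>i\<in>UNIV. lp_norm (pp i) (f i))"
    using bound by blast
  have "real (CARD('l) * CARD('n)) / u < s"
    by (rule smoothness_gt_isotropic[OF Theta_schwartz Theta_supp pp_pos p_def p u_gt s_pos C])
  then have 1: "real CARD('l) / u < s / ?n" by (simp add: field_simps)
  have "1 / p - 1 / u' < s / ?n"
  proof (cases "p < u")
    case True
    have "?n / p - ?n + ?n / u < s"
      by (rule smoothness_gt_diagonal[OF Theta_schwartz Theta_supp pp_pos p_def p True u_gt s_pos C])
    moreover have "?n / p - ?n + ?n / u = (1 / p - 1 / u') * ?n"
      using u'_def by (simp add: algebra_simps) (metis add_diff_cancel_left' diff_add_cancel mult.commute mult.right_neutral right_diff_distrib times_divide_eq_right)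
    ultimately show ?thesis by (simp add: less_divide_eq)
  next
    case False
    \<comment> \<open>The first condition dominates here because there is at least one block and
      \<open>1 / u'\<close> is positive.\<close>
    have "1 / p \<le> 1 / u" using False u_gt by (intro divide_left_mono) auto
    also have "1 / u \<le> real CARD('l) / u" using u_gt by (intro divide_right_mono) (auto simp: Suc_le_eq)
    finally have "1 / p < s / ?n" using 1 by simp
    moreover have "1 / u < 1" using u_gt by simp
    then have "1 / u' > 0" using u'_def by linarith
    ultimately show ?thesis by linarith
  qed
  with 1 show ?thesis by simp
qed

end
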